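(* Consider the linear Gaussian state-space model $x_k=A_kx_{k-1}+q_k$ ($k=1,\dots,T$), $y_k=C_kx_k+r_k$ ($k=0,\dots,T$), with independent white Gaussian noises $q_k\sim\mathcal{N}(0,Q_k)$, $r_k\sim\mathcal{N}(0,R_k)$ and $x_0\sim\mathcal{N}(0,P_0)$ independent of them; let $\alpha_0,\dots,\alpha_T\ge0$. Let $\mathcal{J}_0^T=(\mathcal{J}_0,\dots,\mathcal{J}_T)$ be jointly distributed with $Y_0^T=(y_0,\dots,y_T)$ (and conditionally independent of $x_0,\dots,x_T$ given $Y_0^T$) such that: (i) $\mathcal{J}_0^T\sim\mathcal{N}\big(0,\operatorname{diag}\{P_0,Q_1,\dots,Q_T\}\big)$; (ii) $\mathcal{J}_k$ is conditionally independent of $y_{k+n}$ given $Y_0^k$ for all $k\in[0,T]$ and $n\ge1$; (iii) $\sum_{k=0}^T\alpha_k\mathbb{E}\|x_k-\chi_k\|^2=\mathcal{C}$, where $\chi_0=\mathcal{J}_0$ and $\chi_k=A_k\chi_{k-1}+\mathcal{J}_k$. Then there exists a jointly Gaussian distribution of $(J_0^T,Y_0^T)$ (with $Y_0^T$ having its given law and $J_0^T$ conditionally independent of $x_0,\dots,x_T$ given $Y_0^T$) for which (i) and (ii) hold with $J$ in place of $\mathcal{J}$, and the estimator $\hat x_0=J_0$, $\hat x_k=A_k\hat x_{k-1}+J_k$ satisfies $\sum_{k=0}^T\alpha_k\mathbb{E}\|x_k-\hat x_k\|^2=\mathcal{C}$. Furthermore, one can write $$J_k=\pi_k\mathcal{I}_k+\phi_k\upsilon_k+w_k,\qquad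 \upsilon_k=\mathcal{I}_0^{k-1}-\mathbb{E}\big[\mathcal{I}_0^{k-1}\mid J_0^{k-1}\big],$$ for deterministic matrices $\pi_k,\phi_k$, where $(w_k)$ is a white Gaussian sequence with $w_k$ independent of $Y_0^T$ and of $J_0^{k-1}$.
   Context: The innovation process is $\mathcal{I}_k=y_k-C_k\hat x^*_{k|k-1}$ with $\hat x^*_{k|k-1}=\mathbb{E}[x_k\mid y_0,\dots,y_{k-1}]$ and $\mathcal{I}_0=y_0$; $\mathcal{I}_0^{k-1}=(\mathcal{I}_0,\dots,\mathcal{I}_{k-1})$ and $J_0^{k-1}=(J_0,\dots,J_{k-1})$. *)

theory Defs
  imports "HOL-Probability.Probability"
begin

definition normal_rv :: "'a measure \<Rightarrow> ('a \<Rightarrow> real) \<Rightarrow> real \<Rightarrow> real \<Rightarrow> bool" where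
  "normal_rv M X mu s2 \<longleftrightarrow> X \<in> borel_measurable M \<and> s2 \<ge> 0 \<and>
     distr M borel X = (if s2 = 0 then return borel mu
                        else density lborel (normal_density mu (sqrt s2)))"

definition gauss_family :: "'a measure \<Rightarrow> 'i set \<Rightarrow> ('i \<Rightarrow> 'a \<Rightarrow> real) \<Rightarrow>
    ('i \<Rightarrow> real) \<Rightarrow> ('i \<Rightarrow> 'i \<Rightarrow> real) \<Rightarrow> bool" where
  "gauss_family M S Z mu K \<longleftrightarrow> finite S \<and> (\<forall>i\<in>S. Z i \<in> borel_measurable M) \<and>
     (\<forall>c :: 'i \<Rightarrow> real. normal_rv M (\<lambda>\<omega>. \<Sum>i\<in>S. c i * Z i \<omega>) (\<Sum>i\<in>S. c i * mu i)
                                   (\<Sum>i\<in>S. \<Sum>j\<in>S. c i * c j * K i j))"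

definition jointly_gaussian :: "'a measure \<Rightarrow> 'i set \<Rightarrow> ('i \<Rightarrow> 'a \<Rightarrow> real) \<Rightarrow> bool" where
  "jointly_gaussian M S Z \<longleftrightarrow> (\<exists>mu K. gauss_family M S Z mu K)"

definition gauss_vec :: "'a measure \<Rightarrow> ('a \<Rightarrow> real^'n::finite) \<Rightarrow> real^'n \<Rightarrow> real^'n^'n \<Rightarrow> bool" where
  "gauss_vec M X mu K \<longleftrightarrow> X \<in> borel_measurable M \<and>
     gauss_family M UNIV (\<lambda>i \<omega>. X \<omega> $ i) (\<lambda>i. mu $ i) (\<lambda>i j. K $ i $ j)"

definition vsa :: "'a measure \<Rightarrow> ('a \<Rightarrow> 'b::topological_space) \<Rightarrow> 'a set set" where
  "vsa M X = sigma_sets (space M) {X -` B \<inter> space M | B. B \<in> sets borel}"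

definition gen_sa :: "'a measure \<Rightarrow> 'i set \<Rightarrow> ('i \<Rightarrow> 'a \<Rightarrow> 'b::topological_space) \<Rightarrow> 'a set set" where
  "gen_sa M S X = (\<Union>i\<in>S. {X i -` B \<inter> space M | B. B \<in> sets borel})"

definition cond_indep :: "'a measure \<Rightarrow> 'a set set \<Rightarrow> 'a set set \<Rightarrow> 'a set set \<Rightarrow> bool" where
  "cond_indep M G1 G2 H \<longleftrightarrow>
     (\<forall>A\<in>sigma_sets (space M) G1. \<forall>B\<in>sigma_sets (space M) G2.
        AE \<omega> in M. real_cond_exp M (sigma (space M) H) (indicator (A \<inter> B)) \<omega> =
                   real_cond_exp M (sigma (space M) H) (indicator A) \<omega> *
                   real_cond_exp M (sigma (space M) H) (indicator B) \<omega>)"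

definition vcond_exp :: "'a measure \<Rightarrow> 'a measure \<Rightarrow> ('a \<Rightarrow> real^'n::finite) \<Rightarrow> 'a \<Rightarrow> real^'n" where
  "vcond_exp M F X = (\<lambda>\<omega>. \<chi> i. real_cond_exp M F (\<lambda>\<omega>. X \<omega> $ i) \<omega>)"

definition innov :: "'a measure \<Rightarrow> (nat \<Rightarrow> real^'n::finite^'m::finite) \<Rightarrow> (nat \<Rightarrow> 'a \<Rightarrow> real^'n)
    \<Rightarrow> (nat \<Rightarrow> 'a \<Rightarrow> real^'m) \<Rightarrow> nat \<Rightarrow> 'a \<Rightarrow> real^'m" where
  "innov M C x y k = (if k = 0 then y 0 else
     (\<lambda>\<omega>. y k \<omega> - C k *v vcond_exp M (sigma (space M) (gen_sa M {..<k} y)) (x k) \<omega>))"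

text \<open>j-th block (j < k) of upsilon_k = I_0^{k-1} - E[I_0^{k-1} | J_0^{k-1}].\<close>
definition upsilon :: "'a measure \<Rightarrow> (nat \<Rightarrow> real^'n::finite^'m::finite) \<Rightarrow> (nat \<Rightarrow> 'a \<Rightarrow> real^'n)
    \<Rightarrow> (nat \<Rightarrow> 'a \<Rightarrow> real^'m) \<Rightarrow> (nat \<Rightarrow> 'a \<Rightarrow> real^'n) \<Rightarrow> nat \<Rightarrow> nat \<Rightarrow> 'a \<Rightarrow> real^'m" where
  "upsilon M C x y J k j = (\<lambda>\<omega>. innov M C x y j \<omega> -
       vcond_exp M (sigma (space M) (gen_sa M {..<k} J)) (innov M C x y j) \<omega>)"

fun est :: "(nat \<Rightarrow> real^'n^'n) \<Rightarrow> (nat \<Rightarrow> 'a \<Rightarrow> real^'n) \<Rightarrow> nat \<Rightarrow> 'a \<Rightarrow> real^'n" where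
  "est A J 0 \<omega> = J 0 \<omega>"
| "est A J (Suc k) \<omega> = A (Suc k) *v est A J k \<omega> + J (Suc k) \<omega>"

definition wmse :: "'a measure \<Rightarrow> (nat \<Rightarrow> real) \<Rightarrow> (nat \<Rightarrow> 'a \<Rightarrow> real^'n::finite) \<Rightarrow>
    (nat \<Rightarrow> 'a \<Rightarrow> real^'n) \<Rightarrow> nat \<Rightarrow> real" where
  "wmse M \<alpha> x xh T = (\<Sum>k\<le>T. \<alpha> k * (\<integral>\<omega>. (norm (x k \<omega> - xh k \<omega>))^2 \<partial>M))"

definition lgssm :: "'a measure \<Rightarrow> nat \<Rightarrow> (nat \<Rightarrow> real^'n::finite^'n) \<Rightarrow> (nat \<Rightarrow> real^'n^'m::finite)
    \<Rightarrow> real^'n^'n \<Rightarrow> (nat \<Rightarrow> real^'n^'n) \<Rightarrow> (nat \<Rightarrow> real^'m^'m)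
    \<Rightarrow> (nat \<Rightarrow> 'a \<Rightarrow> real^'n) \<Rightarrow> (nat \<Rightarrow> 'a \<Rightarrow> real^'m)
    \<Rightarrow> (nat \<Rightarrow> 'a \<Rightarrow> real^'n) \<Rightarrow> (nat \<Rightarrow> 'a \<Rightarrow> real^'m) \<Rightarrow> bool" where
  "lgssm M T A C P0 Q R x y q r \<longleftrightarrow> prob_space M \<and>
     (\<forall>k\<le>T. x k \<in> borel_measurable M \<and> y k \<in> borel_measurable M) \<and>
     (\<forall>k\<in>{1..T}. \<forall>\<omega>\<in>space M. x k \<omega> = A k *v x (k - 1) \<omega> + q k \<omega>) \<and>
     (\<forall>k\<le>T. \<forall>\<omega>\<in>space M. y k \<omega> = C k *v x k \<omega> + r k \<omega>) \<and>
     gauss_vec M (x 0) 0 P0 \<and>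
     (\<forall>k\<in>{1..T}. gauss_vec M (q k) 0 (Q k)) \<and>
     (\<forall>k\<le>T. gauss_vec M (r k) 0 (R k)) \<and>
     prob_space.indep_sets M
       (\<lambda>i. case i of Inl k \<Rightarrow> (if k = 0 then vsa M (x 0) else vsa M (q k)) | Inr k \<Rightarrow> vsa M (r k))
       (Inl ` {..T} \<union> Inr ` {..T})"

definition admissible :: "'a measure \<Rightarrow> nat \<Rightarrow> real^'n::finite^'n \<Rightarrow> (nat \<Rightarrow> real^'n^'n)
    \<Rightarrow> (nat \<Rightarrow> 'a \<Rightarrow> real^'n) \<Rightarrow> (nat \<Rightarrow> 'a \<Rightarrow> real^'m::finite) \<Rightarrow> (nat \<Rightarrow> 'a \<Rightarrow> real^'n) \<Rightarrow> bool" where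
  "admissible M T P0 Q x y J \<longleftrightarrow>
     (\<forall>k\<le>T. J k \<in> borel_measurable M) \<and>
     cond_indep M (gen_sa M {..T} J) (gen_sa M {..T} x) (gen_sa M {..T} y) \<and>
     gauss_family M ({..T} \<times> UNIV) (\<lambda>(k, i) \<omega>. J k \<omega> $ i) (\<lambda>_. 0)
       (\<lambda>(k, i) (l, j). if k = l then (if k = 0 then P0 else Q k) $ i $ j else 0) \<and>
     (\<forall>k\<le>T. \<forall>n\<ge>1. k + n \<le> T \<longrightarrow>
        cond_indep M (gen_sa M {k} J) (gen_sa M {k + n} y) (gen_sa M {..k} y))"

definition joint_law :: "'a measure \<Rightarrow> nat \<Rightarrow> (nat \<Rightarrow> 'a \<Rightarrow> real^'n::finite) \<Rightarrow> (nat \<Rightarrow> 'a \<Rightarrow> real^'m::finite)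
    \<Rightarrow> ((nat \<Rightarrow> real^'n) \<times> (nat \<Rightarrow> real^'m)) measure" where
  "joint_law M T x y = distr M (PiM {..T} (\<lambda>_. borel) \<Otimes>\<^sub>M PiM {..T} (\<lambda>_. borel))
      (\<lambda>\<omega>. (\<lambda>k\<in>{..T}. x k \<omega>, \<lambda>k\<in>{..T}. y k \<omega>))"

end

theory Submission
  imports Defs
begin

text \<open>
  Everything reduces to second moments. The triple \<open>(x, y, J\<^sub>c)\<close> is square integrable, so there is a
  centered Gaussian triple \<open>(x', y', J)\<close> with the same covariance; it is realized by a Cholesky factor
  applied to independent standard normals. The law of \<open>(x, y)\<close> and the cost depend on that
  covariance only. Conditional independence of \<open>J\<^sub>c\<close> in the original space implies that the
  corresponding projection residuals are uncorrelated with \<open>J\<^sub>c\<close>; this transfers to \<open>J\<close>, where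
  uncorrelated means independent, and so gives conditional independence back.

  For the representation, let \<open>w\<^sub>k\<close> be the residual of projecting \<open>J\<^sub>k\<close> onto the linear span of
  the innovation \<open>I\<^sub>k\<close> and of \<open>\<upsilon>\<^sub>k\<close>. Causality makes \<open>J\<^sub>l\<close> orthogonal to \<open>I\<^sub>k\<close> for
  \<open>l < k\<close>, and \<open>J\<close> is white. Hence the past inputs, \<open>I\<^sub>k\<close>, \<open>\<upsilon>\<^sub>k\<close> and the later
  innovations are mutually orthogonal and together span all outputs and past inputs, so \<open>w\<^sub>k\<close> is
  orthogonal to the latter and therefore independent of them.
\<close>

section \<open>Finite families of variables are determined by their characteristic function\<close>

text \<open>Two obstacles shape the proof. The given input is Gaussian by itself but not jointly
  with the outputs; it may even be a nonlinear function of them, so the original space need not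
  carry the randomness that a Gaussian input requires. Hence a fresh space, and equality in law
  instead of equality of variables. Covariances can record conditional independence because state
  and outputs are jointly Gaussian already in the original space. There the conditional expectation
  given outputs is a linear projection, so its residual is a linear combination whose coefficients
  make sense on the new space too, and only its orthogonality to the input has to be carried
  over.\<close>

lemma finite_measure_density_bounded:
  fixes u :: "'a \<Rightarrow> real"
  assumes "finite_measure M" "u \<in> borel_measurable M" "\<And>\<omega>. 0 \<le> u \<omega>" "\<And>\<omega>. u \<omega> \<le> B"
  shows "finite_measure (density M (\<lambda>\<omega>. ennreal (u \<omega>)))"
proof -
  interpret finite_measure M by fact
  have "integrable M u"
    by (rule integrable_const_bound[of _ B]) (use assms in auto)
  then have "(\<integral>\<^sup>+\<omega>. ennreal (u \<omega>) \<partial>M) < \<infinity>"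
    using assms by (simp add: integrable_iff_bounded)
  then show ?thesis
    using assms(2) by (intro finite_measureI) (auto simp: emeasure_density cong: nn_integral_cong)
qed

lemma measure_density_bounded:
  fixes u :: "'a \<Rightarrow> real"
  assumes "finite_measure M" "u \<in> borel_measurable M" "\<And>\<omega>. 0 \<le> u \<omega>" "\<And>\<omega>. u \<omega> \<le> B" "E \<in> sets M"
  shows "measure (density M (\<lambda>\<omega>. ennreal (u \<omega>))) E = (\<integral>\<omega>. u \<omega> * indicator E \<omega> \<partial>M)"
proof -
  interpret D: finite_measure "density M (\<lambda>\<omega>. ennreal (u \<omega>))"
    by (rule finite_measure_density_bounded) (use assms in auto)
  have "measure (density M (\<lambda>\<omega>. ennreal (u \<omega>))) E
      = (\<integral>\<omega>. indicator E \<omega> \<partial>density M (\<lambda>\<omega>. ennreal (u \<omega>)))"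
    using assms(5) by simp
  also have "\<dots> = (\<integral>\<omega>. u \<omega> * indicator E \<omega> \<partial>M)"
    by (subst integral_density) (use assms in auto)
  finally show ?thesis .
qed

text \<open>Levy's uniqueness theorem speaks of probability laws. Equality at \<open>t = 0\<close>
  makes the total masses equal, so both measures can be normalized by the same factor; mass zero is
  trivial.\<close>

lemma measure_eq_if_char_eq:
  assumes "finite_measure M" "finite_measure N" and [measurable_cong]: "sets N = sets M"
    and X [measurable]: "X \<in> borel_measurable M"
    and char: "\<And>t. (\<integral>\<omega>. iexp (t * X \<omega>) \<partial>M) = (\<integral>\<omega>. iexp (t * X \<omega>) \<partial>N)"
    and B [measurable]: "B \<in> sets borel"
  shows "measure M (X -` B \<inter> space M) = measure N (X -` B \<inter> space M)"
proof -
  interpret M: finite_measure M by fact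
  interpret N: finite_measure N by fact
  have sp: "space N = space M" using assms(3) by (rule sets_eq_imp_space_eq)
  have X' [measurable]: "X \<in> borel_measurable N"
    using X by (simp add: measurable_cong_sets[OF assms(3) refl])
  define m where "m = measure M (space M)"
  have m: "measure N (space M) = m"
    using char[of 0] by (simp add: m_def sp)
  show ?thesis
  proof (cases "m = 0")
    case True
    have "measure M (X -` B \<inter> space M) \<le> m" unfolding m_def by (rule M.finite_measure_mono) auto
    moreover have "measure N (X -` B \<inter> space M) \<le> m" unfolding m[symmetric] sp[symmetric]
      by (rule N.finite_measure_mono) auto
    ultimately show ?thesis using True measure_nonneg[of M] measure_nonneg[of N]
      by (metis antisym)
  next
    case False
    then have m0: "m > 0" using measure_nonneg[of M] by (simp add: m_def less_le)
    define D where "D L = density L (\<lambda>\<omega>. ennreal (1 / m))" for L :: "'a measure"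
    have D: "real_distribution (distr (D L) borel X) \<and>
      char (distr (D L) borel X) t = (\<integral>\<omega>. iexp (t * X \<omega>) \<partial>L) / m \<and>
      measure (distr (D L) borel X) B = measure L (X -` B \<inter> space M) / m"
      if fin: "finite_measure L" and [measurable_cong]: "sets L = sets M" and mL: "measure L (space M) = m" for L t
    proof -
      interpret L: finite_measure L by fact
      have spL: "space L = space M" using that(2) by (rule sets_eq_imp_space_eq)
      have [measurable]: "X \<in> borel_measurable L"
        using X by (simp add: measurable_cong_sets[OF that(2) refl])
      have e: "measure (D L) E = measure L E / m" if [measurable]: "E \<in> sets L" for E
        unfolding D_def by (subst measure_density_bounded[OF fin, where B="1/m"]) (use m0 in auto)
      have fD: "finite_measure (D L)" unfolding D_def
        by (rule finite_measure_density_bounded[OF fin, where B="1/m"]) (use m0 in auto)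
      interpret DD: finite_measure "D L" by fact
      have "prob_space (D L)"
        using e[of "space L"] mL m0 spL DD.emeasure_eq_measure by (intro prob_spaceI) (simp add: D_def)
      then have 1: "real_distribution (distr (D L) borel X)"
        by (intro prob_space.real_distribution_distr) (auto simp: D_def)
      have "char (distr (D L) borel X) t = (\<integral>\<omega>. iexp (t * X \<omega>) \<partial>L) / m"
        unfolding char_def
        apply (subst integral_distr)
          apply (auto simp: D_def)
        apply (subst integral_density)
           apply (use m0 in auto)
        by (simp add: scaleR_conv_of_real divide_inverse mult.commute)
      moreover have "measure (distr (D L) borel X) B = measure L (X -` B \<inter> space M) / m"
        by (subst measure_distr) (auto simp: D_def[symmetric] spL e, auto simp: D_def spL e[unfolded D_def])
      ultimately show ?thesis using 1 by simp
    qed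
    have "distr (D M) borel X = distr (D N) borel X"
      by (rule Levy_uniqueness)
        (use D[OF assms(1) refl] D[OF assms(2) assms(3) m] char in \<open>auto simp: m_def\<close>)
    then show ?thesis
      using D[OF assms(1) refl] D[OF assms(2) assms(3) m] m0 by (auto simp: m_def)
  qed
qed

text \<open>A signed weight is not a density, but \<open>2 + u\<close> takes values in [1, 3]. The
  two measures reweighted by it have equal characteristic functions of \<open>X\<close>; subtracting
  twice the unweighted equality leaves the claim for \<open>u\<close>.\<close>

lemma integral_weight_eq_if_char_eq:
  fixes u :: "'a \<Rightarrow> real"
  assumes "finite_measure M" "finite_measure N" and ss: "sets N = sets M"
    and X [measurable]: "X \<in> borel_measurable M" and u [measurable]: "u \<in> borel_measurable M"
    and ub: "\<And>\<omega>. \<bar>u \<omega>\<bar> \<le> 1"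
    and char: "\<And>t. (\<integral>\<omega>. iexp (t * X \<omega>) \<partial>M) = (\<integral>\<omega>. iexp (t * X \<omega>) \<partial>N)"
    and charu: "\<And>t. (\<integral>\<omega>. u \<omega> *\<^sub>R iexp (t * X \<omega>) \<partial>M) = (\<integral>\<omega>. u \<omega> *\<^sub>R iexp (t * X \<omega>) \<partial>N)"
    and B [measurable]: "B \<in> sets borel"
  shows "(\<integral>\<omega>. u \<omega> * indicator (X -` B \<inter> space M) \<omega> \<partial>M) = (\<integral>\<omega>. u \<omega> * indicator (X -` B \<inter> space M) \<omega> \<partial>N)"
proof -
  let ?E = "X -` B \<inter> space M"
  let ?D = "\<lambda>L. density L (\<lambda>\<omega>. ennreal (2 + u \<omega>))"
  have sp: "space N = space M" using ss by (rule sets_eq_imp_space_eq)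
  have u0: "0 \<le> 2 + u \<omega>" "2 + u \<omega> \<le> 3" for \<omega> using ub[of \<omega>] by linarith+
  have I: "(\<integral>\<omega>. iexp (t * X \<omega>) \<partial>?D L) = 2 * (\<integral>\<omega>. iexp (t * X \<omega>) \<partial>L) + (\<integral>\<omega>. u \<omega> *\<^sub>R iexp (t * X \<omega>) \<partial>L)
     \<and> measure (?D L) ?E = 2 * measure L ?E + (\<integral>\<omega>. u \<omega> * indicator ?E \<omega> \<partial>L) \<and> finite_measure (?D L)"
    if fin: "finite_measure L" and sL [measurable_cong]: "sets L = sets M" for L t
  proof -
    interpret L: finite_measure L by fact
    have spL: "space L = space M" using sL by (rule sets_eq_imp_space_eq)
    have [measurable]: "X \<in> borel_measurable L" "u \<in> borel_measurable L"
      using X u by (simp_all add: measurable_cong_sets[OF sL refl])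
    have E [measurable]: "?E \<in> sets L" unfolding spL[symmetric] by measurable
    have i1: "integrable L (\<lambda>\<omega>. iexp (t * X \<omega>))"
      by (rule L.integrable_const_bound[of _ 1]) auto
    have i2: "integrable L (\<lambda>\<omega>. u \<omega> *\<^sub>R iexp (t * X \<omega>))"
      by (rule L.integrable_const_bound[of _ 1]) (use ub in auto)
    have i3: "integrable L (\<lambda>\<omega>. indicator ?E \<omega> :: real)"
      by (rule L.integrable_const_bound[of _ 1]) auto
    have i4: "integrable L (\<lambda>\<omega>. u \<omega> * indicator ?E \<omega> :: real)"
      by (rule L.integrable_const_bound[of _ 1]) (use ub in \<open>auto simp: indicator_def abs_mult\<close>)
    have "(\<integral>\<omega>. iexp (t * X \<omega>) \<partial>?D L) = (\<integral>\<omega>. (2 + u \<omega>) *\<^sub>R iexp (t * X \<omega>) \<partial>L)"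
      by (rule integral_density) (use u0 in auto)
    also have "\<dots> = (\<integral>\<omega>. 2 * iexp (t * X \<omega>) + u \<omega> *\<^sub>R iexp (t * X \<omega>) \<partial>L)"
      by (simp add: scaleR_conv_of_real algebra_simps)
    also have "\<dots> = 2 * (\<integral>\<omega>. iexp (t * X \<omega>) \<partial>L) + (\<integral>\<omega>. u \<omega> *\<^sub>R iexp (t * X \<omega>) \<partial>L)"
      using i1 i2 by simp
    finally have 1: "(\<integral>\<omega>. iexp (t * X \<omega>) \<partial>?D L) = 2 * (\<integral>\<omega>. iexp (t * X \<omega>) \<partial>L) + (\<integral>\<omega>. u \<omega> *\<^sub>R iexp (t * X \<omega>) \<partial>L)" .
    have "measure (?D L) ?E = (\<integral>\<omega>. (2 + u \<omega>) * indicator ?E \<omega> \<partial>L)"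
      by (rule measure_density_bounded[OF fin, where B=3]) (use u0 in auto)
    also have "\<dots> = 2 * measure L ?E + (\<integral>\<omega>. u \<omega> * indicator ?E \<omega> \<partial>L)"
      using i3 i4 by (simp add: distrib_right spL[symmetric])
    finally show ?thesis using 1 finite_measure_density_bounded[OF fin, of "\<lambda>\<omega>. 2 + u \<omega>" 3] u0 by simp
  qed
  note IM = I[OF assms(1) refl] and IN = I[OF assms(2) ss]
  have *: "measure K ?E = measure K' ?E"
    if "finite_measure K" "finite_measure K'" "sets K = sets M" "sets K' = sets M"
      "\<And>t. (\<integral>\<omega>. iexp (t * X \<omega>) \<partial>K) = (\<integral>\<omega>. iexp (t * X \<omega>) \<partial>K')" for K K' :: "'a measure"
  proof -
    have "space K = space M" using that(3) by (rule sets_eq_imp_space_eq)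
    moreover have "X \<in> borel_measurable K" using X by (simp add: measurable_cong_sets[OF that(3) refl])
    ultimately show ?thesis using measure_eq_if_char_eq[of K K' X B] that by simp
  qed
  have "measure M ?E = measure N ?E" by (rule *) (use assms in auto)
  moreover have "measure (?D M) ?E = measure (?D N) ?E"
    by (rule *) (use IM IN char charu ss in auto)
  ultimately show ?thesis using IM IN by simp
qed

text \<open>Induction on the number of coordinates: restricting both measures to \<open>Z i \<in> B i\<close> preserves
  equality of the characteristic functions of the remaining coordinates.\<close>

lemma cramer_wold_rectangles:
  fixes Z :: "'i \<Rightarrow> 'a \<Rightarrow> real"
  assumes "finite S" "finite_measure M" "finite_measure N" "sets N = sets M"
    and "\<And>i. i \<in> S \<Longrightarrow> Z i \<in> borel_measurable M"
    and "\<And>c. (\<integral>\<omega>. iexp (\<Sum>i\<in>S. c i * Z i \<omega>) \<partial>M) = (\<integral>\<omega>. iexp (\<Sum>i\<in>S. c i * Z i \<omega>) \<partial>N)"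
    and "\<And>i. i \<in> S \<Longrightarrow> B i \<in> sets borel"
  shows "measure M {\<omega>\<in>space M. \<forall>i\<in>S. Z i \<omega> \<in> B i} = measure N {\<omega>\<in>space M. \<forall>i\<in>S. Z i \<omega> \<in> B i}"
  using assms
proof (induction S arbitrary: M N rule: finite_induct)
  case empty
  then interpret M: finite_measure M + N: finite_measure N by auto
  have sp: "space N = space M" using empty by (intro sets_eq_imp_space_eq)
  show ?case using empty.prems(5) by (simp add: sp)
next
  case (insert i S)
  interpret M: finite_measure M by fact
  interpret N: finite_measure N by fact
  note ss = \<open>sets N = sets M\<close>
  have sp: "space N = space M" using ss by (rule sets_eq_imp_space_eq)
  have Z [measurable]: "Z j \<in> borel_measurable M" if "j \<in> insert i S" for j using insert.prems(4) that .
  have ZN: "Z j \<in> borel_measurable N" if "j \<in> insert i S" for j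
    using Z[OF that] by (simp add: measurable_cong_sets[OF ss refl])
  have [measurable]: "Z i \<in> borel_measurable M" "B i \<in> sets borel" using insert.prems by auto
  let ?E = "Z i -` B i \<inter> space M"
  have E [measurable]: "?E \<in> sets M" by measurable
  have EN: "?E \<in> sets N" using E ss by simp
  let ?D = "\<lambda>L. density L (\<lambda>\<omega>. ennreal (indicator ?E \<omega>))"
  \<comment> \<open>An arbitrary linear combination of the remaining coordinates. The induction
    hypothesis asks for its characteristic function under the restricted measures
    \<open>?D M\<close> and \<open>?D N\<close>.\<close>
  define V where "V c \<omega> = (\<Sum>j\<in>S. c j * Z j \<omega>)" for c :: "'i \<Rightarrow> real" and \<omega>
  have Vm [measurable]: "V c \<in> borel_measurable M" for c unfolding V_def by measurable
  have VmN: "V c \<in> borel_measurable N" for c using Vm[of c] by (simp add: measurable_cong_sets[OF ss refl])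
  have sS: "(\<Sum>j\<in>insert i S. (c(i := t)) j * Z j \<omega>) = t * Z i \<omega> + V c \<omega>" for c t \<omega>
  proof -
    have "(\<Sum>j\<in>S. (c(i := t)) j * Z j \<omega>) = V c \<omega>" unfolding V_def
      using insert.hyps by (intro sum.cong) auto
    then show ?thesis using insert.hyps by simp
  qed
  have ch: "(\<integral>\<omega>. iexp (t * Z i \<omega> + V c \<omega>) \<partial>M) = (\<integral>\<omega>. iexp (t * Z i \<omega> + V c \<omega>) \<partial>N)" for t c
    using insert.prems(5)[of "c(i := t)"] unfolding sS .
  have chm: "(\<integral>\<omega>. iexp (t * Z i \<omega> - V c \<omega>) \<partial>M) = (\<integral>\<omega>. iexp (t * Z i \<omega> - V c \<omega>) \<partial>N)" for t c
    using ch[of t "\<lambda>i. - c i"] by (simp add: V_def sum_negf)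
  have ch0: "(\<integral>\<omega>. iexp (t * Z i \<omega>) \<partial>M) = (\<integral>\<omega>. iexp (t * Z i \<omega>) \<partial>N)" for t
    using ch[of t "\<lambda>_. 0"] by (simp add: V_def)
  have integ: "integrable L (\<lambda>\<omega>. iexp (t * Z i \<omega> + V c \<omega>))" "integrable L (\<lambda>\<omega>. iexp (t * Z i \<omega> - V c \<omega>))"
    if "finite_measure L" "sets L = sets M" for L t c
  proof -
    interpret L: finite_measure L by fact
    have [measurable]: "Z i \<in> borel_measurable L" "V c \<in> borel_measurable L"
      using Z[of i] Vm by (simp_all add: measurable_cong_sets[OF that(2) refl])
    show "integrable L (\<lambda>\<omega>. iexp (t * Z i \<omega> + V c \<omega>))" "integrable L (\<lambda>\<omega>. iexp (t * Z i \<omega> - V c \<omega>))"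
      by (rule L.integrable_const_bound[of _ 1]; simp)+
  qed
  \<comment> \<open>The characteristic function of \<open>V c\<close> under the restriction to
    \<open>?E\<close> has real and imaginary parts with weights \<open>cos (V c)\<close> and
    \<open>sin (V c)\<close>, both bounded by 1. These product formulas express the weighted
    characteristic functions of \<open>Z i\<close> by unweighted ones of \<open>t * Z i\<close> plus
    or minus \<open>V c\<close>, which agree by assumption.\<close>
  have cosE: "cos v *\<^sub>R iexp z = (1/2) * (iexp (z + v) + iexp (z - v))"
    and sinE: "sin v *\<^sub>R iexp z = (- \<i>/2) * (iexp (z + v) - iexp (z - v))" for v z :: real
    unfolding cis_conv_exp[symmetric] by (auto simp: complex_eq_iff cos_add sin_add cos_diff sin_diff)
  have "(\<integral>\<omega>. cos (V c \<omega>) *\<^sub>R iexp (t * Z i \<omega>) \<partial>M) = (\<integral>\<omega>. cos (V c \<omega>) *\<^sub>R iexp (t * Z i \<omega>) \<partial>N)" for c t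
    unfolding cosE using integ[OF insert.prems(1) refl] integ[OF insert.prems(2) ss]
    by (simp add: ch[of t c] chm[of t c] del: of_real_add of_real_diff)
  then have wcos: "(\<integral>\<omega>. cos (V c \<omega>) * indicator ?E \<omega> \<partial>M) = (\<integral>\<omega>. cos (V c \<omega>) * indicator ?E \<omega> \<partial>N)" for c
    by (intro integral_weight_eq_if_char_eq) (use insert.prems ss ch0 in auto)
  have "(\<integral>\<omega>. sin (V c \<omega>) *\<^sub>R iexp (t * Z i \<omega>) \<partial>M) = (\<integral>\<omega>. sin (V c \<omega>) *\<^sub>R iexp (t * Z i \<omega>) \<partial>N)" for c t
    unfolding sinE using integ[OF insert.prems(1) refl] integ[OF insert.prems(2) ss]
    by (simp add: ch[of t c] chm[of t c] del: of_real_add of_real_diff)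
  then have wsin: "(\<integral>\<omega>. sin (V c \<omega>) * indicator ?E \<omega> \<partial>M) = (\<integral>\<omega>. sin (V c \<omega>) * indicator ?E \<omega> \<partial>N)" for c
    by (intro integral_weight_eq_if_char_eq) (use insert.prems ss ch0 in auto)
  have D: "(\<integral>\<omega>. iexp (V c \<omega>) \<partial>?D L) = Complex (\<integral>\<omega>. cos (V c \<omega>) * indicator ?E \<omega> \<partial>L) (\<integral>\<omega>. sin (V c \<omega>) * indicator ?E \<omega> \<partial>L)
     \<and> finite_measure (?D L) \<and> (\<forall>F\<in>sets M. measure (?D L) F = measure L (?E \<inter> F))"
    if fin: "finite_measure L" and sL: "sets L = sets M" for L c
  proof -
    interpret L: finite_measure L by fact
    have [measurable]: "V c \<in> borel_measurable L" using Vm by (simp_all add: measurable_cong_sets[OF sL refl])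
    have EL [measurable]: "?E \<in> sets L" using E sL by simp
    have int: "integrable L (\<lambda>\<omega>. indicator ?E \<omega> *\<^sub>R iexp (V c \<omega>))"
    proof (rule L.integrable_const_bound[of _ 1])
      show "AE \<omega> in L. norm (indicator ?E \<omega> *\<^sub>R iexp (V c \<omega>)) \<le> 1" by (simp add: indicator_def)
    qed measurable
    have "(\<integral>\<omega>. iexp (V c \<omega>) \<partial>?D L) = (\<integral>\<omega>. indicator ?E \<omega> *\<^sub>R iexp (V c \<omega>) \<partial>L)"
      by (rule integral_density) auto
    also have "\<dots> = Complex (\<integral>\<omega>. cos (V c \<omega>) * indicator ?E \<omega> \<partial>L) (\<integral>\<omega>. sin (V c \<omega>) * indicator ?E \<omega> \<partial>L)"
      using int unfolding cis_conv_exp[symmetric]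
      by (auto simp: complex_eq_iff mult.commute simp flip: integral_Re integral_Im)
    finally have 1: "(\<integral>\<omega>. iexp (V c \<omega>) \<partial>?D L) = \<dots>" .
    have "measure (?D L) F = measure L (?E \<inter> F)" if "F \<in> sets M" for F
    proof -
      have [measurable]: "F \<in> sets L" using that sL by simp
      have "measure (?D L) F = (\<integral>\<omega>. indicator (?E \<inter> F) \<omega> \<partial>L)"
        unfolding indicator_inter_arith[of ?E F]
        by (rule measure_density_bounded[OF fin, where B=1]) simp_all
      also have "\<dots> = measure L (?E \<inter> F)" using sets.sets_into_space[OF EL] by simp
      finally show ?thesis .
    qed
    with 1 finite_measure_density_bounded[OF fin, of "indicator ?E" 1] show ?thesis by auto
  qed
  let ?F = "{\<omega>\<in>space M. \<forall>j\<in>S. Z j \<omega> \<in> B j}"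
  have F: "?F \<in> sets M"
  proof -
    have "{\<omega> \<in> space M. Z j \<omega> \<in> B j} \<in> sets M" if "j \<in> S" for j
    proof -
      have [measurable]: "Z j \<in> borel_measurable M" "B j \<in> sets borel"
        using Z[of j] insert.prems(6)[of j] that by auto
      show ?thesis by measurable
    qed
    then show ?thesis using insert.hyps by (intro sets.sets_Collect_finite_All) auto
  qed
  have "measure (?D M) {\<omega>\<in>space (?D M). \<forall>j\<in>S. Z j \<omega> \<in> B j} = measure (?D N) {\<omega>\<in>space (?D M). \<forall>j\<in>S. Z j \<omega> \<in> B j}"
    using D[OF insert.prems(1) refl] D[OF insert.prems(2) ss] wcos wsin insert.prems ss
    by (intro insert.IH) (auto simp: V_def[symmetric])
  then have "measure (?D M) ?F = measure (?D N) ?F" by simp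
  then have "measure M (?E \<inter> ?F) = measure N (?E \<inter> ?F)"
    using D[OF insert.prems(1) refl] D[OF insert.prems(2) ss] F by simp
  moreover have "?E \<inter> ?F = {\<omega>\<in>space M. \<forall>j\<in>insert i S. Z j \<omega> \<in> B j}" by auto
  ultimately show ?case by simp
qed

section \<open>Centered normal variables\<close>

text \<open>Rescaling to variance one reduces this to the standard normal law, evaluated at
  \<open>t * \<sigma>\<close>.\<close>

lemma char_centered_normal:
  assumes "0 < \<sigma>"
  shows "char (density lborel (normal_density 0 \<sigma>)) t = of_real (exp (- (\<sigma>\<^sup>2 * t\<^sup>2) / 2))"
proof -
  let ?D = "density lborel (normal_density 0 \<sigma>)"
  interpret D: prob_space ?D using assms by (rule prob_space_normal_density)
  have "distributed ?D lborel (\<lambda>x. x) (normal_density 0 \<sigma>)"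
    unfolding distributed_def by (simp add: distr_id2)
  then have "distributed ?D lborel (\<lambda>x. x / \<sigma>) std_normal_density"
    using D.normal_standard_normal_convert[OF assms, of "\<lambda>x. x" 0] by simp
  then have "distr ?D lborel (\<lambda>x. x / \<sigma>) = std_normal_distribution"
    by (simp add: distributed_def)
  then have "char std_normal_distribution (t * \<sigma>) = (\<integral>x. iexp (t * \<sigma> * x) \<partial>distr ?D lborel (\<lambda>x. x / \<sigma>))"
    by (simp add: char_def)
  also have "\<dots> = char ?D t"
    unfolding char_def using assms by (subst integral_distr) auto
  finally show ?thesis
    by (simp add: char_std_normal_distribution power_mult_distrib mult.commute)
qed

text \<open>The case distinction in \<open>normal_rv\<close> between a point mass and a density
  disappears on the side of characteristic functions. Sums and multiples of possibly degenerate
  variables are therefore handled on that side.\<close>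

lemma (in prob_space) centered_normal_rv_iff_char:
  "normal_rv M X 0 s2 \<longleftrightarrow> X \<in> borel_measurable M \<and> s2 \<ge> 0 \<and>
     (\<forall>t. (\<integral>\<omega>. iexp (t * X \<omega>) \<partial>M) = of_real (exp (- (s2 * t\<^sup>2) / 2)))"
proof (cases "X \<in> borel_measurable M \<and> s2 \<ge> 0")
  case True
  then have X [measurable]: "X \<in> borel_measurable M" and s2: "s2 \<ge> 0" by auto
  let ?N = "if s2 = 0 then return borel 0 else density lborel (normal_density 0 (sqrt s2))"
  have N: "real_distribution ?N"
  proof (cases "s2 = 0")
    case False
    then have "prob_space (density lborel (normal_density 0 (sqrt s2)))"
      using s2 by (intro prob_space_normal_density) simp
    then show ?thesis using False by (auto simp: real_distribution_def real_distribution_axioms_def)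
  qed (auto simp: real_distribution_def real_distribution_axioms_def intro!: prob_space_return)
  have cN: "char ?N = (\<lambda>t. of_real (exp (- (s2 * t\<^sup>2) / 2)))"
    using s2 char_centered_normal[of "sqrt s2"] by (auto simp: char_def fun_eq_iff integral_return)
  have cX: "char (distr M borel X) = (\<lambda>t. \<integral>\<omega>. iexp (t * X \<omega>) \<partial>M)"
    by (auto simp: char_def integral_distr fun_eq_iff)
  have "distr M borel X = ?N \<longleftrightarrow> char (distr M borel X) = char ?N"
    using Levy_uniqueness[OF real_distribution_distr[OF X] N] by auto
  then show ?thesis using True unfolding normal_rv_def cN cX by (auto simp: fun_eq_iff)
qed (auto simp: normal_rv_def)

lemma (in prob_space) centered_normal_rv_moments:
  assumes "normal_rv M X 0 s2"
  shows "integrable M X" "integrable M (\<lambda>\<omega>. (X \<omega>)\<^sup>2)" "expectation X = 0" "expectation (\<lambda>\<omega>. (X \<omega>)\<^sup>2) = s2"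
proof -
  have X [measurable]: "X \<in> borel_measurable M" and s2: "s2 \<ge> 0"
    and D: "distr M borel X = (if s2 = 0 then return borel 0 else density lborel (normal_density 0 (sqrt s2)))"
    using assms by (auto simp: normal_rv_def)
  have *: "integrable (distr M borel X) (\<lambda>x. x)" "integrable (distr M borel X) (\<lambda>x. x\<^sup>2)"
     "(\<integral>x. x \<partial>distr M borel X) = 0" "(\<integral>x. x\<^sup>2 \<partial>distr M borel X) = s2"
  proof (atomize (full), cases "s2 = 0")
    case True
    then have D': "distr M borel X = return borel 0" using D by simp
    have i: "integrable (return borel (0::real)) f" if f: "f \<in> borel_measurable borel" for f :: "real \<Rightarrow> real"
      unfolding integrable_iff_bounded using f by (subst nn_integral_return) auto
    have "(\<integral>x. x \<partial>return borel (0::real)) = 0" "(\<integral>x. x\<^sup>2 \<partial>return borel (0::real)) = 0"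
      by (subst integral_return; simp)+
    then show "(integrable (distr M borel X) (\<lambda>x. x) \<and> integrable (distr M borel X) (\<lambda>x. x\<^sup>2)) \<and>
       (\<integral>x. x \<partial>distr M borel X) = 0 \<and> (\<integral>x. x\<^sup>2 \<partial>distr M borel X) = s2"
      unfolding D' True by (intro conjI i) auto
  next
    case False
    then have D': "distr M borel X = density lborel (normal_density 0 (sqrt s2))" using D by simp
    have s: "sqrt s2 > 0" using s2 False by simp
    have m: "integrable lborel (\<lambda>x. normal_density 0 (sqrt s2) x * x)"
        "integrable lborel (\<lambda>x. normal_density 0 (sqrt s2) x * x\<^sup>2)"
        "(\<integral>x. normal_density 0 (sqrt s2) x * x \<partial>lborel) = 0"
        "(\<integral>x. normal_density 0 (sqrt s2) x * x\<^sup>2 \<partial>lborel) = s2"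
      using integrable_normal_moment[OF s, of 0 1] integrable_normal_moment[OF s, of 0 2]
        integral_normal_moment_nz_1[OF s, of 0] integral_normal_moment_even[OF s, of 0 1] s2
      by (simp_all add: fact_numeral)
    show "(integrable (distr M borel X) (\<lambda>x. x) \<and> integrable (distr M borel X) (\<lambda>x. x\<^sup>2)) \<and>
       (\<integral>x. x \<partial>distr M borel X) = 0 \<and> (\<integral>x. x\<^sup>2 \<partial>distr M borel X) = s2"
      unfolding D' by (intro conjI; subst integrable_density integral_density; simp add: m)
  qed
  show "integrable M X" "integrable M (\<lambda>\<omega>. (X \<omega>)\<^sup>2)"
    using *(1,2) by (simp_all add: integrable_distr_eq)
  show "expectation X = 0" "expectation (\<lambda>\<omega>. (X \<omega>)\<^sup>2) = s2"
    using integral_distr[OF X, of "\<lambda>x. x"] integral_distr[OF X, of "\<lambda>x. x\<^sup>2"]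
    unfolding *(3,4) by auto
qed

lemma (in prob_space) centered_normal_rv_sum:
  assumes fin: "finite S" and ind: "indep_vars (\<lambda>_. borel) X S"
    and nrm: "\<And>i. i \<in> S \<Longrightarrow> normal_rv M (X i) 0 (s2 i)"
  shows "normal_rv M (\<lambda>\<omega>. \<Sum>i\<in>S. X i \<omega>) 0 (\<Sum>i\<in>S. s2 i)"
proof -
  have X [measurable]: "X i \<in> borel_measurable M" and s2: "s2 i \<ge> 0"
    and c: "(\<integral>\<omega>. iexp (t * X i \<omega>) \<partial>M) = of_real (exp (- (s2 i * t\<^sup>2) / 2))" if "i \<in> S" for i t
    using nrm[OF that] by (auto simp: centered_normal_rv_iff_char)
  have "(\<integral>\<omega>. iexp (t * (\<Sum>i\<in>S. X i \<omega>)) \<partial>M) = of_real (exp (- ((\<Sum>i\<in>S. s2 i) * t\<^sup>2) / 2))" for t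
  proof -
    have "(\<integral>\<omega>. iexp (t * (\<Sum>i\<in>S. X i \<omega>)) \<partial>M) = char (distr M borel (\<lambda>\<omega>. \<Sum>i\<in>S. X i \<omega>)) t"
      by (simp add: char_def integral_distr)
    also have "\<dots> = (\<Prod>i\<in>S. char (distr M borel (X i)) t)" by (rule char_distr_sum[OF ind])
    also have "\<dots> = (\<Prod>i\<in>S. of_real (exp (- (s2 i * t\<^sup>2) / 2)))"
      by (intro prod.cong refl) (simp add: c char_def integral_distr del: of_real_mult of_real_exp)
    also have "\<dots> = of_real (exp (\<Sum>i\<in>S. - (s2 i * t\<^sup>2) / 2))"
      by (simp add: exp_sum[OF fin])
    finally show ?thesis by (simp add: sum_negf sum_divide_distrib sum_distrib_right)
  qed
  then show ?thesis unfolding centered_normal_rv_iff_char using s2 by (auto intro!: sum_nonneg)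
qed

lemma (in prob_space) centered_normal_rv_cmult:
  assumes "normal_rv M X 0 s2"
  shows "normal_rv M (\<lambda>\<omega>. c * X \<omega>) 0 (c\<^sup>2 * s2)"
proof -
  have "(\<integral>\<omega>. iexp ((t * c) * X \<omega>) \<partial>M) = of_real (exp (- (s2 * (t * c)\<^sup>2) / 2))" for t
    using assms centered_normal_rv_iff_char by blast
  then show ?thesis using assms
    by (auto simp: centered_normal_rv_iff_char mult.assoc power_mult_distrib mult_ac)
qed

text \<open>The model equations hold on \<open>space M\<close> only, so normality must be
  insensitive to values outside it.\<close>

lemma (in prob_space) normal_rv_cong:
  assumes "\<And>\<omega>. \<omega> \<in> space M \<Longrightarrow> X \<omega> = Y \<omega>"
  shows "normal_rv M X m s \<longleftrightarrow> normal_rv M Y m s"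
  using assms unfolding normal_rv_def
  by (metis (no_types, lifting) distr_cong measurable_cong)

lemma (in prob_space) centered_normal_rv_variance:
  assumes "normal_rv M X 0 s2"
  shows "normal_rv M X 0 (expectation (\<lambda>\<omega>. X \<omega> * X \<omega>))"
  using assms centered_normal_rv_moments(4)[OF assms] by (simp add: power2_eq_square)

section \<open>Conditional independence from independence\<close>

lemma gen_sa_Pow: "gen_sa M S X \<subseteq> Pow (space M)"
  by (auto simp: gen_sa_def)

lemma sets_gen_sa: "sets (sigma (space M) (gen_sa M S X)) = sigma_sets (space M) (gen_sa M S X)"
  by (rule sets_measure_of[OF gen_sa_Pow])

lemma space_gen_sa [simp]: "space (sigma (space M) (gen_sa M S X)) = space M"
  by (rule space_measure_of[OF gen_sa_Pow])

lemma gen_sa_subset_sets: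
  assumes "\<And>i. i \<in> S \<Longrightarrow> X i \<in> borel_measurable L" "space L = space M"
  shows "gen_sa M S X \<subseteq> sets L"
  using assms by (auto simp: gen_sa_def simp flip: assms(2))

lemma sigma_gen_sa_subset:
  assumes "\<And>i. i \<in> S \<Longrightarrow> X i \<in> borel_measurable L" "space L = space M"
  shows "sigma_sets (space M) (gen_sa M S X) \<subseteq> sets L"
  using sets.sigma_sets_subset[OF gen_sa_subset_sets[OF assms]] assms(2) by simp

lemma measurable_sigma_superset:
  fixes X :: "'i \<Rightarrow> 'a \<Rightarrow> 'b::topological_space"
  assumes "gen_sa M S X \<subseteq> G" "G \<subseteq> Pow (space M)" "i \<in> S"
  shows "X i \<in> borel_measurable (sigma (space M) G)"
proof (rule measurableI)
  fix B :: "'b set" assume "B \<in> sets borel"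
  then have "X i -` B \<inter> space M \<in> gen_sa M S X" using assms(3) by (auto simp: gen_sa_def)
  then show "X i -` B \<inter> space (sigma (space M) G) \<in> sets (sigma (space M) G)"
    using assms(1,2) by (auto simp: space_measure_of sets_measure_of intro: sigma_sets.Basic)
qed simp

lemma measurable_gen_sa: "i \<in> S \<Longrightarrow> X i \<in> borel_measurable (sigma (space M) (gen_sa M S X))"
  by (rule measurable_sigma_superset[OF subset_refl gen_sa_Pow])

lemma borel_measurable_vec_iff:
  fixes X :: "'a \<Rightarrow> real^'n"
  shows "X \<in> borel_measurable L \<longleftrightarrow> (\<forall>i. (\<lambda>\<omega>. X \<omega> $ i) \<in> borel_measurable L)"
proof
  assume *: "\<forall>i. (\<lambda>\<omega>. X \<omega> $ i) \<in> borel_measurable L"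
  have "(\<lambda>\<omega>. X \<omega> \<bullet> b) \<in> borel_measurable L" if b: "b \<in> Basis" for b
  proof -
    obtain i where i: "b = axis i 1" using b by (auto simp: Basis_vec_def)
    show ?thesis unfolding i using * by (simp add: inner_axis)
  qed
  then show "X \<in> borel_measurable L" by (subst borel_measurable_euclidean_space) auto
next
  assume "X \<in> borel_measurable L"
  then show "\<forall>i. (\<lambda>\<omega>. X \<omega> $ i) \<in> borel_measurable L"
    using borel_measurable_inner[of X L "\<lambda>_. axis i 1" for i] by (simp add: inner_axis)
qed

text \<open>\<open>admissible\<close> speaks of vectors, the Gaussian arguments speak of scalar
  families. The generators differ, but each sigma-algebra makes the variables of the other one
  measurable.\<close>

lemma sigma_gen_sa_vec:
  fixes X :: "'i \<Rightarrow> 'a \<Rightarrow> real^'n"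
  shows "sigma_sets (space M) (gen_sa M S X) =
    sigma_sets (space M) (gen_sa M (S \<times> UNIV) (\<lambda>(k, i) \<omega>. X k \<omega> $ i))" (is "?l = ?r")
proof
  let ?Y = "\<lambda>(k, i) \<omega>. X k \<omega> $ i"
  have "?Y p \<in> borel_measurable (sigma (space M) (gen_sa M (S \<times> UNIV) ?Y))" if "p \<in> S \<times> UNIV" for p
    by (rule measurable_gen_sa[OF that])
  then have "X k \<in> borel_measurable (sigma (space M) (gen_sa M (S \<times> UNIV) ?Y))" if "k \<in> S" for k
    using that by (fastforce simp: borel_measurable_vec_iff)
  then show "?l \<subseteq> ?r" unfolding sets_gen_sa[symmetric, of M "S \<times> UNIV"]
    by (intro sigma_gen_sa_subset) auto
  have "?Y p \<in> borel_measurable (sigma (space M) (gen_sa M S X))" if "p \<in> S \<times> UNIV" for p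
    using measurable_gen_sa[of "fst p" S X M] that by (auto simp: borel_measurable_vec_iff split: prod.split)
  then show "?r \<subseteq> ?l" unfolding sets_gen_sa[symmetric, of M S]
    by (intro sigma_gen_sa_subset) auto
qed

lemma vsa_eq_gen_sa: "vsa M (X k) = sigma_sets (space M) (gen_sa M {k} X)"
  by (simp add: vsa_def gen_sa_def)

lemma subalgebra_gen_sa:
  assumes "\<And>i. i \<in> S \<Longrightarrow> X i \<in> borel_measurable M"
  shows "subalgebra M (sigma (space M) (gen_sa M S X))"
  using sigma_gen_sa_subset[of S X M M] assms by (simp add: subalgebra_def sets_gen_sa)

lemma sigma_sets_inter:
  "X \<subseteq> Pow \<Omega> \<Longrightarrow> a \<in> sigma_sets \<Omega> X \<Longrightarrow> b \<in> sigma_sets \<Omega> X \<Longrightarrow> a \<inter> b \<in> sigma_sets \<Omega> X"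
  using sets.Int[of a "sigma \<Omega> X" b] by (simp add: sets_measure_of)

lemma (in prob_space) sigma_finite_subalgebraI:
  assumes "subalgebra M F" shows "sigma_finite_subalgebra M F"
  using assms by (intro finite_measure_subalgebra_is_sigma_finite)
    (simp add: finite_measure_subalgebra_def finite_measure_subalgebra_axioms_def finite_measure_axioms)

text \<open>Events of \<open>N\<close> are independent of \<open>J\<close> and \<open>F\<close>
  together, so adding them to \<open>F\<close> leaves the conditional probabilities of events of
  \<open>J\<close> unchanged. As \<open>G\<close> lies in what \<open>N\<close> and \<open>F\<close>
  generate, it adds no information about \<open>J\<close> beyond \<open>F\<close>.\<close>

lemma (in prob_space) cond_indep_of_indep:
  assumes J: "J \<subseteq> sets M" and F: "F \<subseteq> sets M" and N: "N \<subseteq> sets M"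
    and ind: "indep_set (sigma_sets (space M) N) (sigma_sets (space M) (J \<union> F))"
    and G: "sigma_sets (space M) G \<subseteq> sigma_sets (space M) (N \<union> F)"
  shows "cond_indep M J G F"
proof -
  let ?\<Omega> = "space M"
  have sp: "sets M \<subseteq> Pow ?\<Omega>" by (rule sets.space_closed)
  have mono: "sigma_sets ?\<Omega> X \<subseteq> sets M" if "X \<subseteq> sets M" for X
    using that by (rule sets.sigma_sets_subset)
  define FF where "FF = sigma ?\<Omega> F"
  have FF: "sets FF = sigma_sets ?\<Omega> F" "space FF = ?\<Omega>"
    using F sp by (auto simp: FF_def sets_measure_of space_measure_of)
  have sub: "subalgebra M FF" using FF mono[OF F] by (simp add: subalgebra_def)
  interpret sigma_finite_subalgebra M FF by (rule sigma_finite_subalgebraI[OF sub])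
  have FFM: "X \<in> sets M" if "X \<in> sets FF" for X using that sub by (auto simp: subalgebra_def)
  define ce where "ce A = real_cond_exp M FF (indicator A)" for A :: "'a set"
  have ceF [measurable]: "ce A \<in> borel_measurable FF" and ceM [measurable]: "ce A \<in> borel_measurable M" for A
    by (auto simp: ce_def)
  have ce01: "AE \<omega> in M. 0 \<le> ce A \<omega> \<and> ce A \<omega> \<le> 1" if A: "A \<in> sets M" for A
  proof -
    have i: "integrable M (indicator A :: 'a \<Rightarrow> real)" using A by (simp add: integrable_indicator_iff emeasure_eq_measure)
    show ?thesis unfolding ce_def
      using real_cond_exp_ge_c[OF i, of 0] real_cond_exp_le_c[OF i, of 1] by (auto simp: indicator_def)
  qed
  have int1: "integrable M (\<lambda>\<omega>. ce A \<omega> * f \<omega>)"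
    if "A \<in> sets M" "f \<in> borel_measurable M" "AE \<omega> in M. \<bar>f \<omega>\<bar> \<le> 1" for A and f :: "'a \<Rightarrow> real"
    by (rule integrable_const_bound[where B=1])
      (use ce01[OF that(1)] that in \<open>auto simp: abs_mult mult_le_one\<close>)
  have ce_int: "(\<integral>\<omega>. f \<omega> * ce A \<omega> \<partial>M) = (\<integral>\<omega>. f \<omega> * indicator A \<omega> \<partial>M)"
    if "A \<in> sets M" and f [measurable]: "f \<in> borel_measurable FF" and b: "AE \<omega> in M. \<bar>f \<omega>\<bar> \<le> 1" for A and f :: "'a \<Rightarrow> real"
  proof -
    have [measurable]: "f \<in> borel_measurable M" "A \<in> sets M"
      using measurable_from_subalg[OF sub f] that by auto
    have "integrable M (\<lambda>\<omega>. f \<omega> * indicator A \<omega>)"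
      by (rule integrable_const_bound[where B=1]) (use b in \<open>auto simp: abs_mult indicator_def\<close>)
    then show ?thesis unfolding ce_def by (intro real_cond_exp_intg) auto
  qed
  \<comment> \<open>Conditional expectation is self-adjoint: both sides equal the integral of
    \<open>ce A * ce B\<close>.\<close>
  have swap: "(\<integral>\<omega>. indicator A \<omega> * ce B \<omega> \<partial>M) = (\<integral>\<omega>. ce A \<omega> * indicator B \<omega> \<partial>M)"
    if A: "A \<in> sets M" and B: "B \<in> sets M" for A B
  proof -
    have "(\<integral>\<omega>. ce B \<omega> * indicator A \<omega> \<partial>M) = (\<integral>\<omega>. ce B \<omega> * ce A \<omega> \<partial>M)"
      by (rule ce_int[symmetric]) (use A ce01[OF B] in auto)
    also have "\<dots> = (\<integral>\<omega>. ce A \<omega> * ce B \<omega> \<partial>M)" by (simp add: mult.commute)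
    also have "\<dots> = (\<integral>\<omega>. ce A \<omega> * indicator B \<omega> \<partial>M)"
      by (rule ce_int) (use B ce01[OF A] in auto)
    finally show ?thesis by (simp add: mult.commute)
  qed
  have NF: "N \<union> F \<subseteq> sets M" and JF: "J \<union> F \<subseteq> sets M" using J N F by auto
  \<comment> \<open>Intersections of an event of \<open>N\<close> with an event of \<open>F\<close>
    form a pi-system that generates the join of both.\<close>
  define P where "P = {a \<inter> b | a b. a \<in> sigma_sets ?\<Omega> N \<and> b \<in> sigma_sets ?\<Omega> F}"
  have PM: "P \<subseteq> sets M" using mono[OF N] mono[OF F] by (auto simp: P_def)
  have "Int_stable P"
  proof (rule Int_stableI)
    fix u v assume "u \<in> P" "v \<in> P"
    then obtain a b c d where *: "u = a \<inter> b" "v = c \<inter> d" "a \<in> sigma_sets ?\<Omega> N" "c \<in> sigma_sets ?\<Omega> N"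
      "b \<in> sigma_sets ?\<Omega> F" "d \<in> sigma_sets ?\<Omega> F" by (auto simp: P_def)
    have "a \<inter> c \<in> sigma_sets ?\<Omega> N" "b \<inter> d \<in> sigma_sets ?\<Omega> F"
      using sigma_sets_inter[OF _ *(3,4)] sigma_sets_inter[OF _ *(5,6)] N F sp by blast+
    moreover have "u \<inter> v = (a \<inter> c) \<inter> (b \<inter> d)" unfolding * by auto
    ultimately show "u \<inter> v \<in> P" unfolding P_def by blast
  qed
  have NFP: "sigma_sets ?\<Omega> (N \<union> F) \<subseteq> sigma_sets ?\<Omega> P"
  proof (rule sigma_sets_mono, safe)
    fix X assume X: "X \<in> N"
    then have "X = X \<inter> ?\<Omega>" using N sp by auto
    moreover have "X \<inter> ?\<Omega> \<in> P" 
      using sigma_sets.Basic[OF X] sigma_sets_top[of ?\<Omega> F] unfolding P_def by blast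
    ultimately show "X \<in> sigma_sets ?\<Omega> P" using sigma_sets.Basic[of "X \<inter> ?\<Omega>" P] by simp
  next
    fix X assume X: "X \<in> F"
    then have "X = ?\<Omega> \<inter> X" using F sp by auto
    moreover have "?\<Omega> \<inter> X \<in> P" 
      using sigma_sets.Basic[OF X] sigma_sets_top[of ?\<Omega> N] unfolding P_def by blast
    ultimately show "X \<in> sigma_sets ?\<Omega> P" using sigma_sets.Basic[of "?\<Omega> \<inter> X" P] by simp
  qed
  \<comment> \<open>In other words, \<open>ce C\<close> is also the conditional probability of
    \<open>C\<close> given the larger sigma-algebra generated by \<open>N \<union> F\<close>. Here
    \<open>C\<close> ranges over events of \<open>J \<union> F\<close> rather than of
    \<open>J\<close>, so that a test event of \<open>F\<close> can be absorbed into it at the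
    end.\<close>
  have key: "(\<integral>\<omega>. indicator C \<omega> * indicator B \<omega> \<partial>M) = (\<integral>\<omega>. ce C \<omega> * indicator B \<omega> \<partial>M)"
    if C: "C \<in> sigma_sets ?\<Omega> (J \<union> F)" and B: "B \<in> sigma_sets ?\<Omega> (N \<union> F)" for B C
  proof -
    have CM [measurable]: "C \<in> sets M" using C mono[OF JF] by auto
    let ?u = "\<lambda>\<omega>. indicator C \<omega> - ce C \<omega>"
    have ui: "integrable M ?u"
      using int1[OF CM, of "\<lambda>_. 1"] by (intro Bochner_Integration.integrable_diff)
        (auto simp: integrable_indicator_iff emeasure_eq_measure)
    have ui': "integrable M (\<lambda>\<omega>. indicator X \<omega> * ?u \<omega>)" if "X \<in> sets M" for X
      using integrable_mult_indicator[OF that ui] by simp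
    have zero: "(\<integral>\<omega>\<in>X. ?u \<omega> \<partial>M) = 0" if "X \<in> sigma_sets ?\<Omega> P" for X
    proof (rule sigma_sets_induct_disjoint[OF \<open>Int_stable P\<close> _ that])
      show "P \<subseteq> Pow ?\<Omega>" using PM sp by blast
    next
      fix X assume "X \<in> P"
      then obtain a b where X: "X = a \<inter> b" and a: "a \<in> sigma_sets ?\<Omega> N" and b: "b \<in> sigma_sets ?\<Omega> F" by (auto simp: P_def)
      have aM [measurable]: "a \<in> sets M" and bM [measurable]: "b \<in> sets M" and bF [measurable]: "b \<in> sets FF"
        using mono[OF N] mono[OF F] a b FF by auto
      have bJF: "b \<in> sigma_sets ?\<Omega> (J \<union> F)" using b sigma_sets_mono'[of F "J \<union> F"] by auto
      have "C \<inter> b \<in> sigma_sets ?\<Omega> (J \<union> F)" using sigma_sets_inter[OF _ C bJF] JF sp by blast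
      then have i1: "prob (a \<inter> (C \<inter> b)) = prob a * prob (C \<inter> b)" by (rule indep_setD[OF ind a])
      \<comment> \<open>\<open>a\<close> is independent of \<open>F\<close>, so its conditional
        probability is constant. By \<open>swap\<close>, the integral of
        \<open>ce (C \<inter> b)\<close> over \<open>a\<close> is then the same product that
        \<open>i1\<close> gives for the probability of
        \<open>a \<inter> (C \<inter> b)\<close>.\<close>
      have "AE \<omega> in M. ce a \<omega> = prob a"
        unfolding ce_def
      proof (rule real_cond_exp_charact)
        fix D assume D: "D \<in> sets FF"
        have "prob (a \<inter> D) = prob a * prob D"
          using D FF sigma_sets_mono'[of F "J \<union> F"] by (intro indep_setD[OF ind a]) auto
        then show "(\<integral>\<omega>\<in>D. indicator a \<omega> \<partial>M) = (\<integral>\<omega>\<in>D. prob a \<partial>M)"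
          using FFM[OF D] sets.sets_into_space[OF FFM[OF D]]
          by (simp add: set_lebesgue_integral_def indicator_inter_arith[symmetric] Int_commute Int_absorb1)
      qed (auto simp: integrable_indicator_iff emeasure_eq_measure)
      then have "(\<integral>\<omega>. (indicator (C \<inter> b) \<omega>) * ce a \<omega> \<partial>M) = (\<integral>\<omega>. prob a * indicator (C \<inter> b) \<omega> \<partial>M)"
        by (intro integral_cong_AE) (auto elim!: eventually_mono)
      then have i2: "(\<integral>\<omega>. ce (C \<inter> b) \<omega> * indicator a \<omega> \<partial>M) = prob a * prob (C \<inter> b)"
        using swap[of "C \<inter> b" a] sets.sets_into_space[OF CM] by (simp add: Int_absorb2 inf.coboundedI1)
      have "AE \<omega> in M. ce (C \<inter> b) \<omega> = indicator b \<omega> * ce C \<omega>"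
      proof -
        have "AE \<omega> in M. real_cond_exp M FF (\<lambda>\<omega>. indicator b \<omega> * indicator C \<omega>) \<omega> = indicator b \<omega> * real_cond_exp M FF (indicator C) \<omega>"
          by (rule real_cond_exp_mult)
            (auto simp: integrable_indicator_iff emeasure_eq_measure indicator_inter_arith[symmetric])
        moreover have "(\<lambda>\<omega>. indicator b \<omega> * indicator C \<omega> :: real) = indicator (C \<inter> b)"
          by (auto simp: indicator_def fun_eq_iff)
        ultimately show ?thesis by (simp add: ce_def)
      qed
      then have i3: "(\<integral>\<omega>. ce (C \<inter> b) \<omega> * indicator a \<omega> \<partial>M) = (\<integral>\<omega>. indicator X \<omega> * ce C \<omega> \<partial>M)"
        by (intro integral_cong_AE) (auto simp: X indicator_inter_arith mult_ac elim!: eventually_mono)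
      have XM [measurable]: "X \<in> sets M" by (simp add: X)
      have "(\<integral>\<omega>. indicator X \<omega> * indicator C \<omega> \<partial>M) = prob (a \<inter> (C \<inter> b))"
        using sets.sets_into_space[OF CM]
        by (simp add: indicator_inter_arith[symmetric] X Int_ac Int_absorb2 inf.coboundedI1 inf.coboundedI2)
      moreover have "integrable M (\<lambda>\<omega>. indicator X \<omega> * indicator C \<omega> :: real)"
        by (simp add: indicator_inter_arith[symmetric] integrable_indicator_iff emeasure_eq_measure)
      moreover have "integrable M (\<lambda>\<omega>. indicator X \<omega> * ce C \<omega>)"
        using int1[OF CM, of "indicator X"] by (simp add: mult.commute)
      ultimately show "(\<integral>\<omega>\<in>X. ?u \<omega> \<partial>M) = 0"
        using i1 i2 i3 by (simp add: set_lebesgue_integral_def right_diff_distrib)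
    next
      show "(\<integral>\<omega>\<in>{}. ?u \<omega> \<partial>M) = 0" by (simp add: set_lebesgue_integral_def)
    next
      fix X assume X: "X \<in> sigma_sets ?\<Omega> P" and IH: "(\<integral>\<omega>\<in>X. ?u \<omega> \<partial>M) = 0"
      have XM: "X \<in> sets M" using X mono[OF PM] by auto
      have "(\<integral>\<omega>. ?u \<omega> \<partial>M) = 0"
        using int1[OF CM, of "\<lambda>_. 1"] ce_int[OF CM, of "\<lambda>_. 1"] 
        by (subst Bochner_Integration.integral_diff) (auto simp: integrable_indicator_iff emeasure_eq_measure)
      moreover have "(\<integral>\<omega>. indicator (?\<Omega> - X) \<omega> * ?u \<omega> \<partial>M) = (\<integral>\<omega>. ?u \<omega> - indicator X \<omega> * ?u \<omega> \<partial>M)"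
        by (intro Bochner_Integration.integral_cong) (auto simp: indicator_def)
      ultimately show "(\<integral>\<omega>\<in>?\<Omega> - X. ?u \<omega> \<partial>M) = 0"
        using IH ui ui'[OF XM] by (simp add: set_lebesgue_integral_def)
    next
      fix A :: "nat \<Rightarrow> 'a set"
      assume A: "disjoint_family A" "range A \<subseteq> sigma_sets ?\<Omega> P" "\<And>i. (\<integral>\<omega>\<in>A i. ?u \<omega> \<partial>M) = 0"
      have AM: "A i \<in> sets M" for i using A(2) mono[OF PM] by auto
      then have "set_integrable M (\<Union>i. A i) ?u" unfolding set_integrable_def using ui' by auto
      then have "(\<integral>\<omega>\<in>(\<Union>i. A i). ?u \<omega> \<partial>M) = (\<Sum>i. (\<integral>\<omega>\<in>A i. ?u \<omega> \<partial>M))"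
        using A(1) AM by (intro lebesgue_integral_countable_add) (auto simp: disjoint_family_on_def)
      then show "(\<integral>\<omega>\<in>(\<Union>i. A i). ?u \<omega> \<partial>M) = 0" using A(3) by simp
    qed
    have BM: "B \<in> sets M" using B mono[OF NF] by auto
    have "(\<integral>\<omega>. indicator B \<omega> * ?u \<omega> \<partial>M) = 0"
      using zero[of B] B NFP by (auto simp: set_lebesgue_integral_def)
    moreover have "integrable M (\<lambda>\<omega>. indicator B \<omega> * indicator C \<omega> :: real)"
      using BM by (simp add: indicator_inter_arith[symmetric] integrable_indicator_iff emeasure_eq_measure)
    moreover have "integrable M (\<lambda>\<omega>. indicator B \<omega> * ce C \<omega>)"
      using int1[OF CM, of "indicator B"] BM by (simp add: mult.commute)
    ultimately show ?thesis by (simp add: right_diff_distrib mult.commute)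
  qed
  have "AE \<omega> in M. ce (A \<inter> B) \<omega> = ce A \<omega> * ce B \<omega>"
    if A: "A \<in> sigma_sets ?\<Omega> J" and B': "B \<in> sigma_sets ?\<Omega> G" for A B
  proof -
    have B: "B \<in> sigma_sets ?\<Omega> (N \<union> F)" using B' G by auto
    have AJ: "A \<in> sigma_sets ?\<Omega> (J \<union> F)" using A sigma_sets_mono'[of J "J \<union> F"] by auto
    have AM [measurable]: "A \<in> sets M" and BM [measurable]: "B \<in> sets M" using A B mono[OF J] mono[OF NF] by auto
    have iAB: "integrable M (\<lambda>\<omega>. ce A \<omega> * ce B \<omega>)"
      by (rule int1[OF AM]) (use ce01[OF BM] in \<open>auto elim: eventually_mono\<close>)
    show ?thesis unfolding ce_def[of "A \<inter> B"]
    proof (rule real_cond_exp_charact)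
      fix D assume D [measurable]: "D \<in> sets FF"
      have [measurable]: "D \<in> sets M" by (rule FFM[OF D])
      have DJ: "D \<in> sigma_sets ?\<Omega> (J \<union> F)" using D FF sigma_sets_mono'[of F "J \<union> F"] by auto
      have AD: "A \<inter> D \<in> sigma_sets ?\<Omega> (J \<union> F)" using sigma_sets_inter[OF _ AJ DJ] JF sp by blast
      \<comment> \<open>The test event \<open>D\<close> belongs to \<open>F\<close>, so it moves in
        and out of the conditional probability; \<open>key\<close> is applied to
        \<open>A \<inter> D\<close>.\<close>
      have "AE \<omega> in M. real_cond_exp M FF (\<lambda>\<omega>. indicator D \<omega> * indicator A \<omega>) \<omega> = indicator D \<omega> * real_cond_exp M FF (indicator A) \<omega>"
        by (rule real_cond_exp_mult)
          (auto simp: integrable_indicator_iff emeasure_eq_measure indicator_inter_arith[symmetric])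
      moreover have "(\<lambda>\<omega>. indicator D \<omega> * indicator A \<omega> :: real) = indicator (A \<inter> D)"
        by (auto simp: indicator_def fun_eq_iff)
      ultimately have ceAD: "AE \<omega> in M. ce (A \<inter> D) \<omega> = indicator D \<omega> * ce A \<omega>" by (simp add: ce_def)
      have "(\<integral>\<omega>\<in>D. indicator (A \<inter> B) \<omega> \<partial>M) = (\<integral>\<omega>. indicator (A \<inter> D) \<omega> * (indicator B \<omega> :: real) \<partial>M)"
        unfolding set_lebesgue_integral_def
        by (intro Bochner_Integration.integral_cong) (auto simp: indicator_def)
      also have "\<dots> = (\<integral>\<omega>. ce (A \<inter> D) \<omega> * indicator B \<omega> \<partial>M)" by (rule key[OF AD B])
      also have "\<dots> = (\<integral>\<omega>. (indicator D \<omega> * ce A \<omega>) * indicator B \<omega> \<partial>M)"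
        using ceAD by (intro integral_cong_AE) (auto elim!: eventually_mono)
      also have "\<dots> = (\<integral>\<omega>. (indicator D \<omega> * ce A \<omega>) * ce B \<omega> \<partial>M)"
        by (rule ce_int[symmetric]) (use ce01[OF AM] in \<open>auto simp: indicator_def\<close>)
      finally show "(\<integral>\<omega>\<in>D. indicator (A \<inter> B) \<omega> \<partial>M) = (\<integral>\<omega>\<in>D. ce A \<omega> * ce B \<omega> \<partial>M)"
        by (simp add: set_lebesgue_integral_def mult.assoc)
    qed (use iAB in \<open>auto simp: integrable_indicator_iff emeasure_eq_measure\<close>)
  qed
  then show ?thesis unfolding cond_indep_def ce_def FF_def by blast
qed

section \<open>Gaussian spaces\<close>

text \<open>Uncentred second moment, a covariance for centred variables. Its calculus is developed
  for square integrable variables and not inside a Gaussian space, because it must also cover the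
  given input, which need not be jointly Gaussian with states and outputs.\<close>

definition corr :: "'a measure \<Rightarrow> ('a \<Rightarrow> real) \<Rightarrow> ('a \<Rightarrow> real) \<Rightarrow> real" where
  "corr M X Y = (\<integral>\<omega>. X \<omega> * Y \<omega> \<partial>M)"

lemma corr_sym: "corr M X Y = corr M Y X"
  by (simp add: corr_def mult.commute)

lemma corr_scale: "corr M (\<lambda>\<omega>. c * X \<omega>) Z = c * corr M X Z"
  by (simp add: corr_def mult.assoc)

definition sq_integrable :: "'a measure \<Rightarrow> ('a \<Rightarrow> real) \<Rightarrow> bool" where
  "sq_integrable M X \<longleftrightarrow> X \<in> borel_measurable M \<and> integrable M (\<lambda>\<omega>. (X \<omega>)\<^sup>2)"

lemma sq_integrable_mult:
  assumes "sq_integrable M X" "sq_integrable M Y"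
  shows "integrable M (\<lambda>\<omega>. X \<omega> * Y \<omega>)"
proof (rule Bochner_Integration.integrable_bound)
  show "integrable M (\<lambda>\<omega>. (X \<omega>)\<^sup>2 + (Y \<omega>)\<^sup>2)" using assms by (simp add: sq_integrable_def)
  have "2 * \<bar>X \<omega> * Y \<omega>\<bar> \<le> (X \<omega>)\<^sup>2 + (Y \<omega>)\<^sup>2" for \<omega>
    using sum_squares_bound[of "\<bar>X \<omega>\<bar>" "\<bar>Y \<omega>\<bar>"] by (simp add: abs_mult)
  then show "AE \<omega> in M. norm (X \<omega> * Y \<omega>) \<le> norm ((X \<omega>)\<^sup>2 + (Y \<omega>)\<^sup>2)"
    by (intro AE_I2) (smt (verit) abs_ge_zero real_norm_def zero_le_power2)
qed (use assms in \<open>auto simp: sq_integrable_def\<close>)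

lemma sq_integrable_add:
  assumes "sq_integrable M X" "sq_integrable M Y" shows "sq_integrable M (\<lambda>\<omega>. X \<omega> + Y \<omega>)"
  using assms sq_integrable_mult[OF assms] unfolding sq_integrable_def
  by (auto simp: power2_sum mult.assoc)

lemma sq_integrable_scale: "sq_integrable M X \<Longrightarrow> sq_integrable M (\<lambda>\<omega>. c * X \<omega>)"
  by (auto simp: sq_integrable_def power_mult_distrib)

lemma sq_integrable_lincomb:
  assumes "\<And>i. i \<in> S \<Longrightarrow> sq_integrable M (X i)"
  shows "sq_integrable M (\<lambda>\<omega>. \<Sum>i\<in>S. c i * X i \<omega>)"
  using assms
proof (induction S rule: infinite_finite_induct)
  case (insert i S)
  have "sq_integrable M (\<lambda>\<omega>. c i * X i \<omega> + (\<Sum>i\<in>S. c i * X i \<omega>))"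
    by (rule sq_integrable_add[OF sq_integrable_scale]) (use insert in auto)
  then show ?case using insert.hyps by simp
qed (auto simp: sq_integrable_def)

lemma sq_integrable_diff:
  assumes "sq_integrable M X" "sq_integrable M Y" shows "sq_integrable M (\<lambda>\<omega>. X \<omega> - Y \<omega>)"
  using sq_integrable_add[OF assms(1) sq_integrable_scale[OF assms(2), of "-1"]] by simp

lemma corr_lincomb:
  assumes "\<And>i. i \<in> S \<Longrightarrow> sq_integrable M (X i)" "sq_integrable M Z"
  shows "corr M (\<lambda>\<omega>. \<Sum>i\<in>S. c i * X i \<omega>) Z = (\<Sum>i\<in>S. c i * corr M (X i) Z)"
  using assms by (simp add: corr_def sum_distrib_right mult.assoc sq_integrable_mult)

lemma corr_diff:
  assumes "sq_integrable M X" "sq_integrable M Y" "sq_integrable M Z"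
  shows "corr M (\<lambda>\<omega>. X \<omega> - Y \<omega>) Z = corr M X Z - corr M Y Z"
  using assms by (simp add: corr_def left_diff_distrib sq_integrable_mult)

lemma corr_resid:
  assumes "sq_integrable M U" "\<And>i. i \<in> S \<Longrightarrow> sq_integrable M (X i)" "sq_integrable M Z"
  shows "corr M (\<lambda>\<omega>. U \<omega> - (\<Sum>i\<in>S. c i * X i \<omega>)) Z = corr M U Z - (\<Sum>i\<in>S. c i * corr M (X i) Z)"
  using assms by (simp add: corr_diff sq_integrable_lincomb corr_lincomb)

text \<open>Written out so that only second moments of \<open>U\<close> and the \<open>X i\<close>
  remain: the expected squared error of a linear estimate is determined by covariances
  alone.\<close>

lemma corr_resid_resid:
  assumes "sq_integrable M U" "\<And>i. i \<in> S \<Longrightarrow> sq_integrable M (X i)"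
  shows "corr M (\<lambda>\<omega>. U \<omega> - (\<Sum>i\<in>S. c i * X i \<omega>)) (\<lambda>\<omega>. U \<omega> - (\<Sum>i\<in>S. c i * X i \<omega>))
    = corr M U U - (\<Sum>i\<in>S. c i * corr M (X i) U)
      - (\<Sum>i\<in>S. c i * (corr M U (X i) - (\<Sum>j\<in>S. c j * corr M (X j) (X i))))"
proof -
  let ?D = "\<lambda>\<omega>. U \<omega> - (\<Sum>i\<in>S. c i * X i \<omega>)"
  have D: "sq_integrable M ?D" by (intro sq_integrable_diff sq_integrable_lincomb assms)
  have "corr M ?D ?D = corr M U ?D - (\<Sum>i\<in>S. c i * corr M (X i) ?D)"
    by (rule corr_resid[OF assms D])
  also have "corr M U ?D = corr M U U - (\<Sum>i\<in>S. c i * corr M (X i) U)"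
    by (subst corr_sym) (rule corr_resid[OF assms assms(1)])
  also have "(\<Sum>i\<in>S. c i * corr M (X i) ?D) = (\<Sum>i\<in>S. c i * (corr M U (X i) - (\<Sum>j\<in>S. c j * corr M (X j) (X i))))"
  proof (intro sum.cong refl)
    fix i assume i: "i \<in> S"
    show "c i * corr M (X i) ?D = c i * (corr M U (X i) - (\<Sum>j\<in>S. c j * corr M (X j) (X i)))"
      unfolding corr_sym[of M "X i" ?D] using corr_resid[OF assms assms(2)[OF i], where c=c] by simp
  qed
  finally show ?thesis .
qed

lemma corr_self_nonneg: "corr M X X \<ge> 0"
  by (simp add: corr_def)

text \<open>The quadratic form of second moments is the second moment of one variable. This makes it
  nonnegative, and in a Gaussian space it fixes the law of the combination.\<close>

lemma corr_lincomb_self: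
  assumes "\<And>i. i \<in> S \<Longrightarrow> sq_integrable M (X i)"
  shows "corr M (\<lambda>\<omega>. \<Sum>i\<in>S. c i * X i \<omega>) (\<lambda>\<omega>. \<Sum>i\<in>S. c i * X i \<omega>) = (\<Sum>i\<in>S. \<Sum>j\<in>S. c i * c j * corr M (X i) (X j))"
proof -
  have "corr M (\<lambda>\<omega>. \<Sum>i\<in>S. c i * X i \<omega>) (\<lambda>\<omega>. \<Sum>i\<in>S. c i * X i \<omega>) = (\<Sum>i\<in>S. c i * corr M (X i) (\<lambda>\<omega>. \<Sum>i\<in>S. c i * X i \<omega>))"
    by (rule corr_lincomb) (auto intro: assms sq_integrable_lincomb)
  also have "\<dots> = (\<Sum>i\<in>S. c i * (\<Sum>j\<in>S. c j * corr M (X i) (X j)))"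
  proof (intro sum.cong refl)
    fix i assume i: "i \<in> S"
    have "corr M (X i) (\<lambda>\<omega>. \<Sum>j\<in>S. c j * X j \<omega>) = (\<Sum>j\<in>S. c j * corr M (X j) (X i))"
      unfolding corr_sym[of M "X i"] by (rule corr_lincomb[OF assms assms[OF i]])
    then show "c i * corr M (X i) (\<lambda>\<omega>. \<Sum>j\<in>S. c j * X j \<omega>) = c i * (\<Sum>j\<in>S. c j * corr M (X i) (X j))"
      by (simp only: corr_sym[of M "X i"])
  qed
  finally show ?thesis by (simp add: sum_distrib_left mult.assoc)
qed

text \<open>Joint normality is encoded as a linear space of functions each of which is centred
  normal, possibly degenerate. Only one-dimensional laws occur, and no family has to be fixed in
  advance: projections and residuals stay in \<open>H\<close>.\<close>

locale centered_gaussian_space = prob_space M for M :: "'a measure" +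
  fixes H :: "('a \<Rightarrow> real) set"
  assumes normal: "X \<in> H \<Longrightarrow> \<exists>s2. normal_rv M X 0 s2"
    and H_zero: "(\<lambda>_. 0) \<in> H"
    and H_add: "X \<in> H \<Longrightarrow> Y \<in> H \<Longrightarrow> (\<lambda>\<omega>. X \<omega> + Y \<omega>) \<in> H"
    and H_scale: "X \<in> H \<Longrightarrow> (\<lambda>\<omega>. c * X \<omega>) \<in> H"
begin

abbreviation ip :: "('a \<Rightarrow> real) \<Rightarrow> ('a \<Rightarrow> real) \<Rightarrow> real" where
  "ip \<equiv> corr M"

lemma H_sum: "(\<And>i. i \<in> S \<Longrightarrow> X i \<in> H) \<Longrightarrow> (\<lambda>\<omega>. \<Sum>i\<in>S. X i \<omega>) \<in> H"
  by (induction S rule: infinite_finite_induct) (auto intro: H_zero H_add)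

lemma H_lincomb: "(\<And>i. i \<in> S \<Longrightarrow> X i \<in> H) \<Longrightarrow> (\<lambda>\<omega>. \<Sum>i\<in>S. c i * X i \<omega>) \<in> H"
  by (intro H_sum H_scale)

lemma H_diff: "X \<in> H \<Longrightarrow> Y \<in> H \<Longrightarrow> (\<lambda>\<omega>. X \<omega> - Y \<omega>) \<in> H"
  using H_add[of X "\<lambda>\<omega>. -1 * Y \<omega>"] H_scale[of Y "-1"] by simp

lemma H_resid: "U \<in> H \<Longrightarrow> (\<And>i. i \<in> S \<Longrightarrow> X i \<in> H) \<Longrightarrow> (\<lambda>\<omega>. U \<omega> - (\<Sum>i\<in>S. c i * X i \<omega>)) \<in> H"
  by (intro H_diff H_lincomb)

lemma H_normal: "X \<in> H \<Longrightarrow> normal_rv M X 0 (ip X X)"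
  using normal[of X] centered_normal_rv_variance[of X] unfolding corr_def by blast

lemma H_measurable: "X \<in> H \<Longrightarrow> X \<in> borel_measurable M"
  using H_normal by (auto simp: normal_rv_def)

lemma H_integrable: "X \<in> H \<Longrightarrow> integrable M X"
  using H_normal centered_normal_rv_moments by blast

lemma H_mean: "X \<in> H \<Longrightarrow> expectation X = 0"
  using H_normal centered_normal_rv_moments by blast

lemma H_sq_integrable: "X \<in> H \<Longrightarrow> sq_integrable M X"
  using centered_normal_rv_moments(2)[OF H_normal] H_measurable by (simp add: sq_integrable_def)

lemmas H_integrable_mult = sq_integrable_mult[OF H_sq_integrable H_sq_integrable]

lemmas ip_sym = corr_sym[of M]

lemma ip_add: "X \<in> H \<Longrightarrow> Y \<in> H \<Longrightarrow> Z \<in> H \<Longrightarrow> ip (\<lambda>\<omega>. X \<omega> + Y \<omega>) Z = ip X Z + ip Y Z"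
  by (simp add: corr_def distrib_right H_integrable_mult)

lemmas ip_diff = corr_diff[OF H_sq_integrable H_sq_integrable H_sq_integrable]

lemmas ip_scale = corr_scale[of M]

lemmas ip_lincomb = corr_lincomb[OF H_sq_integrable H_sq_integrable]

text \<open>A variable of norm zero vanishes almost everywhere. This takes the place of invertible
  Gram matrices in the degenerate case.\<close>

lemma ip_self_zero:
  assumes "X \<in> H" "ip X X = 0" shows "ip X Z = 0"
proof -
  have "AE \<omega> in M. X \<omega> * X \<omega> = 0"
    using integral_nonneg_eq_0_iff_AE[OF H_integrable_mult[OF assms(1,1)]] assms(2) by (simp add: corr_def)
  then have "AE \<omega> in M. X \<omega> * Z \<omega> = 0" by (auto elim: eventually_mono)
  then show ?thesis unfolding corr_def by (rule integral_eq_zero_AE)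
qed

lemma char_H: "X \<in> H \<Longrightarrow> (\<integral>\<omega>. iexp (X \<omega>) \<partial>M) = of_real (exp (- ip X X / 2))"
proof -
  assume "X \<in> H"
  then have "(\<integral>\<omega>. iexp (1 * X \<omega>) \<partial>M) = of_real (exp (- (ip X X * 1\<^sup>2) / 2))"
    using H_normal centered_normal_rv_iff_char by blast
  then show ?thesis by simp
qed

text \<open>Gram-Schmidt, one variable at a time: the residual of \<open>U\<close> is corrected by a
  multiple of the residual of the new variable \<open>X i\<close>, which leaves orthogonality to the
  earlier variables intact.\<close>

lemma projection_exists:
  assumes "finite S" "\<And>i. i \<in> S \<Longrightarrow> X i \<in> H" "U \<in> H"
  shows "\<exists>c. \<forall>i\<in>S. ip (\<lambda>\<omega>. U \<omega> - (\<Sum>j\<in>S. c j * X j \<omega>)) (X i) = 0"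
  using assms
proof (induction S arbitrary: U rule: finite_induct)
  case (insert i S)
  have X: "X j \<in> H" if "j \<in> insert i S" for j using insert.prems that by auto
  obtain c where c: "\<forall>j\<in>S. ip (\<lambda>\<omega>. U \<omega> - (\<Sum>j\<in>S. c j * X j \<omega>)) (X j) = 0"
    using insert.IH[of U] insert.prems by auto
  obtain d where d: "\<forall>j\<in>S. ip (\<lambda>\<omega>. X i \<omega> - (\<Sum>j\<in>S. d j * X j \<omega>)) (X j) = 0"
    using insert.IH[of "X i"] insert.prems by auto
  let ?U = "\<lambda>\<omega>. U \<omega> - (\<Sum>j\<in>S. c j * X j \<omega>)" and ?D = "\<lambda>\<omega>. \<Sum>j\<in>S. d j * X j \<omega>"
  let ?X = "\<lambda>\<omega>. X i \<omega> - ?D \<omega>"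
  have UH: "?U \<in> H" and XH: "?X \<in> H" and DH: "?D \<in> H"
    using insert.prems by (auto intro!: H_resid H_lincomb)
  \<comment> \<open>If the residual of \<open>X i\<close> has norm zero, then \<open>X i\<close> is
    almost surely a combination of the earlier variables and no correction is called for.\<close>
  define b where "b = (if ip ?X ?X = 0 then 0 else ip ?U ?X / ip ?X ?X)"
  let ?W = "\<lambda>\<omega>. ?U \<omega> - b * ?X \<omega>"
  have WH: "?W \<in> H" by (rule H_diff[OF UH H_scale[OF XH]])
  have WX: "ip ?W Z = ip ?U Z - b * ip ?X Z" if "Z \<in> H" for Z
    using ip_diff[OF UH H_scale[OF XH] that] by (simp add: ip_scale)
  have 1: "ip ?W (X j) = 0" if "j \<in> S" for j
    using WX[of "X j"] X that c d by simp
  have "ip ?W ?D = (\<Sum>j\<in>S. d j * ip (X j) ?W)"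
    unfolding ip_sym[of ?W ?D] by (rule ip_lincomb) (use X WH in auto)
  also have "\<dots> = 0" using 1 by (intro sum.neutral) (auto simp: ip_sym[of "X _" ?W])
  finally have WD: "ip ?W ?D = 0" .
  have "ip ?W ?X = 0"
  proof (cases "ip ?X ?X = 0")
    case True
    then show ?thesis using ip_self_zero[OF XH, of ?W] ip_sym[of ?X ?W] by simp
  next
    case False
    then show ?thesis using WX[OF XH] by (simp add: b_def)
  qed
  moreover have "ip ?W ?X = ip ?W (X i) - ip ?W ?D"
    using ip_diff[OF X[of i] DH WH] by (simp add: ip_sym[of ?W])
  ultimately have 2: "ip ?W (X i) = 0" using WD by simp
  define c' where "c' j = (if j = i then b else c j - b * d j)" for j
  have W: "?W = (\<lambda>\<omega>. U \<omega> - (\<Sum>j\<in>insert i S. c' j * X j \<omega>))"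
  proof
    fix \<omega>
    have "(\<Sum>j\<in>S. c' j * X j \<omega>) = (\<Sum>j\<in>S. c j * X j \<omega> - b * (d j * X j \<omega>))"
      using insert.hyps by (intro sum.cong) (auto simp: c'_def algebra_simps)
    then show "?W \<omega> = U \<omega> - (\<Sum>j\<in>insert i S. c' j * X j \<omega>)"
      using insert.hyps by (simp add: c'_def[of i] sum_subtractf sum_distrib_left algebra_simps)
  qed
  show ?case
    using 1 2 unfolding W by (intro exI[of _ c']) auto
qed auto

text \<open>Two families are independent when their joint law is the same whether they read one
  sample point or two independent ones. For combinations \<open>U\<close> and \<open>V\<close> of
  the two families, orthogonality splits the variance of \<open>U + V\<close>, so the characteristic
  function factors and the two laws agree on rectangles.\<close>

lemma indep_of_orthogonal:
  fixes X :: "'i \<Rightarrow> 'a \<Rightarrow> real" and Y :: "'j \<Rightarrow> 'a \<Rightarrow> real"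
  assumes fin: "finite S" "finite S'" and XH: "\<And>i. i \<in> S \<Longrightarrow> X i \<in> H" and YH: "\<And>j. j \<in> S' \<Longrightarrow> Y j \<in> H"
    and orth: "\<And>i j. i \<in> S \<Longrightarrow> j \<in> S' \<Longrightarrow> ip (X i) (Y j) = 0"
  shows "indep_set (sigma_sets (space M) (gen_sa M S X)) (sigma_sets (space M) (gen_sa M S' Y))"
proof -
  define RX where "RX B = {\<omega>\<in>space M. \<forall>i\<in>S. X i \<omega> \<in> B i}" for B
  define RY where "RY B = {\<omega>\<in>space M. \<forall>i\<in>S'. Y i \<omega> \<in> B i}" for B
  define PX where "PX = {RX B | B. \<forall>i\<in>S. B i \<in> sets borel}"
  define PY where "PY = {RY B | B. \<forall>i\<in>S'. B i \<in> sets borel}"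
  have Xm: "X i \<in> borel_measurable M" if "i \<in> S" for i using XH[OF that] by (rule H_measurable)
  have Ym: "Y i \<in> borel_measurable M" if "i \<in> S'" for i using YH[OF that] by (rule H_measurable)
  have RM: "{\<omega>\<in>space M. \<forall>i\<in>K. Z i \<omega> \<in> B i} \<in> sets M"
    if K: "finite K" "\<forall>i\<in>K. B i \<in> sets borel" "\<And>i. i \<in> K \<Longrightarrow> Z i \<in> borel_measurable M"
    for K :: "'k set" and Z and B :: "'k \<Rightarrow> real set"
  proof -
    have "{\<omega>\<in>space M. Z i \<omega> \<in> B i} \<in> sets M" if "i \<in> K" for i
      using measurable_sets[OF K(3)[OF that], of "B i"] K(2) that
      by (auto simp: vimage_def Int_def conj_commute)
    then show ?thesis using K(1) by (intro sets.sets_Collect_finite_All) auto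
  qed
  have gen: "sigma_sets (space M) (gen_sa M K Z) \<subseteq> sigma_sets (space M) {{\<omega>\<in>space M. \<forall>i\<in>K. Z i \<omega> \<in> B i} | B. \<forall>i\<in>K. B i \<in> sets borel}"
    (is "_ \<subseteq> sigma_sets _ ?R") for K :: "'k set" and Z :: "'k \<Rightarrow> 'a \<Rightarrow> real"
  proof (rule sigma_sets_mono', rule subsetI)
    fix E assume "E \<in> gen_sa M K Z"
    then obtain i B where "i \<in> K" "B \<in> sets borel" "E = Z i -` B \<inter> space M" by (auto simp: gen_sa_def)
    then show "E \<in> ?R"
      by (intro CollectI exI[of _ "\<lambda>j. if j = i then B else UNIV"]) auto
  qed
  have stable: "Int_stable {{\<omega>\<in>space M. \<forall>i\<in>K. Z i \<omega> \<in> B i} | B. \<forall>i\<in>K. B i \<in> sets borel}" (is "Int_stable ?R")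
    for K :: "'k set" and Z :: "'k \<Rightarrow> 'a \<Rightarrow> real"
  proof (rule Int_stableI)
    fix a b assume "a \<in> ?R"
      "b \<in> ?R"
    then obtain A B where "\<forall>i\<in>K. A i \<in> sets borel" "\<forall>i\<in>K. B i \<in> sets borel"
      "a = {\<omega>\<in>space M. \<forall>i\<in>K. Z i \<omega> \<in> A i}" "b = {\<omega>\<in>space M. \<forall>i\<in>K. Z i \<omega> \<in> B i}" by auto
    then show "a \<inter> b \<in> ?R"
      by (intro CollectI exI[of _ "\<lambda>j. A j \<inter> B j"]) auto
  qed
  interpret MM: pair_prob_space M M by unfold_locales
  \<comment> \<open>The image of \<open>M\<close> under the diagonal map: here both families read
    the same sample point, under the product measure they read independent ones.\<close>
  let ?N = "distr M (M \<Otimes>\<^sub>M M) (\<lambda>\<omega>. (\<omega>, \<omega>))"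
  have N: "prob_space ?N" by (rule prob_space_distr) simp
  define Z where "Z = case_sum (\<lambda>i p. X i (fst p)) (\<lambda>j p. Y j (snd p :: 'a))"
  have Zm: "Z k \<in> borel_measurable (M \<Otimes>\<^sub>M M)" if "k \<in> S <+> S'" for k
    using that measurable_compose[OF measurable_fst Xm] measurable_compose[OF measurable_snd Ym]
    by (auto simp: Z_def)
  have fin': "finite (S <+> S')" using fin by simp
  have ch: "(\<integral>p. iexp (\<Sum>k\<in>S <+> S'. c k * Z k p) \<partial>?N) = (\<integral>p. iexp (\<Sum>k\<in>S <+> S'. c k * Z k p) \<partial>(M \<Otimes>\<^sub>M M))" for c
  proof -
    define U where "U \<omega> = (\<Sum>i\<in>S. c (Inl i) * X i \<omega>)" for \<omega>
    define V where "V \<omega> = (\<Sum>j\<in>S'. c (Inr j) * Y j \<omega>)" for \<omega>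
    have UH: "U \<in> H" and VH: "V \<in> H" unfolding U_def[abs_def] V_def[abs_def] using XH YH by (auto intro!: H_lincomb)
    have [measurable]: "U \<in> borel_measurable M" "V \<in> borel_measurable M" using UH VH by (auto intro: H_measurable)
    have UVH: "(\<lambda>\<omega>. U \<omega> + V \<omega>) \<in> H" by (rule H_add[OF UH VH])
    have s: "(\<Sum>k\<in>S <+> S'. c k * Z k p) = U (fst p) + V (snd p)" for p
      using fin by (simp add: sum.Plus Z_def U_def V_def)
    have "ip V (X i) = 0" if "i \<in> S" for i
      unfolding V_def[abs_def] using orth[OF that] XH that YH
      by (subst ip_lincomb) (auto intro!: sum.neutral simp: ip_sym[of "Y _" "X _"])
    then have UV: "ip U V = 0"
      unfolding U_def[abs_def] using XH VH
      by (subst ip_lincomb) (auto intro!: sum.neutral simp: ip_sym[of "X _" V])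
    have uv: "ip (\<lambda>\<omega>. U \<omega> + V \<omega>) (\<lambda>\<omega>. U \<omega> + V \<omega>) = ip U U + ip V V"
      using ip_add[OF UH VH UVH] ip_add[OF UH VH UH] ip_add[OF UH VH VH] UV ip_sym[of U V]
      by (simp add: ip_sym[of U "\<lambda>\<omega>. U \<omega> + V \<omega>"] ip_sym[of V "\<lambda>\<omega>. U \<omega> + V \<omega>"])
    have "(\<integral>p. iexp (\<Sum>k\<in>S <+> S'. c k * Z k p) \<partial>?N) = (\<integral>\<omega>. iexp (U \<omega> + V \<omega>) \<partial>M)"
      unfolding s by (subst integral_distr) auto
    also have "\<dots> = of_real (exp (- (ip U U + ip V V) / 2))"
      using char_H[OF UVH] by (simp only: uv)
    also have "\<dots> = of_real (exp (- ip U U / 2)) * of_real (exp (- ip V V / 2))"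
      by (simp add: exp_add[symmetric] add_divide_distrib del: of_real_exp flip: of_real_mult)
    also have "\<dots> = (\<integral>\<omega>. iexp (U \<omega>) \<partial>M) * (\<integral>\<omega>. iexp (V \<omega>) \<partial>M)"
      by (simp only: char_H[OF UH] char_H[OF VH])
    also have "\<dots> = (\<integral>x. (\<integral>y. iexp (U x) * iexp (V y) \<partial>M) \<partial>M)"
      by simp
    also have "\<dots> = (\<integral>p. iexp (U (fst p)) * iexp (V (snd p)) \<partial>(M \<Otimes>\<^sub>M M))"
    proof (subst MM.integral_fst'[symmetric])
      show "integrable (M \<Otimes>\<^sub>M M) (\<lambda>p. iexp (U (fst p)) * iexp (V (snd p)))"
        by (rule MM.P.integrable_const_bound[where B=1]) (auto simp: norm_mult)
    qed simp
    also have "\<dots> = (\<integral>p. iexp (\<Sum>k\<in>S <+> S'. c k * Z k p) \<partial>(M \<Otimes>\<^sub>M M))"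
      unfolding s by (simp add: exp_add distrib_left)
    finally show ?thesis .
  qed
  have "indep_set PX PY"
  proof (rule indep_setI)
    show "PX \<subseteq> events" "PY \<subseteq> events"
      using RM[OF fin(1) _ Xm] RM[OF fin(2) _ Ym] by (auto simp: PX_def PY_def RX_def RY_def)
    fix a b assume "a \<in> PX" "b \<in> PY"
    then obtain A B where AB: "\<forall>i\<in>S. A i \<in> sets borel" "\<forall>i\<in>S'. B i \<in> sets borel" and a: "a = RX A" and b: "b = RY B"
      by (auto simp: PX_def PY_def)
    have [measurable]: "a \<in> sets M" "b \<in> sets M"
      using RM[OF fin(1) AB(1) Xm] RM[OF fin(2) AB(2) Ym] by (auto simp: a b RX_def RY_def)
    let ?E = "{p\<in>space ?N. \<forall>k\<in>S <+> S'. Z k p \<in> case_sum A B k}"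
    have "(\<forall>k\<in>S <+> S'. Q k) \<longleftrightarrow> (\<forall>i\<in>S. Q (Inl i)) \<and> (\<forall>j\<in>S'. Q (Inr j))" for Q :: "'i + 'j \<Rightarrow> bool"
      by auto
    then have E: "?E = a \<times> b" unfolding a b RX_def RY_def Z_def
      by (auto simp: space_pair_measure)
    have "measure ?N ?E = measure (M \<Otimes>\<^sub>M M) ?E"
      using N MM.P.prob_space_axioms AB Zm ch
      by (intro cramer_wold_rectangles[OF fin']) (auto simp: prob_space.finite_measure split: sum.split)
    moreover have "measure ?N (a \<times> b) = prob (a \<inter> b)"
    proof (subst measure_distr)
      have "(\<lambda>\<omega>. (\<omega>, \<omega>)) -` (a \<times> b) \<inter> space M = a \<inter> b"
        using sets.sets_into_space[OF \<open>a \<in> sets M\<close>] by auto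
      then show "prob ((\<lambda>\<omega>. (\<omega>, \<omega>)) -` (a \<times> b) \<inter> space M) = prob (a \<inter> b)" by simp
    qed auto
    moreover have "measure (M \<Otimes>\<^sub>M M) (a \<times> b) = prob a * prob b"
      by (simp add: measure_def emeasure_pair_measure_Times enn2real_mult)
    ultimately show "prob (a \<inter> b) = prob a * prob b" unfolding E by simp
  qed
  then have "indep_set (sigma_sets (space M) PX) (sigma_sets (space M) PY)"
    by (rule indep_set_sigma_sets) (auto simp: PX_def PY_def RX_def RY_def stable)
  moreover have "sigma_sets (space M) (gen_sa M S X) \<subseteq> sigma_sets (space M) PX"
    "sigma_sets (space M) (gen_sa M S' Y) \<subseteq> sigma_sets (space M) PY"
    using gen[of S X] gen[of S' Y] by (simp_all add: PX_def PY_def RX_def RY_def)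
  ultimately show ?thesis unfolding indep_sets2_eq by blast
qed

text \<open>The residual is orthogonal to the conditioning variables, hence independent of them, and
  it has mean zero; so it integrates to zero over every conditioning event. Any solution of the
  normal equations gives a version.\<close>

lemma cond_exp_eq_projection:
  fixes X :: "'i \<Rightarrow> 'a \<Rightarrow> real"
  assumes fin: "finite S" and XH: "\<And>i. i \<in> S \<Longrightarrow> X i \<in> H" and UH: "U \<in> H"
    and orth: "\<And>i. i \<in> S \<Longrightarrow> ip (\<lambda>\<omega>. U \<omega> - (\<Sum>j\<in>S. c j * X j \<omega>)) (X i) = 0"
  shows "AE \<omega> in M. real_cond_exp M (sigma (space M) (gen_sa M S X)) U \<omega> = (\<Sum>j\<in>S. c j * X j \<omega>)"
proof -
  let ?F = "sigma (space M) (gen_sa M S X)" and ?P = "\<lambda>\<omega>. \<Sum>j\<in>S. c j * X j \<omega>"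
  define D where "D \<omega> = U \<omega> - ?P \<omega>" for \<omega>
  have DH: "D \<in> H" and PH: "?P \<in> H" unfolding D_def[abs_def] using UH XH by (auto intro!: H_resid H_lincomb)
  have sub: "subalgebra M ?F" by (rule subalgebra_gen_sa) (use XH H_measurable in auto)
  interpret F: sigma_finite_subalgebra M ?F by (rule sigma_finite_subalgebraI[OF sub])
  have ind: "indep_set (sigma_sets (space M) (gen_sa M {()} (\<lambda>_. D))) (sigma_sets (space M) (gen_sa M S X))"
    by (rule indep_of_orthogonal) (use fin XH DH orth in \<open>auto simp: D_def[abs_def]\<close>)
  show ?thesis
  proof (rule F.real_cond_exp_charact)
    fix A assume A: "A \<in> sets ?F"
    then have AM [measurable]: "A \<in> sets M" using sub by (auto simp: subalgebra_def)
    have "(indicator A :: 'a \<Rightarrow> real) \<in> borel_measurable ?F" using A by simp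
    then have "{(indicator A :: 'a \<Rightarrow> real) -` B \<inter> space M | B. B \<in> sets borel} \<subseteq> sets ?F"
      by (auto dest: measurable_sets)
    then have "sigma_sets (space M) {(indicator A :: 'a \<Rightarrow> real) -` B \<inter> space M | B. B \<in> sets borel} \<subseteq> sigma_sets (space M) (gen_sa M S X)"
      using sets.sigma_sets_subset[of _ ?F] by (simp add: sets_gen_sa)
    then have "indep_var borel D borel (indicator A :: 'a \<Rightarrow> real)"
      using ind H_measurable[OF DH] unfolding indep_var_eq indep_sets2_eq
      by (auto simp: gen_sa_def)
    then have "(\<integral>\<omega>. D \<omega> * indicator A \<omega> \<partial>M) = expectation D * (\<integral>\<omega>. indicator A \<omega> \<partial>M)"
      by (rule indep_var_lebesgue_integral)
        (use H_integrable[OF DH] in \<open>auto simp: integrable_indicator_iff emeasure_eq_measure\<close>)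
    then have z: "(\<integral>\<omega>. D \<omega> * indicator A \<omega> \<partial>M) = 0" using H_mean[OF DH] by simp
    have "(\<integral>\<omega>. indicator A \<omega> * U \<omega> \<partial>M) = (\<integral>\<omega>. D \<omega> * indicator A \<omega> + indicator A \<omega> * ?P \<omega> \<partial>M)"
      by (simp add: D_def algebra_simps)
    also have "\<dots> = (\<integral>\<omega>. D \<omega> * indicator A \<omega> \<partial>M) + (\<integral>\<omega>. indicator A \<omega> * ?P \<omega> \<partial>M)"
      using integrable_mult_indicator[OF AM H_integrable[OF DH]] integrable_mult_indicator[OF AM H_integrable[OF PH]]
      by (intro Bochner_Integration.integral_add) (auto simp: mult.commute)
    finally show "(\<integral>\<omega>\<in>A. U \<omega> \<partial>M) = (\<integral>\<omega>\<in>A. ?P \<omega> \<partial>M)"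
      using z by (simp add: set_lebesgue_integral_def)
  next
    have "X i \<in> borel_measurable ?F" if "i \<in> S" for i using that by (rule measurable_gen_sa)
    then show "?P \<in> borel_measurable ?F" by (auto intro!: borel_measurable_sum borel_measurable_times)
  qed (use UH PH H_integrable in auto)
qed

text \<open>Each \<open>G l\<close> is its projection on \<open>V\<close> plus a residual. Residuals
  orthogonal to both \<open>V\<close> and \<open>J\<close> are independent of these two families
  jointly, so they can play the part of \<open>N\<close> in
  \<open>cond_indep_of_indep\<close>.\<close>

lemma cond_indep_of_orthogonal:
  fixes J :: "'i \<Rightarrow> 'a \<Rightarrow> real" and G :: "'j \<Rightarrow> 'a \<Rightarrow> real" and V :: "'k \<Rightarrow> 'a \<Rightarrow> real"
  assumes fin: "finite S1" "finite S2" "finite S3"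
    and JH: "\<And>i. i \<in> S1 \<Longrightarrow> J i \<in> H" and GH: "\<And>l. l \<in> S2 \<Longrightarrow> G l \<in> H" and VH: "\<And>j. j \<in> S3 \<Longrightarrow> V j \<in> H"
    and orth: "\<And>l. l \<in> S2 \<Longrightarrow> \<exists>d. (\<forall>j\<in>S3. ip (\<lambda>\<omega>. G l \<omega> - (\<Sum>j\<in>S3. d j * V j \<omega>)) (V j) = 0) \<and>
      (\<forall>i\<in>S1. ip (\<lambda>\<omega>. G l \<omega> - (\<Sum>j\<in>S3. d j * V j \<omega>)) (J i) = 0)"
  shows "cond_indep M (gen_sa M S1 J) (gen_sa M S2 G) (gen_sa M S3 V)"
proof -
  have "\<exists>d. \<forall>l\<in>S2. (\<forall>j\<in>S3. ip (\<lambda>\<omega>. G l \<omega> - (\<Sum>j\<in>S3. d l j * V j \<omega>)) (V j) = 0) \<and>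
      (\<forall>i\<in>S1. ip (\<lambda>\<omega>. G l \<omega> - (\<Sum>j\<in>S3. d l j * V j \<omega>)) (J i) = 0)"
    (is "\<exists>d. \<forall>l\<in>S2. ?Q d l")
    by (rule bchoice) (use orth in blast)
  then obtain d where d: "\<And>l. l \<in> S2 \<Longrightarrow> ?Q d l"
    by blast
  define e where "e l \<omega> = G l \<omega> - (\<Sum>j\<in>S3. d l j * V j \<omega>)" for l \<omega>
  have eH: "e l \<in> H" if "l \<in> S2" for l
    unfolding e_def[abs_def] using GH[OF that] VH by (rule H_resid)
  have meas: "gen_sa M S1 J \<subseteq> events" "gen_sa M S3 V \<subseteq> events" "gen_sa M S2 e \<subseteq> events"
    by (rule gen_sa_subset_sets; use JH VH eH H_measurable in blast)+
  have "gen_sa M S1 J \<union> gen_sa M S3 V = gen_sa M (S1 <+> S3) (case_sum J V)"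
    unfolding gen_sa_def by (auto simp: Plus_def)
  moreover have "indep_set (sigma_sets (space M) (gen_sa M S2 e)) (sigma_sets (space M) (gen_sa M (S1 <+> S3) (case_sum J V)))"
    by (rule indep_of_orthogonal) (use fin JH VH eH d in \<open>auto simp: e_def[abs_def]\<close>)
  ultimately have ind: "indep_set (sigma_sets (space M) (gen_sa M S2 e)) (sigma_sets (space M) (gen_sa M S1 J \<union> gen_sa M S3 V))"
    by simp
  let ?L = "sigma (space M) (gen_sa M S2 e \<union> gen_sa M S3 V)"
  have Pow: "gen_sa M S2 e \<union> gen_sa M S3 V \<subseteq> Pow (space M)" by (intro Un_least gen_sa_Pow)
  have "G l \<in> borel_measurable ?L" if "l \<in> S2" for l
  proof -
    have [measurable]: "e l \<in> borel_measurable ?L"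
      using that Pow by (intro measurable_sigma_superset[of M S2 e]) auto
    have [measurable]: "V j \<in> borel_measurable ?L" if "j \<in> S3" for j
      using that Pow by (intro measurable_sigma_superset[of M S3 V]) auto
    have "G l = (\<lambda>\<omega>. e l \<omega> + (\<Sum>j\<in>S3. d l j * V j \<omega>))" by (simp add: e_def fun_eq_iff)
    also have "\<dots> \<in> borel_measurable ?L" by measurable
    finally show ?thesis .
  qed
  then have "sigma_sets (space M) (gen_sa M S2 G) \<subseteq> sets ?L"
    by (intro sigma_gen_sa_subset) (auto simp: space_measure_of[OF Pow])
  then have "sigma_sets (space M) (gen_sa M S2 G) \<subseteq> sigma_sets (space M) (gen_sa M S2 e \<union> gen_sa M S3 V)"
    by (simp add: sets_measure_of[OF Pow])
  then show ?thesis by (intro cond_indep_of_indep[OF _ _ _ ind] meas)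
qed

end

section \<open>Gaussian realizations of a covariance\<close>

text \<open>Induction by Schur complements. \<open>K\<close> may be singular: a zero pivot forces
  its whole column to vanish, and since division by zero yields zero, the same formulas cover this
  case.\<close>

lemma cholesky:
  fixes K :: "'i \<Rightarrow> 'i \<Rightarrow> real"
  assumes "finite S" "\<And>i j. K i j = K j i" "\<And>c. (\<Sum>i\<in>S. \<Sum>j\<in>S. c i * c j * K i j) \<ge> 0"
  shows "\<exists>a. \<forall>i\<in>S. \<forall>j\<in>S. K i j = (\<Sum>l\<in>S. a i l * a j l)"
  using assms
proof (induction S arbitrary: K rule: finite_induct)
  case (insert p S)
  note sym = insert.prems(1)
  have Q: "(\<Sum>i\<in>insert p S. \<Sum>j\<in>insert p S. c i * c j * K i j)
      = (c p)\<^sup>2 * K p p + 2 * c p * (\<Sum>i\<in>S. c i * K i p) + (\<Sum>i\<in>S. \<Sum>j\<in>S. c i * c j * K i j)" for c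
  proof -
    have "(\<Sum>j\<in>S. c p * c j * K p j) = c p * (\<Sum>i\<in>S. c i * K i p)"
      unfolding sum_distrib_left mult.assoc by (intro sum.cong refl) (subst sym[of p], rule refl)
    moreover have "(\<Sum>i\<in>S. c i * c p * K i p) = c p * (\<Sum>i\<in>S. c i * K i p)"
      unfolding sum_distrib_left by (intro sum.cong refl) simp
    ultimately show ?thesis
      using insert.hyps by (simp add: sum.distrib power2_eq_square)
  qed
  have psd: "0 \<le> (c p)\<^sup>2 * K p p + 2 * c p * (\<Sum>i\<in>S. c i * K i p) + (\<Sum>i\<in>S. \<Sum>j\<in>S. c i * c j * K i j)" for c
    using insert.prems(2)[of c] unfolding Q .
  have Kpp: "K p p \<ge> 0"
  proof -
    let ?c = "\<lambda>i. if i = p then 1 else 0 :: real"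
    have "(\<Sum>i\<in>S. ?c i * K i p) = 0" "(\<Sum>i\<in>S. \<Sum>j\<in>S. ?c i * ?c j * K i j) = 0"
      using insert.hyps by (auto intro!: sum.neutral)
    then show ?thesis using psd[of ?c] by simp
  qed
  \<comment> \<open>The Schur complement of the pivot \<open>K p p\<close>; for a covariance, what
    remains after projecting out the variable \<open>p\<close>.\<close>
  define K' where "K' i j = K i j - K i p * K j p / K p p" for i j
  have psd': "(\<Sum>i\<in>S. \<Sum>j\<in>S. c i * c j * K' i j) \<ge> 0" for c
  proof -
    define m where "m = (\<Sum>i\<in>S. c i * K i p)"
    \<comment> \<open>For a positive pivot this value of the coordinate \<open>p\<close> minimizes
      the quadratic form of \<open>K\<close>, and the minimum is the quadratic form of
      \<open>K'\<close>.\<close>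
    let ?c = "c(p := - m / K p p)"
    have "(\<Sum>i\<in>S. ?c i * K i p) = m" "(\<Sum>i\<in>S. \<Sum>j\<in>S. ?c i * ?c j * K i j) = (\<Sum>i\<in>S. \<Sum>j\<in>S. c i * c j * K i j)"
      unfolding m_def using insert.hyps by (auto intro!: sum.cong)
    then have "0 \<le> (m / K p p)\<^sup>2 * K p p - 2 * (m / K p p) * m + (\<Sum>i\<in>S. \<Sum>j\<in>S. c i * c j * K i j)"
      using psd[of ?c] by simp
    also have "(m / K p p)\<^sup>2 * K p p - 2 * (m / K p p) * m = - (m * m / K p p)"
      by (cases "K p p = 0") (auto simp: power2_eq_square field_simps)
    also have "m * m / K p p = (\<Sum>i\<in>S. \<Sum>j\<in>S. c i * c j * (K i p * K j p / K p p))"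
      unfolding m_def by (simp add: sum_product sum_divide_distrib mult_ac)
    finally show ?thesis
      by (simp add: K'_def right_diff_distrib sum_subtractf)
  qed
  obtain a where a: "\<forall>i\<in>S. \<forall>j\<in>S. K' i j = (\<Sum>l\<in>S. a i l * a j l)"
    using insert.IH[of K'] psd' sym by (auto simp: K'_def mult.commute)
  have K0: "K i p = 0" if "K p p = 0" "i \<in> S" for i
  proof (rule ccontr)
    assume nz: "K i p \<noteq> 0"
    \<comment> \<open>With a zero pivot, the form at the vector with \<open>?t\<close> in coordinate
      \<open>p\<close> and 1 in coordinate \<open>i\<close> is
      \<open>2 * ?t * K i p + K i i\<close>. This \<open>?t\<close> makes it equal to -1.\<close>
    let ?t = "- (K i i + 1) / (2 * K i p)"
    let ?c = "\<lambda>j. if j = p then ?t else if j = i then 1 else 0"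
    have ip: "i \<noteq> p" using that insert.hyps by auto
    have "(\<Sum>j\<in>S. ?c j * K j p) = (\<Sum>j\<in>S. if j = i then K i p else 0)"
      using insert.hyps by (intro sum.cong) auto
    moreover have "(\<Sum>j\<in>S. \<Sum>l\<in>S. ?c j * ?c l * K j l) = (\<Sum>j\<in>S. \<Sum>l\<in>S. if j = i then (if l = i then K i i else 0) else 0)"
      using insert.hyps by (intro sum.cong) auto
    moreover have "\<dots> = (\<Sum>j\<in>S. if j = i then K i i else 0)"
      using insert.hyps that by (intro sum.cong) auto
    ultimately have "0 \<le> 2 * ?t * K i p + K i i"
      using psd[of ?c] that insert.hyps by simp
    moreover have "2 * ?t * K i p = - (K i i + 1)" using nz by simp
    ultimately show False by simp
  qed
  \<comment> \<open>Triangular factor: the new column \<open>p\<close> holds the root of the pivot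
    and the column of \<open>K\<close> divided by that root; row \<open>p\<close> is zero
    elsewhere.\<close>
  let ?a = "\<lambda>i l. if l = p then (if i = p then sqrt (K p p) else K i p / sqrt (K p p)) else if i = p then 0 else a i l"
  have s: "(\<Sum>l\<in>insert p S. ?a i l * ?a j l) = ?a i p * ?a j p + (\<Sum>l\<in>S. (if i = p then 0 else a i l) * (if j = p then 0 else a j l))" for i j
  proof -
    have "(\<Sum>l\<in>S. ?a i l * ?a j l) = (\<Sum>l\<in>S. (if i = p then 0 else a i l) * (if j = p then 0 else a j l))"
      using insert.hyps by (intro sum.cong) auto
    then show ?thesis using insert.hyps by (subst sum.insert) auto
  qed
  have "K i j = (\<Sum>l\<in>insert p S. ?a i l * ?a j l)" if ij: "i \<in> insert p S" "j \<in> insert p S" for i j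
  proof -
    have sq: "sqrt (K p p) * sqrt (K p p) = K p p" using Kpp by simp
    have q: "K l p / sqrt (K p p) * sqrt (K p p) = K l p" if "l \<in> S" for l
      using K0[OF _ that] by (cases "K p p = 0") auto
    consider "i = p" "j = p" | "i = p" "j \<noteq> p" "j \<in> S" | "i \<noteq> p" "j = p" "i \<in> S" | "i \<noteq> p" "j \<noteq> p" "i \<in> S" "j \<in> S"
      using ij by auto
    then show ?thesis
    proof cases
      case 1
      then show ?thesis using sq unfolding s by simp
    next
      case 2
      then show ?thesis using q[of j] sym[of p j] unfolding s by (simp add: mult.commute)
    next
      case 3
      then show ?thesis using q[of i] unfolding s by simp
    next
      case 4
      then have "K' i j = (\<Sum>l\<in>S. a i l * a j l)" using a by auto
      moreover have "K i p / sqrt (K p p) * (K j p / sqrt (K p p)) = K i p * K j p / K p p" using Kpp by simp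
      ultimately show ?thesis using 4 Kpp unfolding s K'_def by simp
    qed
  qed
  then show ?case by (intro exI[of _ ?a] ballI)
qed simp

text \<open>Independent normal spaces combine to a Gaussian space because sums of independent normal
  variables are normal. Equality is required on \<open>space M\<close> only, as the model equations
  are given only there. The lemma serves the independent standard normals as well as the noises of
  the model.\<close>

lemma (in prob_space) centered_gaussian_space_direct_sum:
  assumes fin: "finite I" and ind: "indep_sets G I"
    and LG: "\<And>k u B. k \<in> I \<Longrightarrow> u \<in> L k \<Longrightarrow> B \<in> sets borel \<Longrightarrow> u -` B \<inter> space M \<in> G k"
    and Lnormal: "\<And>k u. k \<in> I \<Longrightarrow> u \<in> L k \<Longrightarrow> \<exists>s. normal_rv M u 0 s"
    and Lzero: "\<And>k. k \<in> I \<Longrightarrow> (\<lambda>_. 0) \<in> L k"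
    and Ladd: "\<And>k u v. k \<in> I \<Longrightarrow> u \<in> L k \<Longrightarrow> v \<in> L k \<Longrightarrow> (\<lambda>\<omega>. u \<omega> + v \<omega>) \<in> L k"
    and Lscale: "\<And>k u c. k \<in> I \<Longrightarrow> u \<in> L k \<Longrightarrow> (\<lambda>\<omega>. c * u \<omega>) \<in> L k"
  shows "centered_gaussian_space M {X. \<exists>u. (\<forall>k\<in>I. u k \<in> L k) \<and> (\<forall>\<omega>\<in>space M. X \<omega> = (\<Sum>k\<in>I. u k \<omega>))}"
    and "k \<in> I \<Longrightarrow> u \<in> L k \<Longrightarrow> u \<in> {X. \<exists>u. (\<forall>k\<in>I. u k \<in> L k) \<and> (\<forall>\<omega>\<in>space M. X \<omega> = (\<Sum>k\<in>I. u k \<omega>))}"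
    and "k \<in> I \<Longrightarrow> l \<in> I \<Longrightarrow> k \<noteq> l \<Longrightarrow> u \<in> L k \<Longrightarrow> v \<in> L l \<Longrightarrow> corr M u v = 0"
proof -
  let ?H = "{X. \<exists>u. (\<forall>k\<in>I. u k \<in> L k) \<and> (\<forall>\<omega>\<in>space M. X \<omega> = (\<Sum>k\<in>I. u k \<omega>))}"
  have iv: "indep_vars (\<lambda>_. borel) u I" if "\<And>k. k \<in> I \<Longrightarrow> u k \<in> L k" for u
    unfolding indep_vars_def2
  proof
    show "\<forall>k\<in>I. random_variable borel (u k)" using Lnormal that by (fastforce simp: normal_rv_def)
    show "indep_sets (\<lambda>k. {u k -` A \<inter> space M |A. A \<in> sets borel}) I"
      by (rule indep_sets_mono_sets[OF ind]) (use LG that in auto)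
  qed
  show "centered_gaussian_space M ?H"
  proof
    fix X assume "X \<in> ?H"
    then obtain u where u: "\<And>k. k \<in> I \<Longrightarrow> u k \<in> L k" "\<And>\<omega>. \<omega> \<in> space M \<Longrightarrow> X \<omega> = (\<Sum>k\<in>I. u k \<omega>)" by auto
    have "\<exists>s. \<forall>k\<in>I. normal_rv M (u k) 0 (s k)" by (rule bchoice) (use Lnormal u in blast)
    then obtain s where s: "\<And>k. k \<in> I \<Longrightarrow> normal_rv M (u k) 0 (s k)" by auto
    have "normal_rv M (\<lambda>\<omega>. \<Sum>k\<in>I. u k \<omega>) 0 (\<Sum>k\<in>I. s k)"
      by (rule centered_normal_rv_sum[OF fin iv[OF u(1)] s])
    then show "\<exists>s2. normal_rv M X 0 s2" using normal_rv_cong[of X "\<lambda>\<omega>. \<Sum>k\<in>I. u k \<omega>"] u(2) by auto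
  next
    show "(\<lambda>_. 0) \<in> ?H" by (intro CollectI exI[of _ "\<lambda>_ _. 0"]) (auto intro: Lzero)
  next
    fix X Y assume "X \<in> ?H" "Y \<in> ?H"
    then obtain u v where "\<forall>k\<in>I. u k \<in> L k" "\<forall>\<omega>\<in>space M. X \<omega> = (\<Sum>k\<in>I. u k \<omega>)"
      "\<forall>k\<in>I. v k \<in> L k" "\<forall>\<omega>\<in>space M. Y \<omega> = (\<Sum>k\<in>I. v k \<omega>)" by auto
    then show "(\<lambda>\<omega>. X \<omega> + Y \<omega>) \<in> ?H"
      by (intro CollectI exI[of _ "\<lambda>k \<omega>. u k \<omega> + v k \<omega>"]) (auto intro: Ladd simp: sum.distrib)
  next
    fix X c assume "X \<in> ?H"
    then obtain u where "\<forall>k\<in>I. u k \<in> L k" "\<forall>\<omega>\<in>space M. X \<omega> = (\<Sum>k\<in>I. u k \<omega>)" by auto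
    then show "(\<lambda>\<omega>. c * X \<omega>) \<in> ?H"
      by (intro CollectI exI[of _ "\<lambda>k \<omega>. c * u k \<omega>"]) (auto intro: Lscale simp: sum_distrib_left)
  qed
  show "u \<in> ?H" if "k \<in> I" "u \<in> L k" for k u
  proof (intro CollectI exI[of _ "\<lambda>l. if l = k then u else (\<lambda>_. 0)"] conjI ballI)
    fix \<omega>
    have "(\<Sum>l\<in>I. (if l = k then u else (\<lambda>_. 0)) \<omega>) = (\<Sum>l\<in>I. if l = k then u \<omega> else 0)"
      by (intro sum.cong) auto
    then show "u \<omega> = (\<Sum>l\<in>I. (if l = k then u else (\<lambda>_. 0)) \<omega>)" using fin that by simp
  qed (use that Lzero in auto)
  show "corr M u v = 0" if kl: "k \<in> I" "l \<in> I" "k \<noteq> l" "u \<in> L k" "v \<in> L l" for k l u v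
  proof -
    obtain s t where "normal_rv M u 0 s" "normal_rv M v 0 t"
      using Lnormal[OF kl(1,4)] Lnormal[OF kl(2,5)] by auto
    note moments = this[THEN centered_normal_rv_moments(1)] this[THEN centered_normal_rv_moments(3)]
    have rv: "random_variable borel u" "random_variable borel v" using Lnormal that by (auto simp: normal_rv_def)
    let ?A = "{u -` A \<inter> space M |A. A \<in> sets borel}" and ?B = "{v -` A \<inter> space M |A. A \<in> sets borel}"
    have st: "Int_stable {w -` A \<inter> space M |A. A \<in> sets borel}" for w :: "'a \<Rightarrow> real"
    proof (rule Int_stableI)
      fix a b assume "a \<in> {w -` A \<inter> space M |A. A \<in> sets borel}" "b \<in> {w -` A \<inter> space M |A. A \<in> sets borel}"
      then obtain A B where "A \<in> sets borel" "B \<in> sets borel" "a = w -` A \<inter> space M" "b = w -` B \<inter> space M" by auto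
      then show "a \<inter> b \<in> {w -` A \<inter> space M |A. A \<in> sets borel}"
        by (intro CollectI exI[of _ "A \<inter> B"]) auto
    qed
    have "indep_set ?A ?B"
    proof (rule indep_setI)
      show "?A \<subseteq> events" "?B \<subseteq> events" using rv by (auto intro: measurable_sets)
      fix a b assume "a \<in> ?A" "b \<in> ?B"
      then have ab: "a \<in> G k" "b \<in> G l" using LG that by auto
      have "prob (\<Inter>j\<in>{k, l}. (if j = k then a else b)) = (\<Prod>j\<in>{k, l}. prob (if j = k then a else b))"
        by (rule indep_setsD[OF ind]) (use that ab in auto)
      then show "prob (a \<inter> b) = prob a * prob b" using that by (simp add: Int_commute)
    qed
    then have "indep_set (sigma_sets (space M) ?A) (sigma_sets (space M) ?B)"
      by (rule indep_set_sigma_sets) (rule st)+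
    then have "indep_var borel u borel v" using rv by (simp add: indep_var_eq)
    then show ?thesis unfolding corr_def
      using moments by (subst indep_var_lebesgue_integral) auto
  qed
qed

text \<open>Independent standard normals are mixed by a Cholesky factor. The index set is embedded
  into the naturals, so that the sample space has the fixed type
  \<open>nat \<Rightarrow> real\<close> whatever the index type.\<close>

lemma gaussian_realization:
  fixes K :: "'i \<Rightarrow> 'i \<Rightarrow> real"
  assumes fin: "finite S" and sym: "\<And>i j. K i j = K j i" and psd: "\<And>c. (\<Sum>i\<in>S. \<Sum>j\<in>S. c i * c j * K i j) \<ge> 0"
  shows "\<exists>(M :: (nat \<Rightarrow> real) measure) H Z. centered_gaussian_space M H \<and> (\<forall>i\<in>S. Z i \<in> H) \<and>
    (\<forall>i\<in>S. \<forall>j\<in>S. corr M (Z i) (Z j) = K i j)"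
proof -
  define M :: "(nat \<Rightarrow> real) measure" where "M = PiM UNIV (\<lambda>_. std_normal_distribution)"
  have std: "prob_space std_normal_distribution" by (rule prob_space_normal_density) simp
  interpret prob_space M unfolding M_def by (rule prob_space_PiM) (rule std)
  have sM [measurable_cong]: "sets M = sets (PiM UNIV (\<lambda>_. borel))"
    unfolding M_def by (rule sets_PiM_cong) auto
  have spM: "space M = UNIV" using sets_eq_imp_space_eq[OF sM] by (simp add: space_PiM)
  have meas [measurable]: "(\<lambda>\<omega>. \<omega> n) \<in> borel_measurable M" for n by measurable
  have coord: "distr M borel (\<lambda>\<omega>. \<omega> n) = std_normal_distribution" for n
  proof -
    interpret P: product_prob_space "\<lambda>_. std_normal_distribution" "UNIV :: nat set"
      using std by (auto simp: product_prob_space_def product_prob_space_axioms_def product_sigma_finite_def prob_space_imp_sigma_finite)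
    have "distr M borel (\<lambda>\<omega>. \<omega> n) = distr M std_normal_distribution (\<lambda>\<omega>. \<omega> n)"
      by (rule distr_cong) auto
    also have "\<dots> = std_normal_distribution" unfolding M_def by (rule P.PiM_component) simp
    finally show ?thesis .
  qed
  have "indep_vars (\<lambda>_. borel) (\<lambda>n \<omega>. \<omega> n) (UNIV :: nat set)"
  proof (subst indep_vars_iff_distr_eq_PiM')
    have "distr M (PiM UNIV (\<lambda>_. borel)) (\<lambda>\<omega>. \<lambda>n\<in>UNIV. \<omega> n) = distr M M (\<lambda>\<omega>. \<omega>)"
      using sM by (intro distr_cong) auto
    also have "\<dots> = M" by (simp add: distr_id2)
    finally show "distr M (PiM UNIV (\<lambda>_. borel)) (\<lambda>\<omega>. \<lambda>n\<in>UNIV. \<omega> n) = PiM UNIV (\<lambda>n. distr M borel (\<lambda>\<omega>. \<omega> n))"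
      by (simp add: coord) (simp add: M_def)
  qed auto
  then have ind: "indep_sets (\<lambda>n. {(\<lambda>\<omega>. \<omega> n) -` A \<inter> space M |A. A \<in> sets borel}) (UNIV :: nat set)"
    by (auto simp: indep_vars_def2)
  define f where "f = to_nat_on S"
  have f: "inj_on f S" unfolding f_def by (rule inj_on_to_nat_on[OF countable_finite[OF fin]])
  define G where "G n = {(\<lambda>\<omega> :: nat \<Rightarrow> real. \<omega> n) -` A \<inter> space M |A. A \<in> sets borel}" for n
  define L where "L n = {u :: (nat \<Rightarrow> real) \<Rightarrow> real. \<exists>c. u = (\<lambda>\<omega>. c * \<omega> n)}" for n
  have nrm: "normal_rv M (\<lambda>\<omega>. \<omega> n) 0 1" for n by (simp add: normal_rv_def coord)
  have indG: "indep_sets G (f ` S)" unfolding G_def by (rule indep_sets_mono_index[OF _ ind]) simp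
  have LG: "u -` B \<inter> space M \<in> G n" if uB: "u \<in> L n" "B \<in> sets borel" for n u B
  proof -
    obtain c where u: "u = (\<lambda>\<omega>. c * \<omega> n)" using uB by (auto simp: L_def)
    have [measurable]: "B \<in> sets borel" by fact
    have "{x :: real. c * x \<in> B} \<in> sets borel" by measurable
    then show ?thesis unfolding G_def by (intro CollectI exI[of _ "{x. c * x \<in> B}"]) (auto simp: u)
  qed
  have Ladd: "(\<lambda>\<omega>. u \<omega> + v \<omega>) \<in> L n" if uv: "u \<in> L n" "v \<in> L n" for u v n
  proof -
    obtain c d where "u = (\<lambda>\<omega>. c * \<omega> n)" "v = (\<lambda>\<omega>. d * \<omega> n)" using uv by (auto simp: L_def)
    then show ?thesis unfolding L_def by (intro CollectI exI[of _ "c + d"]) (auto simp: distrib_right)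
  qed
  have Lscale: "(\<lambda>\<omega>. e * u \<omega>) \<in> L n" if u: "u \<in> L n" for u n e
  proof -
    obtain c where "u = (\<lambda>\<omega>. c * \<omega> n)" using u by (auto simp: L_def)
    then show ?thesis unfolding L_def by (intro CollectI exI[of _ "e * c"]) auto
  qed
  have Lnormal: "\<exists>s. normal_rv M u 0 s" if "u \<in> L n" for u n
    using that centered_normal_rv_cmult[OF nrm[of n]] by (auto simp: L_def)
  have Lzero: "(\<lambda>_. 0) \<in> L n" for n unfolding L_def by (intro CollectI exI[of _ 0]) auto
  let ?H = "{X. \<exists>u. (\<forall>k\<in>f ` S. u k \<in> L k) \<and> (\<forall>\<omega>\<in>space M. X \<omega> = (\<Sum>k\<in>f ` S. u k \<omega>))}"
  have *: "centered_gaussian_space M ?H" "\<And>k u. k \<in> f ` S \<Longrightarrow> u \<in> L k \<Longrightarrow> u \<in> ?H"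
    "\<And>k l u v. k \<in> f ` S \<Longrightarrow> l \<in> f ` S \<Longrightarrow> k \<noteq> l \<Longrightarrow> u \<in> L k \<Longrightarrow> v \<in> L l \<Longrightarrow> corr M u v = 0"
    by (rule centered_gaussian_space_direct_sum[OF finite_imageI[OF fin] indG];
        (rule LG Lnormal Lzero Ladd Lscale)?; assumption?)+
  interpret centered_gaussian_space M ?H by (rule *(1))
  have gH: "(\<lambda>\<omega>. \<omega> (f l)) \<in> ?H" if "l \<in> S" for l
    using that by (intro *(2)[of "f l"]) (auto simp: L_def intro!: exI[of _ 1])
  have orth: "corr M (\<lambda>\<omega>. \<omega> (f i)) (\<lambda>\<omega>. \<omega> (f j)) = (if i = j then 1 else 0)" if "i \<in> S" "j \<in> S" for i j
  proof (cases "i = j")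
    case True
    then show ?thesis using centered_normal_rv_moments(4)[OF nrm[of "f i"]] by (simp add: corr_def power2_eq_square)
  next
    case False
    then show ?thesis using that inj_onD[OF f] by (subst *(3)[of "f i" "f j"]) (auto simp: L_def intro!: exI[of _ 1])
  qed
  obtain a where a: "\<forall>i\<in>S. \<forall>j\<in>S. K i j = (\<Sum>l\<in>S. a i l * a j l)"
    using cholesky[OF fin sym psd] by auto
  define Z where "Z i \<omega> = (\<Sum>l\<in>S. a i l * \<omega> (f l))" for i and \<omega> :: "nat \<Rightarrow> real"
  have ZH: "Z i \<in> ?H" for i unfolding Z_def[abs_def] by (rule H_lincomb[OF gH])
  have g: "corr M (\<lambda>\<omega>. \<omega> (f l)) (Z j) = a j l" if "l \<in> S" for l j
  proof -
    have "corr M (\<lambda>\<omega>. \<omega> (f l)) (Z j) = (\<Sum>k\<in>S. a j k * corr M (\<lambda>\<omega>. \<omega> (f k)) (\<lambda>\<omega>. \<omega> (f l)))"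
      unfolding corr_sym[of M "\<lambda>\<omega>. \<omega> (f l)"] Z_def[abs_def] by (rule ip_lincomb) (use gH that in auto)
    also have "\<dots> = (\<Sum>k\<in>S. if k = l then a j k else 0)" using orth that by (intro sum.cong) auto
    finally show ?thesis using that fin by simp
  qed
  have "corr M (Z i) (Z j) = K i j" if "i \<in> S" "j \<in> S" for i j
  proof -
    have "corr M (Z i) (Z j) = (\<Sum>l\<in>S. a i l * corr M (\<lambda>\<omega>. \<omega> (f l)) (Z j))"
      unfolding Z_def[of i, abs_def] by (rule ip_lincomb) (use gH ZH in auto)
    then show ?thesis using a that by (simp add: g)
  qed
  then show ?thesis using *(1) ZH by blast
qed

text \<open>The characteristic function of a combination depends on its variance only, hence on the
  covariances. Both families are first moved to the common product space, where their laws can be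
  compared on rectangles.\<close>

lemma gaussian_law_eq:
  fixes X :: "'i \<Rightarrow> 'a \<Rightarrow> real" and Y :: "'i \<Rightarrow> 'b \<Rightarrow> real"
  assumes M: "centered_gaussian_space M H" and N: "centered_gaussian_space N H'"
    and fin: "finite S" and X: "\<And>i. i \<in> S \<Longrightarrow> X i \<in> H" and Y: "\<And>i. i \<in> S \<Longrightarrow> Y i \<in> H'"
    and eq: "\<And>i j. i \<in> S \<Longrightarrow> j \<in> S \<Longrightarrow> corr M (X i) (X j) = corr N (Y i) (Y j)"
  shows "distr M (PiM S (\<lambda>_. borel)) (\<lambda>\<omega>. \<lambda>i\<in>S. X i \<omega>) = distr N (PiM S (\<lambda>_. borel)) (\<lambda>\<omega>. \<lambda>i\<in>S. Y i \<omega>)"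
    (is "?P = ?Q")
proof -
  interpret M: centered_gaussian_space M H by fact
  interpret N: centered_gaussian_space N H' by fact
  have [measurable]: "X i \<in> borel_measurable M" "Y i \<in> borel_measurable N" if "i \<in> S" for i
    using X Y that M.H_measurable N.H_measurable by auto
  interpret P: prob_space ?P by (rule M.prob_space_distr) measurable
  interpret Q: prob_space ?Q by (rule N.prob_space_distr) measurable
  have ch: "(\<integral>p. iexp (\<Sum>i\<in>S. c i * p i) \<partial>?P) = (\<integral>p. iexp (\<Sum>i\<in>S. c i * p i) \<partial>?Q)" for c :: "'i \<Rightarrow> real"
  proof -
    have r: "(\<Sum>i\<in>S. c i * (\<lambda>i\<in>S. g i) i) = (\<Sum>i\<in>S. c i * g i)" for g
      by (intro sum.cong) auto
    have "(\<integral>p. iexp (\<Sum>i\<in>S. c i * p i) \<partial>?P) = (\<integral>\<omega>. iexp (\<Sum>i\<in>S. c i * (\<lambda>i\<in>S. X i \<omega>) i) \<partial>M)"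
      by (rule integral_distr) measurable
    also have "\<dots> = (\<integral>\<omega>. iexp (\<Sum>i\<in>S. c i * X i \<omega>) \<partial>M)" by (simp only: r)
    also have "\<dots> = of_real (exp (- corr M (\<lambda>\<omega>. \<Sum>i\<in>S. c i * X i \<omega>) (\<lambda>\<omega>. \<Sum>i\<in>S. c i * X i \<omega>) / 2))"
      using X by (intro M.char_H M.H_lincomb)
    also have "\<dots> = of_real (exp (- corr N (\<lambda>\<omega>. \<Sum>i\<in>S. c i * Y i \<omega>) (\<lambda>\<omega>. \<Sum>i\<in>S. c i * Y i \<omega>) / 2))"
      using X Y eq by (simp add: corr_lincomb_self M.H_sq_integrable N.H_sq_integrable cong: sum.cong)
    also have "\<dots> = (\<integral>\<omega>. iexp (\<Sum>i\<in>S. c i * Y i \<omega>) \<partial>N)"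
      using Y by (intro N.char_H[symmetric] N.H_lincomb)
    also have "\<dots> = (\<integral>\<omega>. iexp (\<Sum>i\<in>S. c i * (\<lambda>i\<in>S. Y i \<omega>) i) \<partial>N)" by (simp only: r)
    also have "\<dots> = (\<integral>p. iexp (\<Sum>i\<in>S. c i * p i) \<partial>?Q)"
      by (rule integral_distr[symmetric]) measurable
    finally show ?thesis .
  qed
  show ?thesis
  proof (rule measure_eqI_PiM_finite[OF fin])
    fix A :: "'i \<Rightarrow> real set" assume A: "\<And>i. i \<in> S \<Longrightarrow> A i \<in> sets borel"
    have "PiE S A = {p \<in> space ?P. \<forall>i\<in>S. p i \<in> A i}"
      unfolding space_distr space_PiM set_eq_iff mem_Collect_eq PiE_iff space_borel by blast
    moreover have "measure ?P {p \<in> space ?P. \<forall>i\<in>S. p i \<in> A i} = measure ?Q {p \<in> space ?P. \<forall>i\<in>S. p i \<in> A i}"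
      by (rule cramer_wold_rectangles[OF fin P.finite_measure_axioms Q.finite_measure_axioms _ _ ch A]) auto
    ultimately show "emeasure ?P (PiE S A) = emeasure ?Q (PiE S A)"
      by (simp only: P.emeasure_eq_measure Q.emeasure_eq_measure)
  next
    show "range (\<lambda>_::nat. PiE S (\<lambda>_. UNIV :: real set)) \<subseteq> prod_algebra S (\<lambda>_. borel)"
      by (auto intro!: prod_algebraI_finite[OF fin])
    show "(\<Union>i::nat. PiE S (\<lambda>_. UNIV :: real set)) = space (PiM S (\<lambda>_. borel))"
      by (simp add: space_PiM)
    show "emeasure ?P (PiE S (\<lambda>_. UNIV)) \<noteq> \<infinity>" by (simp add: P.emeasure_eq_measure)
  qed simp_all
qed

section \<open>Second moments and conditional independence\<close>

text \<open>With \<open>F\<close> the conditioning sigma-algebra, conditional independence says that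
  \<open>indicator A - E[indicator A | F]\<close> integrates to zero over every event of \<open>G2\<close>.
  Conditioning this first on \<open>G2\<close> and then the outcome on \<open>G1\<close> extends it to
  integrable variables.\<close>

lemma (in prob_space) cond_indep_imp_uncorrelated:
  assumes ci: "cond_indep M G1 G2 F" and G1: "G1 \<subseteq> sets M" and G2: "G2 \<subseteq> sets M" and F: "F \<subseteq> sets M"
    and U: "U \<in> borel_measurable (sigma (space M) G1)" and X: "X \<in> borel_measurable (sigma (space M) G2)"
    and iX: "integrable M X" and P: "AE \<omega> in M. real_cond_exp M (sigma (space M) F) X \<omega> = P \<omega>"
    and Pm: "P \<in> borel_measurable M" and iUX: "integrable M (\<lambda>\<omega>. U \<omega> * (X \<omega> - P \<omega>))"
  shows "(\<integral>\<omega>. U \<omega> * (X \<omega> - P \<omega>) \<partial>M) = 0"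
proof -
  let ?\<Omega> = "space M"
  have sg: "sets (sigma ?\<Omega> G) = sigma_sets ?\<Omega> G \<and> subalgebra M (sigma ?\<Omega> G)" if "G \<subseteq> sets M" for G
  proof -
    have "G \<subseteq> Pow ?\<Omega>" using that sets.space_closed by blast
    then show ?thesis using sets.sigma_sets_subset[OF that]
      by (simp add: subalgebra_def sets_measure_of space_measure_of)
  qed
  let ?F = "sigma ?\<Omega> F"
  interpret F: sigma_finite_subalgebra M ?F by (rule sigma_finite_subalgebraI) (use sg F in auto)
  interpret G1: sigma_finite_subalgebra M "sigma ?\<Omega> G1" by (rule sigma_finite_subalgebraI) (use sg G1 in auto)
  interpret G2: sigma_finite_subalgebra M "sigma ?\<Omega> G2" by (rule sigma_finite_subalgebraI) (use sg G2 in auto)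
  define ce where "ce A = real_cond_exp M ?F (indicator A)" for A :: "'a set"
  have ceF [measurable]: "ce A \<in> borel_measurable ?F" and ceM [measurable]: "ce A \<in> borel_measurable M" for A
    by (auto simp: ce_def)
  have ii: "integrable M (indicator A :: 'a \<Rightarrow> real)" if "A \<in> sets M" for A
    using that by (simp add: integrable_indicator_iff emeasure_eq_measure)
  have ce01: "AE \<omega> in M. \<bar>ce A \<omega>\<bar> \<le> 1" if A: "A \<in> sets M" for A
    unfolding ce_def using F.real_cond_exp_ge_c[OF ii[OF A], of 0] F.real_cond_exp_le_c[OF ii[OF A], of 1]
    by (auto simp: indicator_def)
  have ice: "integrable M (ce A)" if "A \<in> sets M" for A unfolding ce_def by (rule F.real_cond_exp_int(1)[OF ii[OF that]])
  have [measurable]: "X \<in> borel_measurable M" "U \<in> borel_measurable M" "P \<in> borel_measurable M"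
    using measurable_from_subalg[OF _ X] measurable_from_subalg[OF _ U] sg[OF G1] sg[OF G2] Pm by auto
  have iP: "integrable M P"
    using F.real_cond_exp_int(1)[OF iX] by (rule integrable_cong_AE_imp) (use P in \<open>auto elim: eventually_mono\<close>)
  have key: "(\<integral>\<omega>. indicator A \<omega> * (X \<omega> - P \<omega>) \<partial>M) = 0" if A: "A \<in> sigma_sets ?\<Omega> G1" for A
  proof -
    have AM [measurable]: "A \<in> sets M" using A sets.sigma_sets_subset[OF G1] by auto
    let ?h = "\<lambda>\<omega>. indicator A \<omega> - ce A \<omega>"
    have ih: "integrable M ?h" using ii[OF AM] ice[OF AM] by simp
    have hb: "AE \<omega> in M. \<bar>?h \<omega>\<bar> \<le> 2" using ce01[OF AM] by (auto simp: indicator_def elim!: eventually_mono)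
    \<comment> \<open>Conditional independence enters here: \<open>indicator A\<close> and
      \<open>ce A\<close> have the same integral over \<open>B\<close>, namely the integral of
      \<open>ce A * ce B\<close>.\<close>
    have zero: "(\<integral>\<omega>\<in>B. ?h \<omega> \<partial>M) = 0" if B: "B \<in> sigma_sets ?\<Omega> G2" for B
    proof -
      have BM [measurable]: "B \<in> sets M" using B sets.sigma_sets_subset[OF G2] by auto
      have "AE \<omega> in M. ce (A \<inter> B) \<omega> = ce A \<omega> * ce B \<omega>"
        using ci A B unfolding cond_indep_def ce_def by blast
      then have "(\<integral>\<omega>. ce (A \<inter> B) \<omega> \<partial>M) = (\<integral>\<omega>. ce A \<omega> * ce B \<omega> \<partial>M)"
        by (intro integral_cong_AE) auto
      also have "\<dots> = (\<integral>\<omega>. ce A \<omega> * indicator B \<omega> \<partial>M)"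
        unfolding ce_def[of B]
      proof (rule F.real_cond_exp_intg(2))
        show "integrable M (\<lambda>\<omega>. ce A \<omega> * indicator B \<omega>)"
          using integrable_mult_indicator[OF BM ice[OF AM]] by (simp add: mult.commute)
      qed auto
      finally have 1: "(\<integral>\<omega>. ce (A \<inter> B) \<omega> \<partial>M) = (\<integral>\<omega>. ce A \<omega> * indicator B \<omega> \<partial>M)" .
      have "(\<integral>\<omega>. ce (A \<inter> B) \<omega> \<partial>M) = (\<integral>\<omega>. indicator (A \<inter> B) \<omega> \<partial>M)"
        unfolding ce_def by (rule F.real_cond_exp_int(2)[OF ii]) auto
      also have "\<dots> = (\<integral>\<omega>. indicator B \<omega> * indicator A \<omega> \<partial>M)"
        by (simp add: indicator_inter_arith mult.commute)
      finally show ?thesis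
        using 1 integrable_mult_indicator[OF BM ice[OF AM]] integrable_mult_indicator[OF BM ii[OF AM]]
        by (simp add: set_lebesgue_integral_def right_diff_distrib mult.commute)
    qed
    have hX: "integrable M (\<lambda>\<omega>. X \<omega> * ?h \<omega>)"
    proof (rule Bochner_Integration.integrable_bound)
      show "integrable M (\<lambda>\<omega>. 2 * X \<omega>)" using iX by simp
      show "AE \<omega> in M. norm (X \<omega> * ?h \<omega>) \<le> norm (2 * X \<omega>)"
        using hb by eventually_elim (simp add: abs_mult mult.commute mult_left_mono)
    qed measurable
    have "AE \<omega> in M. real_cond_exp M (sigma ?\<Omega> G2) ?h \<omega> = 0"
      by (rule G2.real_cond_exp_charact) (use zero sg[OF G2] ih in \<open>auto simp: set_lebesgue_integral_def\<close>)
    then have "(\<integral>\<omega>. X \<omega> * real_cond_exp M (sigma ?\<Omega> G2) ?h \<omega> \<partial>M) = 0"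
      by (intro integral_eq_zero_AE) (auto elim: eventually_mono)
    then have "(\<integral>\<omega>. X \<omega> * ?h \<omega> \<partial>M) = 0"
      using G2.real_cond_exp_intg(2)[OF hX X] by simp
    moreover have iA: "integrable M (\<lambda>\<omega>. indicator A \<omega> * X \<omega>)" "integrable M (\<lambda>\<omega>. indicator A \<omega> * P \<omega>)"
      using integrable_mult_indicator[OF AM iX] integrable_mult_indicator[OF AM iP] by simp_all
    moreover have iceX: "integrable M (\<lambda>\<omega>. ce A \<omega> * X \<omega>)"
      using Bochner_Integration.integrable_diff[OF iA(1) hX] by (simp add: algebra_simps)
    \<comment> \<open>Self-adjointness again: both sides equal the integral of \<open>ce A\<close>
      times the conditional expectation of \<open>X\<close> given \<open>F\<close>.\<close>
    moreover have "(\<integral>\<omega>. indicator A \<omega> * P \<omega> \<partial>M) = (\<integral>\<omega>. ce A \<omega> * X \<omega> \<partial>M)"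
    proof -
      have iceP: "integrable M (\<lambda>\<omega>. real_cond_exp M ?F X \<omega> * indicator A \<omega>)"
        using integrable_mult_indicator[OF AM F.real_cond_exp_int(1)[OF iX]] by (simp add: mult.commute)
      have "(\<integral>\<omega>. ce A \<omega> * X \<omega> \<partial>M) = (\<integral>\<omega>. ce A \<omega> * real_cond_exp M ?F X \<omega> \<partial>M)"
        by (rule F.real_cond_exp_intg(2)[symmetric, OF iceX]) auto
      also have "\<dots> = (\<integral>\<omega>. real_cond_exp M ?F X \<omega> * ce A \<omega> \<partial>M)" by (simp add: mult.commute)
      also have "\<dots> = (\<integral>\<omega>. real_cond_exp M ?F X \<omega> * indicator A \<omega> \<partial>M)"
        unfolding ce_def by (rule F.real_cond_exp_intg(2)[OF iceP]) auto
      also have "\<dots> = (\<integral>\<omega>. indicator A \<omega> * P \<omega> \<partial>M)"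
        using P by (intro integral_cong_AE) (auto elim!: eventually_mono)
      finally show ?thesis by simp
    qed
    ultimately show ?thesis by (simp add: algebra_simps)
  qed
  let ?d = "\<lambda>\<omega>. X \<omega> - P \<omega>"
  \<comment> \<open>\<open>key\<close> says that the residual has conditional expectation zero given
    \<open>G1\<close>. Passing through this conditional expectation admits an unbounded
    \<open>U\<close>, as long as the product is integrable.\<close>
  have "AE \<omega> in M. real_cond_exp M (sigma ?\<Omega> G1) ?d \<omega> = 0"
    by (rule G1.real_cond_exp_charact) (use key sg[OF G1] iX iP in \<open>auto simp: set_lebesgue_integral_def\<close>)
  then have "(\<integral>\<omega>. U \<omega> * real_cond_exp M (sigma ?\<Omega> G1) ?d \<omega> \<partial>M) = 0"
    by (intro integral_eq_zero_AE) (auto elim: eventually_mono)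
  then show ?thesis using G1.real_cond_exp_intg(2)[OF iUX U] by simp
qed

text \<open>\<open>estc A k i (l, j)\<close> is the coefficient of \<open>J l $ j\<close> in \<open>est A J k $ i\<close>.\<close>

fun estc :: "(nat \<Rightarrow> real^'n^'n) \<Rightarrow> nat \<Rightarrow> 'n::finite \<Rightarrow> nat \<times> 'n \<Rightarrow> real" where
  "estc A 0 i p = (if p = (0, i) then 1 else 0)"
| "estc A (Suc k) i p = (\<Sum>j\<in>UNIV. A (Suc k) $ i $ j * estc A k j p) + (if p = (Suc k, i) then 1 else 0)"

text \<open>The sum runs up to \<open>T\<close> for every \<open>k\<close>, so that one index set
  serves all times; the coefficients of inputs after time \<open>k\<close> are zero.\<close>

lemma est_lincomb:
  assumes "k \<le> T"
  shows "est A J k \<omega> $ i = (\<Sum>p\<in>{..T} \<times> UNIV. estc A k i p * J (fst p) \<omega> $ snd p)"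
  using assms
proof (induction k arbitrary: i)
  case 0
  have "(\<Sum>p\<in>{..T} \<times> UNIV. estc A 0 i p * J (fst p) \<omega> $ snd p) = (\<Sum>p\<in>{..T} \<times> UNIV. if p = (0, i) then J 0 \<omega> $ i else 0)"
    by (intro sum.cong) auto
  then show ?case by simp
next
  case (Suc k)
  let ?g = "\<lambda>p. J (fst p) \<omega> $ snd p"
  have s: "(\<Sum>p\<in>{..T} \<times> UNIV. (if p = (Suc k, i) then 1 else 0) * ?g p) = (\<Sum>p\<in>{..T} \<times> UNIV. if p = (Suc k, i) then J (Suc k) \<omega> $ i else 0)"
    by (intro sum.cong) auto
  have "est A J (Suc k) \<omega> $ i = (\<Sum>j\<in>UNIV. A (Suc k) $ i $ j * (\<Sum>p\<in>{..T} \<times> UNIV. estc A k j p * ?g p)) + J (Suc k) \<omega> $ i"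
    using Suc by (simp add: matrix_vector_mult_def)
  also have "(\<Sum>j\<in>UNIV. A (Suc k) $ i $ j * (\<Sum>p\<in>{..T} \<times> UNIV. estc A k j p * ?g p))
      = (\<Sum>p\<in>{..T} \<times> UNIV. (\<Sum>j\<in>UNIV. A (Suc k) $ i $ j * estc A k j p) * ?g p)"
    unfolding sum_distrib_left sum_distrib_right by (subst sum.swap) (simp add: mult.assoc)
  finally show ?case using Suc.prems s by (simp add: distrib_right sum.distrib)
qed

text \<open>This makes the cost a function of the covariances of state and input, so that it carries
  over to any space with the same covariances.\<close>

lemma wmse_eq_sum_corr:
  assumes x: "\<And>k i. k \<le> T \<Longrightarrow> sq_integrable M (\<lambda>\<omega>. x k \<omega> $ i)" and J: "\<And>k i. k \<le> T \<Longrightarrow> sq_integrable M (\<lambda>\<omega>. J k \<omega> $ i)"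
  shows "wmse M \<alpha> x (est A J) T = (\<Sum>k\<le>T. \<alpha> k * (\<Sum>i\<in>UNIV.
    corr M (\<lambda>\<omega>. x k \<omega> $ i - (\<Sum>p\<in>{..T} \<times> UNIV. estc A k i p * J (fst p) \<omega> $ snd p))
           (\<lambda>\<omega>. x k \<omega> $ i - (\<Sum>p\<in>{..T} \<times> UNIV. estc A k i p * J (fst p) \<omega> $ snd p))))"
  unfolding wmse_def
proof (intro sum.cong refl arg_cong2[where f="(*)"])
  fix k assume k: "k \<in> {..T}"
  let ?d = "\<lambda>i \<omega>. x k \<omega> $ i - (\<Sum>p\<in>{..T} \<times> UNIV. estc A k i p * J (fst p) \<omega> $ snd p)"
  have d: "sq_integrable M (?d i)" for i
    by (intro sq_integrable_diff sq_integrable_lincomb x J) (use k in auto)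
  have "(norm (x k \<omega> - est A J k \<omega>))\<^sup>2 = (\<Sum>i\<in>UNIV. ?d i \<omega> * ?d i \<omega>)" for \<omega>
    using k by (simp add: power2_norm_eq_inner inner_vec_def est_lincomb[of k T])
  then show "(\<integral>\<omega>. (norm (x k \<omega> - est A J k \<omega>))\<^sup>2 \<partial>M) = (\<Sum>i\<in>UNIV. corr M (?d i) (?d i))"
    using sq_integrable_mult[OF d d] by (simp add: corr_def)
qed

section \<open>The state-space model\<close>

definition vec_coords :: "(nat \<Rightarrow> 'a \<Rightarrow> real^'n) \<Rightarrow> (nat \<Rightarrow> 'a \<Rightarrow> real^'m) \<Rightarrow> (nat \<times> 'n) + (nat \<times> 'm) \<Rightarrow> 'a \<Rightarrow> real" where
  "vec_coords x y = case_sum (\<lambda>(k, i) \<omega>. x k \<omega> $ i) (\<lambda>(k, i) \<omega>. y k \<omega> $ i)"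

text \<open>The map that reassembles scalars into vectors does not depend on the measure, so
  equality of the laws of the flat scalar families is enough for equality of joint laws.\<close>

lemma joint_law_eq_distr_coords:
  fixes u :: "nat \<Rightarrow> 'a \<Rightarrow> real^'n" and v :: "nat \<Rightarrow> 'a \<Rightarrow> real^'m"
  assumes uv: "\<And>a. a \<in> ({..T} \<times> UNIV) <+> ({..T} \<times> UNIV) \<Longrightarrow> vec_coords u v a \<in> borel_measurable L"
  shows "joint_law L T u v = distr
    (distr L (PiM (({..T} \<times> UNIV) <+> ({..T} \<times> UNIV)) (\<lambda>_. borel)) (\<lambda>\<omega>. \<lambda>a\<in>({..T} \<times> UNIV) <+> ({..T} \<times> UNIV). vec_coords u v a \<omega>))
    (PiM {..T} (\<lambda>_. borel) \<Otimes>\<^sub>M PiM {..T} (\<lambda>_. borel))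
    (\<lambda>p. (\<lambda>k\<in>{..T}. \<chi> i. p (Inl (k, i)), \<lambda>k\<in>{..T}. \<chi> i. p (Inr (k, i))))"
proof -
  let ?S = "({..T} \<times> (UNIV :: 'n set)) <+> ({..T} \<times> (UNIV :: 'm set))"
  let ?T = "PiM {..T} (\<lambda>_. borel :: (real^'n) measure) \<Otimes>\<^sub>M PiM {..T} (\<lambda>_. borel :: (real^'m) measure)"
  define \<psi> where "\<psi> p = (\<lambda>k\<in>{..T}. \<chi> i. p (Inl (k, i)) :: real^'n, \<lambda>k\<in>{..T}. \<chi> i. p (Inr (k, i)) :: real^'m)"
    for p :: "(nat \<times> 'n) + (nat \<times> 'm) \<Rightarrow> real"
  have \<psi>: "\<psi> \<in> measurable (PiM ?S (\<lambda>_. borel)) ?T"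
  proof -
    have c: "(\<lambda>p. p a) \<in> borel_measurable (PiM ?S (\<lambda>_. borel :: real measure))" if "a \<in> ?S" for a
      using that by (rule measurable_component_singleton)
    have "(\<lambda>p. \<chi> i. p (Inl (k, i)) :: real^'n) \<in> borel_measurable (PiM ?S (\<lambda>_. borel :: real measure))" if "k \<le> T" for k
      unfolding borel_measurable_vec_iff using that by (auto intro: c)
    moreover have "(\<lambda>p. \<chi> i. p (Inr (k, i)) :: real^'m) \<in> borel_measurable (PiM ?S (\<lambda>_. borel :: real measure))" if "k \<le> T" for k
      unfolding borel_measurable_vec_iff using that by (auto intro: c)
    ultimately show ?thesis unfolding \<psi>_def[abs_def]
      by (intro measurable_Pair measurable_restrict) auto
  qed
  have m: "(\<lambda>\<omega>. \<lambda>a\<in>?S. vec_coords u v a \<omega>) \<in> measurable L (PiM ?S (\<lambda>_. borel))"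
    by (intro measurable_restrict uv)
  have "\<psi> (\<lambda>a\<in>?S. vec_coords u v a \<omega>) = (\<lambda>k\<in>{..T}. u k \<omega>, \<lambda>k\<in>{..T}. v k \<omega>)" for \<omega>
    by (auto simp: \<psi>_def vec_coords_def fun_eq_iff vec_eq_iff)
  then show ?thesis unfolding joint_law_def \<psi>_def[symmetric]
    by (subst distr_distr[OF \<psi> m]) (simp add: comp_def)
qed

lemma joint_law_eq:
  assumes M: "centered_gaussian_space M H" and N: "centered_gaussian_space N H'"
    and Z: "\<And>a. a \<in> ({..T} \<times> UNIV) <+> ({..T} \<times> UNIV) \<Longrightarrow> vec_coords x y a \<in> H"
    and Z': "\<And>a. a \<in> ({..T} \<times> UNIV) <+> ({..T} \<times> UNIV) \<Longrightarrow> vec_coords x' y' a \<in> H'"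
    and eq: "\<And>a b. a \<in> ({..T} \<times> UNIV) <+> ({..T} \<times> UNIV) \<Longrightarrow> b \<in> ({..T} \<times> UNIV) <+> ({..T} \<times> UNIV) \<Longrightarrow>
      corr M (vec_coords x y a) (vec_coords x y b) = corr N (vec_coords x' y' a) (vec_coords x' y' b)"
  shows "joint_law M T x y = joint_law N T x' y'"
  using centered_gaussian_space.H_measurable[OF M Z] centered_gaussian_space.H_measurable[OF N Z']
  by (simp add: joint_law_eq_distr_coords gaussian_law_eq[OF M N _ Z Z' eq])

text \<open>Linear functionals of one random vector. One such space for each independent noise
  vector is a summand of the Gaussian space of the model.\<close>

definition coord_span :: "('a \<Rightarrow> real^'n) \<Rightarrow> ('a \<Rightarrow> real) set" where
  "coord_span X = {u. \<exists>c. u = (\<lambda>\<omega>. \<Sum>i\<in>UNIV. c i * X \<omega> $ i)}"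

lemma coord_span_zero: "(\<lambda>_. 0) \<in> coord_span X"
  unfolding coord_span_def by (intro CollectI exI[of _ "\<lambda>_. 0"]) simp

lemma coord_span_add:
  assumes "u \<in> coord_span X" "v \<in> coord_span X" shows "(\<lambda>\<omega>. u \<omega> + v \<omega>) \<in> coord_span X"
proof -
  obtain c d where "u = (\<lambda>\<omega>. \<Sum>i\<in>UNIV. c i * X \<omega> $ i)" "v = (\<lambda>\<omega>. \<Sum>i\<in>UNIV. d i * X \<omega> $ i)"
    using assms by (auto simp: coord_span_def)
  then show ?thesis unfolding coord_span_def
    by (intro CollectI exI[of _ "\<lambda>i. c i + d i"]) (simp add: sum.distrib distrib_right)
qed

lemma coord_span_scale:
  assumes "u \<in> coord_span X" shows "(\<lambda>\<omega>. d * u \<omega>) \<in> coord_span X"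
proof -
  obtain c where "u = (\<lambda>\<omega>. \<Sum>i\<in>UNIV. c i * X \<omega> $ i)" using assms by (auto simp: coord_span_def)
  then show ?thesis unfolding coord_span_def
    by (intro CollectI exI[of _ "\<lambda>i. d * c i"]) (simp add: sum_distrib_left mult.assoc)
qed

lemma coord_span_coord: "(\<lambda>\<omega>. X \<omega> $ i) \<in> coord_span X"
  unfolding coord_span_def
proof (intro CollectI exI[of _ "\<lambda>j. if j = i then 1 else 0"] ext)
  fix \<omega>
  have "(\<Sum>j\<in>UNIV. (if j = i then 1 else 0) * X \<omega> $ j) = (\<Sum>j\<in>UNIV. if j = i then X \<omega> $ i else 0)"
    by (intro sum.cong) auto
  then show "X \<omega> $ i = (\<Sum>j\<in>UNIV. (if j = i then 1 else 0) * X \<omega> $ j)" by simp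
qed

lemma coord_span_vsa:
  fixes X :: "'a \<Rightarrow> real^'d"
  assumes u: "u \<in> coord_span X" and B: "B \<in> sets borel"
  shows "u -` B \<inter> space M \<in> vsa M X"
proof -
  obtain c where c: "u = (\<lambda>\<omega>. \<Sum>i\<in>UNIV. c i * X \<omega> $ i)" using u by (auto simp: coord_span_def)
  have "(\<lambda>v :: real^'d. \<Sum>i\<in>UNIV. c i * v $ i) \<in> borel_measurable borel"
    using borel_measurable_vec_iff[of "\<lambda>v :: real^'d. v" borel]
    by (auto intro!: borel_measurable_sum borel_measurable_times)
  from measurable_sets[OF this B] have "(\<lambda>v :: real^'d. \<Sum>i\<in>UNIV. c i * v $ i) -` B \<in> sets borel"
    by simp
  then show ?thesis unfolding vsa_def
    by (intro sigma_sets.Basic CollectI exI[of _ "(\<lambda>v :: real^'d. \<Sum>i\<in>UNIV. c i * v $ i) -` B"]) (auto simp: c)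
qed

lemma coord_span_normal:
  assumes "gauss_vec M X 0 K" "u \<in> coord_span X" shows "\<exists>s. normal_rv M u 0 s"
  using assms unfolding gauss_vec_def gauss_family_def coord_span_def by auto

text \<open>The Gaussian space is the direct sum of the coordinate spans of the initial state and
  all noise vectors; unrolling the recursion puts states and outputs into it. The left factor in the
  last clause is the measurement noise at time \<open>k\<close>, which is uncorrelated with every
  state and with the measurement noises at other times.\<close>

lemma lgssm_gaussian:
  fixes x q :: "nat \<Rightarrow> 'a \<Rightarrow> real^'n" and y r :: "nat \<Rightarrow> 'a \<Rightarrow> real^'m"
  assumes model: "lgssm M T A C P0 Q R x y q r"
  shows "\<exists>H. centered_gaussian_space M H \<and> (\<forall>k\<le>T. \<forall>i. (\<lambda>\<omega>. x k \<omega> $ i) \<in> H) \<and> (\<forall>k\<le>T. \<forall>i. (\<lambda>\<omega>. y k \<omega> $ i) \<in> H) \<and>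
    (\<forall>k\<le>T. \<forall>l\<le>T. k \<noteq> l \<longrightarrow> (\<forall>j j'. corr M (\<lambda>\<omega>. y k \<omega> $ j - (\<Sum>i\<in>UNIV. C k $ j $ i * x k \<omega> $ i)) (\<lambda>\<omega>. y l \<omega> $ j') = 0))"
proof -
  interpret prob_space M using model by (simp add: lgssm_def)
  let ?I = "Inl ` {..T} \<union> Inr ` {..T} :: (nat + nat) set"
  \<comment> \<open>The initial state counts as process noise at time 0, matching the index
    \<open>Inl 0\<close> in \<open>lgssm\<close>.\<close>
  define e where "e k = (if k = 0 then x 0 else q k)" for k
  define G where "G = case_sum (\<lambda>k. vsa M (e k)) (\<lambda>k. vsa M (r k))"
  define L where "L = case_sum (\<lambda>k. coord_span (e k)) (\<lambda>k. coord_span (r k))"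
  have G: "indep_sets G ?I"
  proof -
    have "G = (\<lambda>i. case i of Inl k \<Rightarrow> (if k = 0 then vsa M (x 0) else vsa M (q k)) | Inr k \<Rightarrow> vsa M (r k))"
      by (auto simp: G_def e_def fun_eq_iff split: sum.split)
    then show ?thesis using model by (simp add: lgssm_def)
  qed
  have e: "\<exists>K. gauss_vec M (e k) 0 K" if "k \<le> T" for k
    using model that by (auto simp: lgssm_def e_def)
  have r: "\<exists>K. gauss_vec M (r k) 0 K" if "k \<le> T" for k
    using model that by (auto simp: lgssm_def)
  define H where "H = {X. \<exists>u. (\<forall>k\<in>?I. u k \<in> L k) \<and> (\<forall>\<omega>\<in>space M. X \<omega> = (\<Sum>k\<in>?I. u k \<omega>))}"
  have LG: "u -` B \<inter> space M \<in> G k" if "k \<in> ?I" "u \<in> L k" "B \<in> sets borel" for k u B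
    using that by (auto simp: L_def G_def intro: coord_span_vsa)
  have Lnormal: "\<exists>s. normal_rv M u 0 s" if "k \<in> ?I" "u \<in> L k" for k u
  proof (cases k)
    case (Inl l)
    then obtain K where "gauss_vec M (e l) 0 K" using e[of l] \<open>k \<in> ?I\<close> by auto
    then show ?thesis using \<open>u \<in> L k\<close> Inl by (intro coord_span_normal[of M "e l" K u]) (auto simp: L_def)
  next
    case (Inr l)
    then obtain K where "gauss_vec M (r l) 0 K" using r[of l] \<open>k \<in> ?I\<close> by auto
    then show ?thesis using \<open>u \<in> L k\<close> Inr by (intro coord_span_normal[of M "r l" K u]) (auto simp: L_def)
  qed
  have Lclosed: "(\<lambda>_. 0) \<in> L k" "u \<in> L k \<Longrightarrow> v \<in> L k \<Longrightarrow> (\<lambda>\<omega>. u \<omega> + v \<omega>) \<in> L k" "u \<in> L k \<Longrightarrow> (\<lambda>\<omega>. c * u \<omega>) \<in> L k" for k u v c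
    by (cases k; simp add: L_def coord_span_zero coord_span_add coord_span_scale)+
  have finI: "finite ?I" by simp
  have *: "centered_gaussian_space M H" "\<And>k u. k \<in> ?I \<Longrightarrow> u \<in> L k \<Longrightarrow> u \<in> H"
    "\<And>k l u v. k \<in> ?I \<Longrightarrow> l \<in> ?I \<Longrightarrow> k \<noteq> l \<Longrightarrow> u \<in> L k \<Longrightarrow> v \<in> L l \<Longrightarrow> corr M u v = 0"
    unfolding H_def
    by (rule centered_gaussian_space_direct_sum[OF finI G]; (erule (2) LG | erule (1) Lnormal | rule Lclosed | assumption)?; assumption?)+
  interpret centered_gaussian_space M H by (rule *(1))
  have H_cong: "X \<in> H" if "Y \<in> H" "\<And>\<omega>. \<omega> \<in> space M \<Longrightarrow> X \<omega> = Y \<omega>" for X Y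
    using that by (auto simp: H_def)
  have eL: "(\<lambda>\<omega>. e k \<omega> $ i) \<in> L (Inl k)" and rL: "(\<lambda>\<omega>. r k \<omega> $ j) \<in> L (Inr k)" for k i j
    unfolding L_def sum.case by (rule coord_span_coord)+
  have eH: "(\<lambda>\<omega>. e k \<omega> $ i) \<in> H" and rH: "(\<lambda>\<omega>. r k \<omega> $ j) \<in> H" if "k \<le> T" for k i j
    using that by - (rule *(2)[OF _ eL] *(2)[OF _ rL], simp)+
  have xS: "x (Suc k) \<omega> $ i = (\<Sum>j\<in>UNIV. A (Suc k) $ i $ j * x k \<omega> $ j) + e (Suc k) \<omega> $ i"
    if "Suc k \<le> T" "\<omega> \<in> space M" for k \<omega> i
  proof -
    have "x (Suc k) \<omega> = A (Suc k) *v x k \<omega> + q (Suc k) \<omega>"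
      using model that by (auto simp: lgssm_def dest!: bspec[where x="Suc k"])
    then show ?thesis by (simp add: e_def matrix_vector_mult_def)
  qed
  have yE: "y k \<omega> $ j = (\<Sum>i\<in>UNIV. C k $ j $ i * x k \<omega> $ i) + r k \<omega> $ j" if "k \<le> T" "\<omega> \<in> space M" for k \<omega> j
    using model that by (simp add: lgssm_def matrix_vector_mult_def)
  \<comment> \<open>Membership in \<open>H\<close> and orthogonality to all measurement noises go
    through one induction, because expanding the state recursion in the second claim uses the
    first.\<close>
  have x: "(\<lambda>\<omega>. x k \<omega> $ i) \<in> H \<and> (\<forall>m\<le>T. \<forall>j. corr M (\<lambda>\<omega>. x k \<omega> $ i) (\<lambda>\<omega>. r m \<omega> $ j) = 0)" if "k \<le> T" for k i
    using that
  proof (induction k arbitrary: i)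
    case 0
    have "x 0 = e 0" by (simp add: e_def)
    then show ?case using eH[OF le0] *(3)[OF _ _ _ eL[of 0 i] rL] by auto
  next
    case (Suc k)
    let ?s = "\<lambda>\<omega>. \<Sum>j\<in>UNIV. A (Suc k) $ i $ j * x k \<omega> $ j"
    have sH: "?s \<in> H" using Suc by (intro H_lincomb) auto
    have H1: "(\<lambda>\<omega>. ?s \<omega> + e (Suc k) \<omega> $ i) \<in> H" by (rule H_add[OF sH eH[OF Suc.prems]])
    have "(\<lambda>\<omega>. x (Suc k) \<omega> $ i) \<in> H" by (rule H_cong[OF H1]) (simp add: xS Suc.prems)
    moreover have "corr M (\<lambda>\<omega>. x (Suc k) \<omega> $ i) (\<lambda>\<omega>. r m \<omega> $ j) = 0" if "m \<le> T" for m j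
    proof -
      have "corr M (\<lambda>\<omega>. x (Suc k) \<omega> $ i) (\<lambda>\<omega>. r m \<omega> $ j) = corr M (\<lambda>\<omega>. ?s \<omega> + e (Suc k) \<omega> $ i) (\<lambda>\<omega>. r m \<omega> $ j)"
        unfolding corr_def by (intro Bochner_Integration.integral_cong) (auto simp: xS Suc.prems)
      also have "\<dots> = corr M ?s (\<lambda>\<omega>. r m \<omega> $ j) + corr M (\<lambda>\<omega>. e (Suc k) \<omega> $ i) (\<lambda>\<omega>. r m \<omega> $ j)"
        by (rule ip_add[OF sH eH[OF Suc.prems] rH[OF that]])
      also have "corr M ?s (\<lambda>\<omega>. r m \<omega> $ j) = (\<Sum>l\<in>UNIV. A (Suc k) $ i $ l * corr M (\<lambda>\<omega>. x k \<omega> $ l) (\<lambda>\<omega>. r m \<omega> $ j))"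
        by (rule ip_lincomb[OF _ rH[OF that]]) (use Suc in auto)
      also have "\<dots> = 0" using Suc that by simp
      also have "corr M (\<lambda>\<omega>. e (Suc k) \<omega> $ i) (\<lambda>\<omega>. r m \<omega> $ j) = 0"
        by (rule *(3)[OF _ _ _ eL rL]) (use Suc.prems that in auto)
      finally show ?thesis by simp
    qed
    ultimately show ?case by blast
  qed
  have y: "(\<lambda>\<omega>. y k \<omega> $ j) \<in> H" if "k \<le> T" for k j
  proof (rule H_cong)
    show "(\<lambda>\<omega>. (\<Sum>i\<in>UNIV. C k $ j $ i * x k \<omega> $ i) + r k \<omega> $ j) \<in> H"
      by (intro H_add H_lincomb rH) (use x that in auto)
  qed (simp add: yE that)
  have "corr M (\<lambda>\<omega>. y k \<omega> $ j - (\<Sum>i\<in>UNIV. C k $ j $ i * x k \<omega> $ i)) (\<lambda>\<omega>. y l \<omega> $ j') = 0"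
    if "k \<le> T" "l \<le> T" "k \<noteq> l" for k l j j'
  proof -
    let ?s = "\<lambda>\<omega>. \<Sum>i\<in>UNIV. C l $ j' $ i * x l \<omega> $ i"
    have sH: "?s \<in> H" by (intro H_lincomb) (use x that in auto)
    have "corr M (\<lambda>\<omega>. y k \<omega> $ j - (\<Sum>i\<in>UNIV. C k $ j $ i * x k \<omega> $ i)) (\<lambda>\<omega>. y l \<omega> $ j')
        = corr M (\<lambda>\<omega>. ?s \<omega> + r l \<omega> $ j') (\<lambda>\<omega>. r k \<omega> $ j)"
      unfolding corr_def by (intro Bochner_Integration.integral_cong) (auto simp: yE that mult.commute)
    also have "\<dots> = corr M ?s (\<lambda>\<omega>. r k \<omega> $ j) + corr M (\<lambda>\<omega>. r l \<omega> $ j') (\<lambda>\<omega>. r k \<omega> $ j)"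
      by (rule ip_add[OF sH rH rH]) (use that in auto)
    also have "corr M ?s (\<lambda>\<omega>. r k \<omega> $ j) = (\<Sum>i\<in>UNIV. C l $ j' $ i * corr M (\<lambda>\<omega>. x l \<omega> $ i) (\<lambda>\<omega>. r k \<omega> $ j))"
      by (rule ip_lincomb) (use x rH that in auto)
    also have "\<dots> = 0" using x that by simp
    also have "corr M (\<lambda>\<omega>. r l \<omega> $ j') (\<lambda>\<omega>. r k \<omega> $ j) = 0"
      by (rule *(3)[OF _ _ _ rL rL]) (use that in auto)
    finally show ?thesis by simp
  qed
  then show ?thesis using *(1) x y by (intro exI[of _ H]) blast
qed

section \<open>Innovations\<close>

text \<open>Induction on the largest index of the finite subfamily: its event splits off from the
  intersection of the earlier ones. This turns independence from the past into mutual independence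
  of a white sequence.\<close>

lemma (in prob_space) indep_sets_sequential:
  assumes "\<And>k. k \<le> T \<Longrightarrow> indep_set (G k) (sigma_sets (space M) (\<Union>l<k. G l))"
  shows "indep_sets G {..T :: nat}"
proof (rule indep_setsI)
  show "G k \<subseteq> events" if "k \<in> {..T}" for k
    using assms[of k] that by (auto simp: indep_sets2_eq)
next
  fix A and S :: "nat set" assume S: "S \<noteq> {}" "S \<subseteq> {..T}" "finite S" and A: "\<forall>j\<in>S. A j \<in> G j"
  from \<open>finite S\<close> S(2) A have "S \<noteq> {} \<longrightarrow> prob (\<Inter>j\<in>S. A j) = (\<Prod>j\<in>S. prob (A j))"
  proof (induction S rule: finite_linorder_max_induct)
    case (insert b S)
    show ?case
    proof (cases "S = {}")
      case False
      let ?G = "\<Union>l<b. G l"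
      have "G l \<subseteq> events" if "l < b" for l
        using assms[of l] insert.prems(1) that by (auto simp: indep_sets2_eq)
      then have ev: "?G \<subseteq> events" by blast
      then have Pow: "?G \<subseteq> Pow (space M)" using sets.space_closed by blast
      have "A j \<in> sets (sigma (space M) ?G)" if "j \<in> S" for j
        using insert.hyps insert.prems that by (auto simp: sets_measure_of[OF Pow] intro!: sigma_sets.Basic)
      then have "(\<Inter>j\<in>S. A j) \<in> sets (sigma (space M) ?G)"
        using insert.hyps False by (intro sets.finite_INT) auto
      then have "prob (A b \<inter> (\<Inter>j\<in>S. A j)) = prob (A b) * prob (\<Inter>j\<in>S. A j)"
        using insert.prems by (intro indep_setD[OF assms]) (simp_all add: sets_measure_of[OF Pow])
      then show ?thesis using insert.IH insert.prems insert.hyps False by auto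
    qed simp
  qed simp
  then show "prob (\<Inter>j\<in>S. A j) = (\<Prod>j\<in>S. prob (A j))" using S by blast
qed

definition coords :: "('i \<Rightarrow> 'a \<Rightarrow> real^'n) \<Rightarrow> 'i \<times> 'n \<Rightarrow> 'a \<Rightarrow> real" where
  "coords X p \<omega> = X (fst p) \<omega> $ snd p"

lemma coords_split: "(\<lambda>(k, i) \<omega>. X k \<omega> $ i) = coords X"
  by (auto simp: coords_def fun_eq_iff)

lemma sigma_gen_sa_coords:
  "sigma_sets (space M) (gen_sa M S X) = sigma_sets (space M) (gen_sa M (S \<times> UNIV) (coords X))"
  using sigma_gen_sa_vec[of M S X] unfolding coords_split .

lemma sigma_gen_sa_coords':
  "sigma (space M) (gen_sa M S X) = sigma (space M) (gen_sa M (S \<times> UNIV) (coords X))"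
  by (rule sigma_eqI[OF gen_sa_Pow gen_sa_Pow sigma_gen_sa_coords])

context centered_gaussian_space
begin

text \<open>Chosen and not computed, since with a singular Gram matrix the coefficients are not
  unique. The projection itself is unique almost surely.\<close>

definition proj_coeff :: "'i set \<Rightarrow> ('i \<Rightarrow> 'a \<Rightarrow> real) \<Rightarrow> ('a \<Rightarrow> real) \<Rightarrow> 'i \<Rightarrow> real" where
  "proj_coeff S X U = (SOME c. \<forall>i\<in>S. ip (\<lambda>\<omega>. U \<omega> - (\<Sum>j\<in>S. c j * X j \<omega>)) (X i) = 0)"

lemma proj_coeff:
  assumes "finite S" "\<And>i. i \<in> S \<Longrightarrow> X i \<in> H" "U \<in> H" "i \<in> S"
  shows "ip (\<lambda>\<omega>. U \<omega> - (\<Sum>j\<in>S. proj_coeff S X U j * X j \<omega>)) (X i) = 0"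
  using someI_ex[OF projection_exists[of S X U, OF assms(1-3)]] assms(4) unfolding proj_coeff_def by simp

lemma ip_lincomb_zero:
  assumes "\<And>i. i \<in> S \<Longrightarrow> X i \<in> H" "Z \<in> H" "\<And>i. i \<in> S \<Longrightarrow> ip Z (X i) = 0"
  shows "ip Z (\<lambda>\<omega>. \<Sum>i\<in>S. c i * X i \<omega>) = 0"
  unfolding ip_sym[of Z] using assms ip_sym[of Z] by (subst ip_lincomb) (auto intro!: sum.neutral)

lemma ip_diff_zero:
  assumes "X \<in> H" "Y \<in> H" "Z \<in> H" "ip Z X = 0" "ip Z Y = 0"
  shows "ip Z (\<lambda>\<omega>. X \<omega> - Y \<omega>) = 0"
  unfolding ip_sym[of Z] using assms ip_sym[of Z] by (subst ip_diff) auto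

lemma ip_diff_iff:
  assumes "X \<in> H" "Y \<in> H" "Z \<in> H" "ip Z (\<lambda>\<omega>. X \<omega> - Y \<omega>) = 0" "ip Z Y = 0"
  shows "ip Z X = 0"
  using assms(4,5) unfolding ip_sym[of Z] using assms(1-3) by (subst (asm) ip_diff) auto

text \<open>\<open>X'\<close> is a version of the vector \<open>X\<close> whose coordinates lie in
  \<open>H\<close>. The distinction is used for the innovation, which is defined by conditional
  expectations and agrees with its linear form only almost everywhere.\<close>

lemma vcond_exp_eq_projection:
  fixes Y :: "'i \<Rightarrow> 'a \<Rightarrow> real^'d" and X X' :: "'a \<Rightarrow> real^'e"
  assumes fin: "finite S" and YH: "\<And>k i. k \<in> S \<Longrightarrow> (\<lambda>\<omega>. Y k \<omega> $ i) \<in> H" and XH: "\<And>i. (\<lambda>\<omega>. X \<omega> $ i) \<in> H"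
    and X': "X' \<in> borel_measurable M" "AE \<omega> in M. X' \<omega> = X \<omega>"
  shows "AE \<omega> in M. vcond_exp M (sigma (space M) (gen_sa M S Y)) X' \<omega> =
    (\<chi> i. \<Sum>p\<in>S \<times> UNIV. proj_coeff (S \<times> UNIV) (coords Y) (\<lambda>\<omega>. X \<omega> $ i) p * coords Y p \<omega>)"
proof -
  let ?F = "sigma (space M) (gen_sa M S Y)"
  have Ym: "Y k \<in> borel_measurable M" if "k \<in> S" for k
    using YH[OF that] by (auto simp: borel_measurable_vec_iff intro: H_measurable)
  interpret F: sigma_finite_subalgebra M ?F
    by (rule sigma_finite_subalgebraI[OF subalgebra_gen_sa]) (rule Ym)
  have cH: "coords Y p \<in> H" if "p \<in> S \<times> UNIV" for p
    using YH[of "fst p" "snd p"] that unfolding coords_def[abs_def] by auto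
  have "AE \<omega> in M. real_cond_exp M ?F (\<lambda>\<omega>. X' \<omega> $ i) \<omega> =
    (\<Sum>p\<in>S \<times> UNIV. proj_coeff (S \<times> UNIV) (coords Y) (\<lambda>\<omega>. X \<omega> $ i) p * coords Y p \<omega>)" for i
  proof -
    have "AE \<omega> in M. real_cond_exp M ?F (\<lambda>\<omega>. X' \<omega> $ i) \<omega> = real_cond_exp M ?F (\<lambda>\<omega>. X \<omega> $ i) \<omega>"
    proof (rule F.real_cond_exp_cong)
      show "AE \<omega> in M. X' \<omega> $ i = X \<omega> $ i" using X'(2) by (auto elim: eventually_mono)
      show "(\<lambda>\<omega>. X' \<omega> $ i) \<in> borel_measurable M" using X'(1) by (simp add: borel_measurable_vec_iff)
    qed (rule H_measurable[OF XH])
    moreover have "AE \<omega> in M. real_cond_exp M ?F (\<lambda>\<omega>. X \<omega> $ i) \<omega> =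
      (\<Sum>p\<in>S \<times> UNIV. proj_coeff (S \<times> UNIV) (coords Y) (\<lambda>\<omega>. X \<omega> $ i) p * coords Y p \<omega>)"
      unfolding sigma_gen_sa_coords'
      by (rule cond_exp_eq_projection) (use fin cH XH in \<open>auto intro!: proj_coeff\<close>)
    ultimately show ?thesis by eventually_elim simp
  qed
  then have "AE \<omega> in M. \<forall>i\<in>UNIV. real_cond_exp M ?F (\<lambda>\<omega>. X' \<omega> $ i) \<omega> =
    (\<Sum>p\<in>S \<times> UNIV. proj_coeff (S \<times> UNIV) (coords Y) (\<lambda>\<omega>. X \<omega> $ i) p * coords Y p \<omega>)"
    by (intro AE_finite_allI) auto
  then show ?thesis by eventually_elim (simp add: vcond_exp_def vec_eq_iff)
qed

end

text \<open>The model and the conditions on the input are stated as orthogonality relations, the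
  form that equality of covariances transports. \<open>causal\<close> is condition (ii) in this
  form: the error of predicting a later output from the outputs up to \<open>k\<close> is orthogonal
  to \<open>J k\<close>.\<close>

locale innovation_setup = centered_gaussian_space M H for M :: "'a measure" and H +
  fixes T :: nat and C :: "nat \<Rightarrow> real^'n::finite^'m::finite"
    and x J :: "nat \<Rightarrow> 'a \<Rightarrow> real^'n" and y :: "nat \<Rightarrow> 'a \<Rightarrow> real^'m"
  assumes xH: "k \<le> T \<Longrightarrow> (\<lambda>\<omega>. x k \<omega> $ i) \<in> H"
    and yH: "k \<le> T \<Longrightarrow> (\<lambda>\<omega>. y k \<omega> $ j) \<in> H"
    and JH: "k \<le> T \<Longrightarrow> (\<lambda>\<omega>. J k \<omega> $ i) \<in> H"
    and noise: "k \<le> T \<Longrightarrow> l < k \<Longrightarrow>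
      ip (\<lambda>\<omega>. y k \<omega> $ j - (\<Sum>i\<in>UNIV. C k $ j $ i * x k \<omega> $ i)) (\<lambda>\<omega>. y l \<omega> $ j') = 0"
    and causal: "m \<le> T \<Longrightarrow> k < m \<Longrightarrow> \<exists>d.
      (\<forall>p\<in>{..k} \<times> UNIV. ip (\<lambda>\<omega>. y m \<omega> $ j - (\<Sum>p\<in>{..k} \<times> UNIV. d p * coords y p \<omega>)) (coords y p) = 0) \<and>
      (\<forall>i. ip (\<lambda>\<omega>. y m \<omega> $ j - (\<Sum>p\<in>{..k} \<times> UNIV. d p * coords y p \<omega>)) (\<lambda>\<omega>. J k \<omega> $ i) = 0)"
    and white: "k \<le> T \<Longrightarrow> l \<le> T \<Longrightarrow> k \<noteq> l \<Longrightarrow> ip (\<lambda>\<omega>. J k \<omega> $ i) (\<lambda>\<omega>. J l \<omega> $ i') = 0"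
begin

text \<open>Like \<open>iota\<close> and \<open>ups\<close> below, a linear form that is a finite
  combination of the given variables at every sample point and so lies in \<open>H\<close>. The
  conditional expectations in \<open>innov\<close> and \<open>upsilon\<close> agree with these forms
  almost everywhere.\<close>

definition xpred :: "nat \<Rightarrow> 'n \<Rightarrow> 'a \<Rightarrow> real" where
  "xpred k i \<omega> = (\<Sum>p\<in>{..<k} \<times> UNIV. proj_coeff ({..<k} \<times> UNIV) (coords y) (\<lambda>\<omega>. x k \<omega> $ i) p * coords y p \<omega>)"

text \<open>At \<open>k = 0\<close> the predictor is an empty sum, so \<open>iota 0\<close> is
  \<open>y 0\<close>, as in the separate first case of \<open>innov\<close>.\<close>

definition iota :: "nat \<Rightarrow> 'a \<Rightarrow> real^'m" where
  "iota k \<omega> = (\<chi> j. y k \<omega> $ j - (\<Sum>i\<in>UNIV. C k $ j $ i * xpred k i \<omega>))"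

definition ups :: "nat \<Rightarrow> nat \<Rightarrow> 'a \<Rightarrow> real^'m" where
  "ups k j \<omega> = (\<chi> a. iota j \<omega> $ a -
     (\<Sum>p\<in>{..<k} \<times> UNIV. proj_coeff ({..<k} \<times> UNIV) (coords J) (\<lambda>\<omega>. iota j \<omega> $ a) p * coords J p \<omega>))"

text \<open>Past innovations enter only after removal of their projection on past inputs. All
  regressors are then orthogonal to past inputs, the current innovation by causality, and so is
  \<open>J k\<close> by whiteness; the residual inherits this.\<close>

definition regr :: "nat \<Rightarrow> 'm + nat \<times> 'm \<Rightarrow> 'a \<Rightarrow> real" where
  "regr k = case_sum (\<lambda>a \<omega>. iota k \<omega> $ a) (\<lambda>(j, a) \<omega>. ups k j \<omega> $ a)"

definition regr_index :: "nat \<Rightarrow> ('m + nat \<times> 'm) set" where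
  "regr_index k = UNIV <+> ({..<k} \<times> UNIV)"

definition gain :: "nat \<Rightarrow> 'n \<Rightarrow> 'm + nat \<times> 'm \<Rightarrow> real" where
  "gain k i = proj_coeff (regr_index k) (regr k) (\<lambda>\<omega>. J k \<omega> $ i)"

text \<open>The white sequence \<open>w\<close> of the theorem.\<close>

definition resid :: "nat \<Rightarrow> 'a \<Rightarrow> real^'n" where
  "resid k \<omega> = (\<chi> i. J k \<omega> $ i - (\<Sum>v\<in>regr_index k. gain k i v * regr k v \<omega>))"

lemma finite_regr_index: "finite (regr_index k)"
  by (simp add: regr_index_def)

lemma coords_yH: "fst p \<le> T \<Longrightarrow> coords y p \<in> H"
  using yH[of "fst p" "snd p"] unfolding coords_def[abs_def] .

lemma coords_JH: "fst p \<le> T \<Longrightarrow> coords J p \<in> H"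
  using JH[of "fst p" "snd p"] unfolding coords_def[abs_def] .

lemma xpredH: "k \<le> T \<Longrightarrow> xpred k i \<in> H"
  unfolding xpred_def[abs_def] by (intro H_lincomb coords_yH) auto

lemma iotaH: "k \<le> T \<Longrightarrow> (\<lambda>\<omega>. iota k \<omega> $ j) \<in> H"
  unfolding iota_def vec_lambda_beta by (intro H_resid yH xpredH)

lemma upsH: "k \<le> T \<Longrightarrow> j \<le> T \<Longrightarrow> (\<lambda>\<omega>. ups k j \<omega> $ a) \<in> H"
  unfolding ups_def vec_lambda_beta by (intro H_resid iotaH coords_JH) auto

lemma regrH: "k \<le> T \<Longrightarrow> v \<in> regr_index k \<Longrightarrow> regr k v \<in> H"
  by (auto simp: regr_def regr_index_def intro!: iotaH upsH)

lemma residH: "k \<le> T \<Longrightarrow> (\<lambda>\<omega>. resid k \<omega> $ i) \<in> H"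
  unfolding resid_def vec_lambda_beta by (intro H_resid JH regrH)

section \<open>Orthogonality between outputs, innovations, inputs and residuals\<close>

lemma orth_xpred:
  assumes "k \<le> T" "Z \<in> H" "\<And>l j. l < k \<Longrightarrow> ip Z (\<lambda>\<omega>. y l \<omega> $ j) = 0"
  shows "ip Z (xpred k i) = 0"
  unfolding xpred_def[abs_def]
  by (rule ip_lincomb_zero) (use assms in \<open>auto intro!: yH simp: coords_def[abs_def]\<close>)

lemma orth_iota:
  assumes "k \<le> T" "Z \<in> H" "\<And>l j. l \<le> k \<Longrightarrow> ip Z (\<lambda>\<omega>. y l \<omega> $ j) = 0"
  shows "ip Z (\<lambda>\<omega>. iota k \<omega> $ j) = 0"
  unfolding iota_def vec_lambda_beta
  by (intro ip_diff_zero ip_lincomb_zero orth_xpred H_lincomb yH xpredH) (use assms in auto)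

text \<open>Outputs and innovations determine each other triangularly: the predictor at time
  \<open>k\<close> uses earlier outputs only, and these are covered by strong induction.\<close>

lemma orth_y_of_iota:
  assumes "Z \<in> H" "\<And>l j. l \<le> k \<Longrightarrow> ip Z (\<lambda>\<omega>. iota l \<omega> $ j) = 0" "k \<le> T"
  shows "ip Z (\<lambda>\<omega>. y k \<omega> $ j) = 0"
  using assms(2,3)
proof (induction k arbitrary: j rule: less_induct)
  case (less k)
  have "ip Z (xpred k i) = 0" for i
    by (rule orth_xpred[OF less.prems(2) assms(1)]) (use less in auto)
  then have "ip Z (\<lambda>\<omega>. \<Sum>i\<in>UNIV. C k $ j $ i * xpred k i \<omega>) = 0"
    by (intro ip_lincomb_zero assms(1) xpredH less.prems(2))
  moreover have "ip Z (\<lambda>\<omega>. y k \<omega> $ j - (\<Sum>i\<in>UNIV. C k $ j $ i * xpred k i \<omega>)) = 0"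
    using less.prems(1)[of k j] by (simp add: iota_def)
  ultimately show ?case
    by (intro ip_diff_iff[OF yH[OF less.prems(2)] H_lincomb[OF xpredH[OF less.prems(2)]] assms(1)])
qed

text \<open>The innovation is the measurement noise plus \<open>C k\<close> applied to the
  prediction error of the state. The former is orthogonal to past outputs by \<open>noise\<close>,
  the latter as a projection residual.\<close>

lemma iota_orth_y:
  assumes "k \<le> T" "l < k"
  shows "ip (\<lambda>\<omega>. iota k \<omega> $ j) (\<lambda>\<omega>. y l \<omega> $ j') = 0"
proof -
  let ?v = "\<lambda>\<omega>. y k \<omega> $ j - (\<Sum>i\<in>UNIV. C k $ j $ i * x k \<omega> $ i)"
  let ?e = "\<lambda>i \<omega>. x k \<omega> $ i - xpred k i \<omega>"
  have e: "ip (?e i) (\<lambda>\<omega>. y l \<omega> $ j') = 0" for i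
    using proj_coeff[of "{..<k} \<times> UNIV" "coords y" "\<lambda>\<omega>. x k \<omega> $ i" "(l, j')"] assms coords_yH xH
    by (simp add: xpred_def coords_def[of y "(l, j')", abs_def] mem_Times_iff)
  have eH: "?e i \<in> H" for i by (intro H_diff xH xpredH assms(1))
  have E: "(\<lambda>\<omega>. iota k \<omega> $ j) = (\<lambda>\<omega>. ?v \<omega> + (\<Sum>i\<in>UNIV. C k $ j $ i * ?e i \<omega>))"
    by (simp add: iota_def fun_eq_iff right_diff_distrib sum_subtractf)
  have "ip (\<lambda>\<omega>. iota k \<omega> $ j) (\<lambda>\<omega>. y l \<omega> $ j') = ip ?v (\<lambda>\<omega>. y l \<omega> $ j') + ip (\<lambda>\<omega>. \<Sum>i\<in>UNIV. C k $ j $ i * ?e i \<omega>) (\<lambda>\<omega>. y l \<omega> $ j')"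
    unfolding E by (rule ip_add[OF H_resid H_lincomb]) (use assms in \<open>auto intro: yH xH eH\<close>)
  also have "ip (\<lambda>\<omega>. \<Sum>i\<in>UNIV. C k $ j $ i * ?e i \<omega>) (\<lambda>\<omega>. y l \<omega> $ j') = (\<Sum>i\<in>UNIV. C k $ j $ i * ip (?e i) (\<lambda>\<omega>. y l \<omega> $ j'))"
    by (rule ip_lincomb[OF eH yH]) (use assms in auto)
  finally show ?thesis using noise[OF assms] e by simp
qed

lemma iota_orth_iota:
  assumes "k \<le> T" "l < k"
  shows "ip (\<lambda>\<omega>. iota k \<omega> $ j) (\<lambda>\<omega>. iota l \<omega> $ j') = 0"
  by (rule orth_iota[OF _ iotaH]) (use assms in \<open>auto intro: iota_orth_y\<close>)

text \<open>By causality, the part of \<open>J l\<close> not explained by the outputs up to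
  \<open>l\<close> is orthogonal to all outputs, later ones included, and so to every innovation.
  The explained part is a combination of outputs up to \<open>l\<close>, to which a later innovation
  is orthogonal.\<close>

lemma J_orth_iota:
  assumes "k \<le> T" "l < k"
  shows "ip (\<lambda>\<omega>. J l \<omega> $ i) (\<lambda>\<omega>. iota k \<omega> $ j) = 0"
proof -
  let ?S = "{..l} \<times> (UNIV :: 'm set)"
  let ?c = "proj_coeff ?S (coords y) (\<lambda>\<omega>. J l \<omega> $ i)"
  define n where "n \<omega> = J l \<omega> $ i - (\<Sum>p\<in>?S. ?c p * coords y p \<omega>)" for \<omega>
  have lT: "l \<le> T" using assms by simp
  have yS: "coords y p \<in> H" if "p \<in> ?S" for p using that lT by (intro coords_yH) auto
  have nH: "n \<in> H" unfolding n_def[abs_def] by (intro H_resid JH yS lT)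
  have nS: "ip n (coords y p) = 0" if "p \<in> ?S" for p
    unfolding n_def[abs_def] by (rule proj_coeff) (use that yS JH[OF lT] in auto)
  have ny: "ip n (\<lambda>\<omega>. y m \<omega> $ j) = 0" if m: "m \<le> T" for m j
  proof (cases "m \<le> l")
    case True
    then show ?thesis using nS[of "(m, j)"] by (simp add: coords_def[abs_def])
  next
    case False
    \<comment> \<open>The prediction error of the later output \<open>y m\<close> is orthogonal to
      \<open>J l\<close> and to the outputs up to \<open>l\<close>, hence to \<open>n\<close>. The
      predicted part is a combination of outputs that are orthogonal to \<open>n\<close>
      already.\<close>
    then obtain d where d: "\<forall>p\<in>?S. ip (\<lambda>\<omega>. y m \<omega> $ j - (\<Sum>p\<in>?S. d p * coords y p \<omega>)) (coords y p) = 0"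
      "ip (\<lambda>\<omega>. y m \<omega> $ j - (\<Sum>p\<in>?S. d p * coords y p \<omega>)) (\<lambda>\<omega>. J l \<omega> $ i) = 0"
      using causal[OF m, of l j] by auto
    define e where "e \<omega> = y m \<omega> $ j - (\<Sum>p\<in>?S. d p * coords y p \<omega>)" for \<omega>
    have eH: "e \<in> H" unfolding e_def[abs_def] by (intro H_resid yH yS m)
    have "ip e n = 0" unfolding n_def[abs_def]
      by (intro ip_diff_zero ip_lincomb_zero JH yS H_lincomb eH lT) (use d in \<open>auto simp: e_def[abs_def]\<close>)
    then have "ip n (\<lambda>\<omega>. y m \<omega> $ j - (\<Sum>p\<in>?S. d p * coords y p \<omega>)) = 0"
      unfolding ip_sym[of n] e_def[abs_def] .
    moreover have "ip n (\<lambda>\<omega>. \<Sum>p\<in>?S. d p * coords y p \<omega>) = 0"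
      by (intro ip_lincomb_zero yS nS nH)
    ultimately show ?thesis by (intro ip_diff_iff[OF yH[OF m] H_lincomb[OF yS] nH])
  qed
  have "ip (\<lambda>\<omega>. iota k \<omega> $ j) n = 0"
    unfolding ip_sym[of _ n] by (rule orth_iota[OF assms(1) nH ny]) (use assms in auto)
  then have 1: "ip (\<lambda>\<omega>. iota k \<omega> $ j) (\<lambda>\<omega>. J l \<omega> $ i - (\<Sum>p\<in>?S. ?c p * coords y p \<omega>)) = 0"
    unfolding n_def[abs_def] .
  have "ip (\<lambda>\<omega>. iota k \<omega> $ j) (\<lambda>\<omega>. \<Sum>p\<in>?S. ?c p * coords y p \<omega>) = 0"
    by (intro ip_lincomb_zero yS iotaH assms(1)) (use assms in \<open>auto simp: coords_def[abs_def] intro: iota_orth_y\<close>)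
  from ip_diff_iff[OF JH[OF lT] H_lincomb[OF yS] iotaH[OF assms(1)] 1 this] show ?thesis
    unfolding ip_sym[of "\<lambda>\<omega>. iota k \<omega> $ j"] .
qed

lemma iota_orth_J:
  assumes "k \<le> T" "l < k"
  shows "ip (\<lambda>\<omega>. iota k \<omega> $ j) (\<lambda>\<omega>. J l \<omega> $ i) = 0"
  using J_orth_iota[OF assms] by (simp only: ip_sym)

lemma ups_orth_J:
  assumes "k \<le> T" "j \<le> T" "l < k"
  shows "ip (\<lambda>\<omega>. ups k j \<omega> $ a) (\<lambda>\<omega>. J l \<omega> $ i) = 0"
  using proj_coeff[of "{..<k} \<times> UNIV" "coords J" "\<lambda>\<omega>. iota j \<omega> $ a" "(l, i)"] assms coords_JH iotaH
  by (simp add: ups_def coords_def[of J "(l, i)", abs_def] mem_Times_iff)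

lemma resid_orth_regr:
  assumes "k \<le> T" "v \<in> regr_index k"
  shows "ip (\<lambda>\<omega>. resid k \<omega> $ i) (regr k v) = 0"
  unfolding resid_def vec_lambda_beta gain_def
  by (rule proj_coeff[OF finite_regr_index regrH JH]) (use assms in auto)

text \<open>\<open>J k\<close> is orthogonal to past inputs by whiteness, the innovation by
  causality and the \<open>ups\<close> blocks by construction. No regression on past inputs is
  involved.\<close>

lemma resid_orth_J:
  assumes "k \<le> T" "l < k"
  shows "ip (\<lambda>\<omega>. resid k \<omega> $ i) (\<lambda>\<omega>. J l \<omega> $ i') = 0"
proof -
  have "ip (\<lambda>\<omega>. J l \<omega> $ i') (regr k v) = 0" if "v \<in> regr_index k" for v
    unfolding ip_sym[of "\<lambda>\<omega>. J l \<omega> $ i'" "regr k v"] using that assms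
    by (auto simp: regr_index_def regr_def iota_orth_J ups_orth_J)
  then have "ip (\<lambda>\<omega>. J l \<omega> $ i') (\<lambda>\<omega>. resid k \<omega> $ i) = 0"
    unfolding resid_def vec_lambda_beta
    by (intro ip_diff_zero ip_lincomb_zero JH regrH H_lincomb white) (use assms in auto)
  then show ?thesis by (simp only: ip_sym)
qed

text \<open>The innovation at time \<open>k\<close> is itself a regressor. An earlier one differs
  from a regressor by a combination of past inputs, to which the residual is orthogonal. A later one
  is orthogonal to everything that \<open>resid k\<close> is built from.\<close>

lemma resid_orth_iota:
  assumes k: "k \<le> T" and m: "m \<le> T"
  shows "ip (\<lambda>\<omega>. resid k \<omega> $ i) (\<lambda>\<omega>. iota m \<omega> $ j) = 0"
proof (cases m k rule: linorder_cases)
  case equal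
  then show ?thesis using resid_orth_regr[OF k, of "Inl j" i] by (auto simp: regr_def regr_index_def)
next
  case less
  have "ip (\<lambda>\<omega>. resid k \<omega> $ i) (\<lambda>\<omega>. ups k m \<omega> $ j) = 0"
    using resid_orth_regr[OF k, of "Inr (m, j)" i] less by (auto simp: regr_def regr_index_def)
  then have 1: "ip (\<lambda>\<omega>. resid k \<omega> $ i) (\<lambda>\<omega>. iota m \<omega> $ j -
     (\<Sum>p\<in>{..<k} \<times> UNIV. proj_coeff ({..<k} \<times> UNIV) (coords J) (\<lambda>\<omega>. iota m \<omega> $ j) p * coords J p \<omega>)) = 0"
    by (simp add: ups_def)
  show ?thesis
  proof (rule ip_diff_iff[OF iotaH[OF m] H_lincomb residH[OF k] 1])
    show "coords J p \<in> H" if "p \<in> {..<k} \<times> UNIV" for p using that k by (intro coords_JH) auto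
    show "ip (\<lambda>\<omega>. resid k \<omega> $ i) (\<lambda>\<omega>. \<Sum>p\<in>{..<k} \<times> UNIV. proj_coeff ({..<k} \<times> UNIV) (coords J) (\<lambda>\<omega>. iota m \<omega> $ j) p * coords J p \<omega>) = 0"
      by (intro ip_lincomb_zero residH k coords_JH) (use k in \<open>auto simp: coords_def[abs_def] resid_orth_J\<close>)
  qed
next
  case greater
  have ii: "ip (\<lambda>\<omega>. iota m \<omega> $ j) (\<lambda>\<omega>. iota l \<omega> $ a) = 0" if "l \<le> k" for l a
    using that greater by (intro iota_orth_iota m) auto
  have iJ: "ip (\<lambda>\<omega>. iota m \<omega> $ j) (\<lambda>\<omega>. J l \<omega> $ a) = 0" if "l \<le> k" for l a
    using that greater by (intro iota_orth_J m) auto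
  have "ip (\<lambda>\<omega>. iota m \<omega> $ j) (\<lambda>\<omega>. ups k l \<omega> $ a) = 0" if "l < k" for l a
    unfolding ups_def vec_lambda_beta
    by (intro ip_diff_zero ip_lincomb_zero iotaH H_lincomb coords_JH ii)
      (use k m that in \<open>auto simp: coords_def[abs_def] iJ\<close>)
  then have "ip (\<lambda>\<omega>. iota m \<omega> $ j) (regr k v) = 0" if "v \<in> regr_index k" for v
    using that by (auto simp: regr_def regr_index_def ii)
  then have "ip (\<lambda>\<omega>. iota m \<omega> $ j) (\<lambda>\<omega>. resid k \<omega> $ i) = 0"
    unfolding resid_def vec_lambda_beta
    by (intro ip_diff_zero ip_lincomb_zero iotaH JH regrH H_lincomb iJ) (use k m in auto)
  then show ?thesis by (simp only: ip_sym)
qed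

lemma resid_orth_y:
  assumes "k \<le> T" "m \<le> T"
  shows "ip (\<lambda>\<omega>. resid k \<omega> $ i) (\<lambda>\<omega>. y m \<omega> $ j) = 0"
  by (rule orth_y_of_iota[OF residH]) (use assms in \<open>auto intro: resid_orth_iota\<close>)

text \<open>\<open>resid l\<close> is a combination of innovations and inputs up to time
  \<open>l\<close>, and \<open>resid k\<close> is orthogonal to all of these.\<close>

lemma resid_orth_resid:
  assumes "k \<le> T" "l < k"
  shows "ip (\<lambda>\<omega>. resid k \<omega> $ i) (\<lambda>\<omega>. resid l \<omega> $ i') = 0"
proof -
  have "ip (\<lambda>\<omega>. resid k \<omega> $ i) (\<lambda>\<omega>. ups l j \<omega> $ a) = 0" if "j < l" for j a
    unfolding ups_def vec_lambda_beta
    by (intro ip_diff_zero ip_lincomb_zero iotaH H_lincomb coords_JH residH resid_orth_iota)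
      (use assms that in \<open>auto simp: coords_def[abs_def] resid_orth_J\<close>)
  then have "ip (\<lambda>\<omega>. resid k \<omega> $ i) (regr l v) = 0" if "v \<in> regr_index l" for v
    using that assms by (auto simp: regr_def regr_index_def resid_orth_iota)
  then show ?thesis unfolding resid_def[of l] vec_lambda_beta
    by (intro ip_diff_zero ip_lincomb_zero residH JH regrH H_lincomb resid_orth_J) (use assms in auto)
qed

section \<open>Versions of the conditional expectations and the representation of the input\<close>

lemma y_measurable: "k \<le> T \<Longrightarrow> y k \<in> borel_measurable M"
  using yH by (auto simp: borel_measurable_vec_iff intro: H_measurable)

lemma J_measurable: "k \<le> T \<Longrightarrow> J k \<in> borel_measurable M"
  using JH by (auto simp: borel_measurable_vec_iff intro: H_measurable)

lemma x_measurable: "k \<le> T \<Longrightarrow> x k \<in> borel_measurable M"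
  using xH by (auto simp: borel_measurable_vec_iff intro: H_measurable)

lemma innov_measurable: "k \<le> T \<Longrightarrow> innov M C x y k \<in> borel_measurable M"
proof (cases "k = 0")
  case False
  assume k: "k \<le> T"
  have "(\<lambda>\<omega>. vcond_exp M F (x k) \<omega> $ i) \<in> borel_measurable M" for F i
    unfolding vcond_exp_def vec_lambda_beta by simp
  then show ?thesis using False y_measurable[OF k] unfolding innov_def borel_measurable_vec_iff
    by (auto simp: matrix_vector_mult_def intro!: borel_measurable_diff borel_measurable_sum borel_measurable_times)
qed (simp add: innov_def y_measurable)

lemma innov_eq: "k \<le> T \<Longrightarrow> AE \<omega> in M. innov M C x y k \<omega> = iota k \<omega>"
proof (cases "k = 0")
  case True
  then show ?thesis by (simp add: innov_def iota_def xpred_def vec_eq_iff)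
next
  case False
  assume k: "k \<le> T"
  have "AE \<omega> in M. vcond_exp M (sigma (space M) (gen_sa M {..<k} y)) (x k) \<omega> =
    (\<chi> i. \<Sum>p\<in>{..<k} \<times> UNIV. proj_coeff ({..<k} \<times> UNIV) (coords y) (\<lambda>\<omega>. x k \<omega> $ i) p * coords y p \<omega>)"
    by (rule vcond_exp_eq_projection) (use k in \<open>auto intro: yH xH x_measurable\<close>)
  then show ?thesis
    by eventually_elim (simp add: False innov_def iota_def xpred_def vec_eq_iff matrix_vector_mult_def)
qed

lemma upsilon_eq:
  assumes "k \<le> T" "j \<le> T" shows "AE \<omega> in M. upsilon M C x y J k j \<omega> = ups k j \<omega>"
proof -
  have "AE \<omega> in M. vcond_exp M (sigma (space M) (gen_sa M {..<k} J)) (innov M C x y j) \<omega> =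
    (\<chi> i. \<Sum>p\<in>{..<k} \<times> UNIV. proj_coeff ({..<k} \<times> UNIV) (coords J) (\<lambda>\<omega>. iota j \<omega> $ i) p * coords J p \<omega>)"
    by (rule vcond_exp_eq_projection) (use assms in \<open>auto intro: JH iotaH innov_measurable innov_eq\<close>)
  with innov_eq[OF assms(2)] show ?thesis
    by eventually_elim (simp add: upsilon_def ups_def vec_eq_iff)
qed

text \<open>The definition of \<open>resid\<close> rearranged. It holds only almost everywhere
  because \<open>innov\<close> and \<open>upsilon\<close> contain versions of conditional
  expectations.\<close>

lemma J_representation:
  assumes k: "k \<le> T"
  shows "AE \<omega> in M. J k \<omega> = (\<chi> i a. gain k i (Inl a)) *v innov M C x y k \<omega>
    + (\<Sum>j<k. (\<chi> i a. gain k i (Inr (j, a))) *v upsilon M C x y J k j \<omega>) + resid k \<omega>"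
proof -
  have "AE \<omega> in M. \<forall>j\<in>{..<k}. upsilon M C x y J k j \<omega> = ups k j \<omega>"
    using k by (intro AE_finite_allI upsilon_eq) auto
  with innov_eq[OF k] show ?thesis
  proof eventually_elim
    case (elim \<omega>)
    have "(\<Sum>v\<in>regr_index k. gain k i v * regr k v \<omega>) = (\<Sum>a\<in>UNIV. gain k i (Inl a) * iota k \<omega> $ a)
      + (\<Sum>j<k. \<Sum>a\<in>UNIV. gain k i (Inr (j, a)) * ups k j \<omega> $ a)" for i
      by (simp add: regr_index_def sum.Plus regr_def sum.cartesian_product split_beta)
    then show ?case using elim
      by (simp add: vec_eq_iff resid_def matrix_vector_mult_def)
  qed
qed

lemma resid_gauss_vec:
  assumes "k \<le> T"
  shows "gauss_vec M (resid k) 0 (\<chi> i j. ip (\<lambda>\<omega>. resid k \<omega> $ i) (\<lambda>\<omega>. resid k \<omega> $ j))"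
proof -
  have "normal_rv M (\<lambda>\<omega>. \<Sum>i\<in>UNIV. c i * resid k \<omega> $ i) 0
    (\<Sum>i\<in>UNIV. \<Sum>j\<in>UNIV. c i * c j * ip (\<lambda>\<omega>. resid k \<omega> $ i) (\<lambda>\<omega>. resid k \<omega> $ j))" for c
    using H_normal[OF H_lincomb[of UNIV "\<lambda>i \<omega>. resid k \<omega> $ i" c]] residH[OF assms]
    by (simp add: corr_lincomb_self H_sq_integrable)
  then show ?thesis unfolding gauss_vec_def gauss_family_def
    using residH[OF assms] by (auto simp: borel_measurable_vec_iff intro: H_measurable)
qed

text \<open>Independence is claimed from all outputs and past inputs jointly, not from each family
  separately. Therefore both are merged into one family \<open>?G\<close> before orthogonality is
  turned into independence.\<close>

lemma resid_indep:
  assumes k: "k \<le> T"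
  shows "indep_set (vsa M (resid k)) (sigma_sets (space M) (gen_sa M {..T} y \<union> gen_sa M {..<k} J))"
proof -
  let ?G = "gen_sa M (({..T} \<times> UNIV) <+> ({..<k} \<times> UNIV)) (case_sum (coords y) (coords J))"
  have "indep_set (sigma_sets (space M) (gen_sa M ({k} \<times> UNIV) (coords resid))) (sigma_sets (space M) ?G)"
  proof (rule indep_of_orthogonal)
    show "ip (coords resid i) (case_sum (coords y) (coords J) j) = 0"
      if "i \<in> {k} \<times> UNIV" "j \<in> ({..T} \<times> UNIV) <+> ({..<k} \<times> UNIV)" for i j
      using that k by (auto simp: coords_def[abs_def] resid_orth_y resid_orth_J)
  qed (use k in \<open>auto intro!: coords_yH coords_JH simp: coords_def[of resid, abs_def] residH\<close>)
  then have i: "indep_set (vsa M (resid k)) (sigma_sets (space M) ?G)"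
    by (simp only: vsa_eq_gen_sa sigma_gen_sa_coords[of M "{k}" resid])
  have "?G = gen_sa M ({..T} \<times> UNIV) (coords y) \<union> gen_sa M ({..<k} \<times> UNIV) (coords J)"
    unfolding gen_sa_def by (auto simp: Plus_def)
  then have "sigma_sets (space M) (gen_sa M {..T} y) \<subseteq> sigma_sets (space M) ?G"
    "sigma_sets (space M) (gen_sa M {..<k} J) \<subseteq> sigma_sets (space M) ?G"
    unfolding sigma_gen_sa_coords[of M _ y] sigma_gen_sa_coords[of M _ J]
    by (auto intro!: sigma_sets_mono')
  then have "gen_sa M {..T} y \<union> gen_sa M {..<k} J \<subseteq> sigma_sets (space M) ?G"
    by (auto intro: sigma_sets.Basic)
  then have "sigma_sets (space M) (gen_sa M {..T} y \<union> gen_sa M {..<k} J) \<subseteq> sigma_sets (space M) ?G"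
    by (rule sigma_sets_mono)
  with i show ?thesis unfolding indep_sets2_eq by blast
qed

lemma resid_white: "indep_sets (\<lambda>k. vsa M (resid k)) {..T}"
proof (rule indep_sets_sequential)
  fix k assume k: "k \<le> T"
  have i: "indep_set (sigma_sets (space M) (gen_sa M ({k} \<times> UNIV) (coords resid))) (sigma_sets (space M) (gen_sa M ({..<k} \<times> UNIV) (coords resid)))"
    by (rule indep_of_orthogonal) (use k in \<open>auto simp: coords_def[abs_def] residH resid_orth_resid\<close>)
  have "vsa M (resid l) \<subseteq> sigma_sets (space M) (gen_sa M {..<k} resid)" if "l < k" for l
    unfolding vsa_eq_gen_sa using that by (intro sigma_sets_mono') (auto simp: gen_sa_def)
  then have "sigma_sets (space M) (\<Union>l<k. vsa M (resid l)) \<subseteq> sigma_sets (space M) (gen_sa M {..<k} resid)"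
    by (intro sigma_sets_mono) auto
  with i show "indep_set (vsa M (resid k)) (sigma_sets (space M) (\<Union>l<k. vsa M (resid l)))"
    unfolding sigma_gen_sa_coords[symmetric] vsa_eq_gen_sa[of M resid k] indep_sets2_eq by blast
qed

end

section \<open>The theorem\<close>

text \<open>\<open>gauss_family\<close> prescribes variances of combinations, so it fixes
  \<open>K\<close> only through its quadratic form. Indicator vectors recover the second moments
  from that form; off the diagonal they see the sum \<open>K i j + K j i\<close>, which is why both
  entries appear.\<close>

lemma (in prob_space) centered_gauss_family:
  assumes g: "gauss_family M S Z (\<lambda>_. 0) K"
  shows centered_gauss_family_sq_integrable: "i \<in> S \<Longrightarrow> sq_integrable M (Z i)"
    and centered_gauss_family_variance: "corr M (\<lambda>\<omega>. \<Sum>i\<in>S. c i * Z i \<omega>) (\<lambda>\<omega>. \<Sum>i\<in>S. c i * Z i \<omega>) = (\<Sum>i\<in>S. \<Sum>j\<in>S. c i * c j * K i j)"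
    and centered_gauss_family_uncorrelated: "i \<in> S \<Longrightarrow> j \<in> S \<Longrightarrow> i \<noteq> j \<Longrightarrow> K i j = 0 \<Longrightarrow> K j i = 0 \<Longrightarrow> corr M (Z i) (Z j) = 0"
proof -
  have fin: "finite S" and n: "normal_rv M (\<lambda>\<omega>. \<Sum>i\<in>S. c i * Z i \<omega>) 0 (\<Sum>i\<in>S. \<Sum>j\<in>S. c i * c j * K i j)" for c
    using g by (auto simp: gauss_family_def)
  have var: "corr M (\<lambda>\<omega>. \<Sum>i\<in>S. c i * Z i \<omega>) (\<lambda>\<omega>. \<Sum>i\<in>S. c i * Z i \<omega>) = (\<Sum>i\<in>S. \<Sum>j\<in>S. c i * c j * K i j)" for c
    using centered_normal_rv_moments(4)[OF n[of c]] by (simp add: corr_def power2_eq_square)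
  then show "corr M (\<lambda>\<omega>. \<Sum>i\<in>S. c i * Z i \<omega>) (\<lambda>\<omega>. \<Sum>i\<in>S. c i * Z i \<omega>) = (\<Sum>i\<in>S. \<Sum>j\<in>S. c i * c j * K i j)" .
  have supp: "(\<Sum>a\<in>S. (if a \<in> F then 1 else 0) * f a) = (\<Sum>a\<in>F. f a)" if "F \<subseteq> S" for F and f :: "'b \<Rightarrow> real"
    using fin that by (simp add: if_distrib if_distribR sum.If_cases Int_absorb1 cong: if_cong)
  have Q: "corr M (\<lambda>\<omega>. \<Sum>a\<in>F. Z a \<omega>) (\<lambda>\<omega>. \<Sum>a\<in>F. Z a \<omega>) = (\<Sum>a\<in>F. \<Sum>b\<in>F. K a b)" if F: "F \<subseteq> S" for F
    using var[of "\<lambda>a. if a \<in> F then 1 else 0"]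
    unfolding mult.assoc sum_distrib_left[symmetric] supp[OF F] .
  show sq: "sq_integrable M (Z i)" if "i \<in> S" for i
    using centered_normal_rv_moments(2)[OF n[of "\<lambda>a. if a \<in> {i} then 1 else 0"]] g that
    unfolding supp[of "{i}", OF insert_subsetI[OF that empty_subsetI]]
    by (auto simp: sq_integrable_def gauss_family_def)
  show "corr M (Z i) (Z j) = 0" if ij: "i \<in> S" "j \<in> S" "i \<noteq> j" "K i j = 0" "K j i = 0" for i j
  proof -
    have "K i i + K j j = corr M (\<lambda>\<omega>. \<Sum>a\<in>{i, j}. 1 * Z a \<omega>) (\<lambda>\<omega>. \<Sum>a\<in>{i, j}. 1 * Z a \<omega>)"
      using Q[of "{i, j}"] ij by simp
    also have "\<dots> = (\<Sum>a\<in>{i, j}. \<Sum>b\<in>{i, j}. 1 * 1 * corr M (Z a) (Z b))"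
      by (rule corr_lincomb_self) (use ij sq in auto)
    also have "\<dots> = K i i + K j j + 2 * corr M (Z i) (Z j)"
      using Q[of "{i}"] Q[of "{j}"] ij corr_sym[of M "Z j" "Z i"] by simp
    finally show ?thesis by simp
  qed
qed

lemma cond_indep_coords:
  "cond_indep M (gen_sa M S1 X) (gen_sa M S2 Y) (gen_sa M S3 V) \<longleftrightarrow>
   cond_indep M (gen_sa M (S1 \<times> UNIV) (coords X)) (gen_sa M (S2 \<times> UNIV) (coords Y)) (gen_sa M (S3 \<times> UNIV) (coords V))"
  unfolding cond_indep_def sigma_gen_sa_coords[of M S1] sigma_gen_sa_coords[of M S2] sigma_gen_sa_coords'[of M S3] ..

context centered_gaussian_space
begin

text \<open>The covariance is matched as a quadratic form: \<open>gauss_family\<close> sees nothing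
  more of \<open>K\<close>, and the covariance parameters \<open>P0\<close> and \<open>Q\<close> are
  not assumed symmetric.\<close>

lemma gauss_familyI:
  assumes "finite S" "\<And>i. i \<in> S \<Longrightarrow> Z i \<in> H"
    "\<And>c. (\<Sum>i\<in>S. \<Sum>j\<in>S. c i * c j * ip (Z i) (Z j)) = (\<Sum>i\<in>S. \<Sum>j\<in>S. c i * c j * K i j)"
  shows "gauss_family M S Z (\<lambda>_. 0) K"
proof -
  have "normal_rv M (\<lambda>\<omega>. \<Sum>i\<in>S. c i * Z i \<omega>) 0 (\<Sum>i\<in>S. \<Sum>j\<in>S. c i * c j * K i j)" for c
    using H_normal[OF H_lincomb[of S Z c]] assms by (simp add: corr_lincomb_self H_sq_integrable)
  then show ?thesis using assms by (auto simp: gauss_family_def intro: H_measurable)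
qed

text \<open>\<open>X\<close> and \<open>Y\<close> lie in the Gaussian space, so the conditional
  expectation given \<open>Y\<close> is the linear projection. \<open>J\<close> enters as merely
  square integrable, which is the situation of the given input.\<close>

lemma cond_indep_resid_uncorrelated:
  fixes X :: "nat \<Rightarrow> 'a \<Rightarrow> real^'d" and J :: "nat \<Rightarrow> 'a \<Rightarrow> real^'e" and Y :: "nat \<Rightarrow> 'a \<Rightarrow> real^'f"
  assumes ci: "cond_indep M (gen_sa M S1 J) (gen_sa M S2 X) (gen_sa M S3 Y)"
    and fin: "finite S3" and XH: "\<And>l j. l \<in> S2 \<Longrightarrow> (\<lambda>\<omega>. X l \<omega> $ j) \<in> H" and YH: "\<And>l j. l \<in> S3 \<Longrightarrow> (\<lambda>\<omega>. Y l \<omega> $ j) \<in> H"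
    and J: "\<And>k i. k \<in> S1 \<Longrightarrow> sq_integrable M (\<lambda>\<omega>. J k \<omega> $ i)" and l: "l \<in> S2" and k: "k \<in> S1"
  shows "ip (\<lambda>\<omega>. X l \<omega> $ j - (\<Sum>p\<in>S3 \<times> UNIV. proj_coeff (S3 \<times> UNIV) (coords Y) (\<lambda>\<omega>. X l \<omega> $ j) p * coords Y p \<omega>)) (\<lambda>\<omega>. J k \<omega> $ i) = 0"
proof -
  let ?P = "\<lambda>\<omega>. \<Sum>p\<in>S3 \<times> UNIV. proj_coeff (S3 \<times> UNIV) (coords Y) (\<lambda>\<omega>. X l \<omega> $ j) p * coords Y p \<omega>"
  have Jm: "J k \<in> borel_measurable M" if "k \<in> S1" for k
    using J[OF that] by (auto simp: borel_measurable_vec_iff sq_integrable_def)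
  have Xm: "X k \<in> borel_measurable M" if "k \<in> S2" for k
    using XH[OF that] by (auto simp: borel_measurable_vec_iff intro: H_measurable)
  have Ym: "Y k \<in> borel_measurable M" if "k \<in> S3" for k
    using YH[OF that] by (auto simp: borel_measurable_vec_iff intro: H_measurable)
  have cH: "coords Y p \<in> H" if "p \<in> S3 \<times> UNIV" for p
    using YH[of "fst p" "snd p"] that unfolding coords_def[abs_def] by auto
  have PH: "?P \<in> H" by (rule H_lincomb[OF cH])
  have "(\<integral>\<omega>. J k \<omega> $ i * (X l \<omega> $ j - ?P \<omega>) \<partial>M) = 0"
  proof (rule cond_indep_imp_uncorrelated[OF ci])
    show "gen_sa M S1 J \<subseteq> events" "gen_sa M S2 X \<subseteq> events" "gen_sa M S3 Y \<subseteq> events"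
      by (rule gen_sa_subset_sets; use Jm Xm Ym in blast)+
    show "(\<lambda>\<omega>. J k \<omega> $ i) \<in> borel_measurable (sigma (space M) (gen_sa M S1 J))"
      using measurable_gen_sa[OF k, of J M] by (simp add: borel_measurable_vec_iff)
    show "(\<lambda>\<omega>. X l \<omega> $ j) \<in> borel_measurable (sigma (space M) (gen_sa M S2 X))"
      using measurable_gen_sa[OF l, of X M] by (simp add: borel_measurable_vec_iff)
    show "AE \<omega> in M. real_cond_exp M (sigma (space M) (gen_sa M S3 Y)) (\<lambda>\<omega>. X l \<omega> $ j) \<omega> = ?P \<omega>"
      unfolding sigma_gen_sa_coords'
      by (rule cond_exp_eq_projection) (use fin cH XH l in \<open>auto intro!: proj_coeff\<close>)
    show "integrable M (\<lambda>\<omega>. J k \<omega> $ i * (X l \<omega> $ j - ?P \<omega>))"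
      by (rule sq_integrable_mult[OF J[OF k] H_sq_integrable[OF H_diff[OF XH[OF l] PH]]])
  qed (use PH XH l H_measurable H_integrable in auto)
  then show ?thesis by (simp add: corr_def mult.commute)
qed

end

text \<open>The coefficients \<open>d\<close> are the same numbers on both spaces, so projection
  equations solved with the original variables stay valid for the Gaussian copy.\<close>

lemma corr_resid_transfer:
  fixes Z :: "'i \<Rightarrow> 'a \<Rightarrow> real" and Z' :: "'i \<Rightarrow> 'b \<Rightarrow> real"
  assumes sq: "\<And>a. a \<in> S \<Longrightarrow> sq_integrable M (Z a)" "\<And>a. a \<in> S \<Longrightarrow> sq_integrable M' (Z' a)"
    and eq: "\<And>a b. a \<in> S \<Longrightarrow> b \<in> S \<Longrightarrow> corr M' (Z' a) (Z' b) = corr M (Z a) (Z b)"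
    and S: "a \<in> S" "b \<in> S" "\<And>p. p \<in> F \<Longrightarrow> f p \<in> S"
  shows "corr M' (\<lambda>\<omega>. Z' a \<omega> - (\<Sum>p\<in>F. d p * Z' (f p) \<omega>)) (Z' b) = corr M (\<lambda>\<omega>. Z a \<omega> - (\<Sum>p\<in>F. d p * Z (f p) \<omega>)) (Z b)"
proof -
  have "corr M' (\<lambda>\<omega>. Z' a \<omega> - (\<Sum>p\<in>F. d p * Z' (f p) \<omega>)) (Z' b) = corr M' (Z' a) (Z' b) - (\<Sum>p\<in>F. d p * corr M' (Z' (f p)) (Z' b))"
    by (rule corr_resid) (use sq S in auto)
  also have "\<dots> = corr M (Z a) (Z b) - (\<Sum>p\<in>F. d p * corr M (Z (f p)) (Z b))"
    using eq S by (simp cong: sum.cong)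
  also have "\<dots> = corr M (\<lambda>\<omega>. Z a \<omega> - (\<Sum>p\<in>F. d p * Z (f p) \<omega>)) (Z b)"
    by (rule corr_resid[symmetric]) (use sq S in auto)
  finally show ?thesis .
qed

lemma corr_resid_resid_transfer:
  fixes Z :: "'i \<Rightarrow> 'a \<Rightarrow> real" and Z' :: "'i \<Rightarrow> 'b \<Rightarrow> real"
  assumes sq: "\<And>a. a \<in> S \<Longrightarrow> sq_integrable M (Z a)" "\<And>a. a \<in> S \<Longrightarrow> sq_integrable M' (Z' a)"
    and eq: "\<And>a b. a \<in> S \<Longrightarrow> b \<in> S \<Longrightarrow> corr M' (Z' a) (Z' b) = corr M (Z a) (Z b)"
    and S: "a \<in> S" "\<And>p. p \<in> F \<Longrightarrow> f p \<in> S"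
  shows "corr M' (\<lambda>\<omega>. Z' a \<omega> - (\<Sum>p\<in>F. d p * Z' (f p) \<omega>)) (\<lambda>\<omega>. Z' a \<omega> - (\<Sum>p\<in>F. d p * Z' (f p) \<omega>))
    = corr M (\<lambda>\<omega>. Z a \<omega> - (\<Sum>p\<in>F. d p * Z (f p) \<omega>)) (\<lambda>\<omega>. Z a \<omega> - (\<Sum>p\<in>F. d p * Z (f p) \<omega>))"
  using sq eq S by (simp add: corr_resid_resid cong: sum.cong)

text \<open>State and outputs are rebuilt together with the input on a new space, and
  \<open>joint_law\<close> ties them to the original ones. \<open>\<Phi> k j\<close> is the block of
  the matrix \<phi> at time \<open>k\<close> that acts on block \<open>j\<close> of
  \<open>upsilon\<close>.\<close>

theorem theorem4:
  fixes M :: "'a measure" and T :: nat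
    and A :: "nat \<Rightarrow> real^'n::finite^'n" and C :: "nat \<Rightarrow> real^'n^'m::finite"
    and P0 :: "real^'n^'n" and Q :: "nat \<Rightarrow> real^'n^'n" and R :: "nat \<Rightarrow> real^'m^'m"
    and x q :: "nat \<Rightarrow> 'a \<Rightarrow> real^'n" and y r :: "nat \<Rightarrow> 'a \<Rightarrow> real^'m"
    and \<alpha> :: "nat \<Rightarrow> real" and Jc :: "nat \<Rightarrow> 'a \<Rightarrow> real^'n" and Cost :: real
  assumes model: "lgssm M T A C P0 Q R x y q r"
    and alpha_nonneg: "\<forall>k\<le>T. \<alpha> k \<ge> 0"
    and Jc_adm: "admissible M T P0 Q x y Jc"
    and Jc_cost: "wmse M \<alpha> x (est A Jc) T = Cost"
  shows "\<exists>(M' :: (nat \<Rightarrow> real) measure) x' y' J w W \<pi> \<Phi>.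
     prob_space M' \<and>
     (\<forall>k\<le>T. x' k \<in> borel_measurable M' \<and> y' k \<in> borel_measurable M') \<and>
     joint_law M' T x' y' = joint_law M T x y \<and>
     jointly_gaussian M' (({..T} \<times> UNIV) <+> ({..T} \<times> UNIV))
        (case_sum (\<lambda>(k, i) \<omega>. J k \<omega> $ i) (\<lambda>(k, i) \<omega>. y' k \<omega> $ i)) \<and>
     admissible M' T P0 Q x' y' J \<and>
     wmse M' \<alpha> x' (est A J) T = Cost \<and>
     (\<forall>k\<le>T. AE \<omega> in M'. J k \<omega> =
          (\<pi> k :: real^'m^'n) *v innov M' C x' y' k \<omega>
          + (\<Sum>j<k. (\<Phi> k j :: real^'m^'n) *v upsilon M' C x' y' J k j \<omega>) + w k \<omega>) \<and>
     (\<forall>k\<le>T. gauss_vec M' (w k) 0 (W k)) \<and>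
     prob_space.indep_sets M' (\<lambda>k. vsa M' (w k)) {..T} \<and>
     (\<forall>k\<le>T. prob_space.indep_set M' (vsa M' (w k))
          (sigma_sets (space M') (gen_sa M' {..T} y' \<union> gen_sa M' {..<k} J)))"
proof -
  obtain H where HM: "centered_gaussian_space M H" and xH: "\<And>k i. k \<le> T \<Longrightarrow> (\<lambda>\<omega>. x k \<omega> $ i) \<in> H"
    and yH: "\<And>k j. k \<le> T \<Longrightarrow> (\<lambda>\<omega>. y k \<omega> $ j) \<in> H"
    and noise: "\<And>k l j j'. k \<le> T \<Longrightarrow> l \<le> T \<Longrightarrow> k \<noteq> l \<Longrightarrow>
      corr M (\<lambda>\<omega>. y k \<omega> $ j - (\<Sum>i\<in>UNIV. C k $ j $ i * x k \<omega> $ i)) (\<lambda>\<omega>. y l \<omega> $ j') = 0"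
    using lgssm_gaussian[OF model] by auto
  interpret M: centered_gaussian_space M H by (rule HM)
  define KJ where "KJ = (\<lambda>(k, i) (l, j). if k = l then (if k = 0 then P0 else Q k) $ i $ j else 0)"
  have gJ: "gauss_family M ({..T} \<times> UNIV) (coords Jc) (\<lambda>_. 0) KJ"
    using Jc_adm unfolding admissible_def KJ_def coords_split by blast
  have sqJ: "sq_integrable M (\<lambda>\<omega>. Jc k \<omega> $ i)" if "k \<le> T" for k i
    using M.centered_gauss_family_sq_integrable[OF gJ, of "(k, i)"] that by (simp add: coords_def[abs_def])
  let ?S2 = "({..T} \<times> (UNIV :: 'n set)) <+> ({..T} \<times> (UNIV :: 'm set))"
  let ?S = "?S2 <+> ({..T} \<times> (UNIV :: 'n set))"
  \<comment> \<open>State, outputs and given input as one flat scalar family: square integrable, but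
    in general not Gaussian.\<close>
  define Z where "Z = case_sum (vec_coords x y) (coords Jc)"
  have vH: "vec_coords x y a \<in> H" if "a \<in> ?S2" for a
    using that by (auto simp: vec_coords_def intro: xH yH)
  have sqZ: "sq_integrable M (Z a)" if "a \<in> ?S" for a
  proof (cases a)
    case (Inl b)
    then have "vec_coords x y b \<in> H" using that by (intro vH) (simp add: Plus_def image_iff)
    then show ?thesis using Inl by (simp add: Z_def M.H_sq_integrable)
  next
    case (Inr p)
    then show ?thesis using that by (auto simp: Z_def coords_def[abs_def] intro!: sqJ)
  qed
  have fin: "finite ?S" by simp
  \<comment> \<open>An array of actual second moments is symmetric and positive semidefinite, which
    is all that a Gaussian realization requires.\<close>
  have psd: "0 \<le> (\<Sum>a\<in>?S. \<Sum>b\<in>?S. c a * c b * corr M (Z a) (Z b))" for c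
    using corr_self_nonneg[of M "\<lambda>\<omega>. \<Sum>a\<in>?S. c a * Z a \<omega>"] corr_lincomb_self[of ?S M Z c, OF sqZ] by simp
  have "\<exists>(M' :: (nat \<Rightarrow> real) measure) H' Z'. centered_gaussian_space M' H' \<and> (\<forall>a\<in>?S. Z' a \<in> H') \<and>
    (\<forall>a\<in>?S. \<forall>b\<in>?S. corr M' (Z' a) (Z' b) = corr M (Z a) (Z b))"
    (is "\<exists>M' H' Z'. ?R M' H' Z'")
    by (rule gaussian_realization[OF fin corr_sym psd])
  then obtain M' H' Z' where realization: "?R M' H' Z'"
    by (elim exE)
  have HM': "centered_gaussian_space M' H'" and ZH': "\<And>a. a \<in> ?S \<Longrightarrow> Z' a \<in> H'"
    and eq: "\<And>a b. a \<in> ?S \<Longrightarrow> b \<in> ?S \<Longrightarrow> corr M' (Z' a) (Z' b) = corr M (Z a) (Z b)"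
    using realization by (simp_all only:)
  interpret M': centered_gaussian_space M' H' by (rule HM')
  have sqZ': "sq_integrable M' (Z' a)" if "a \<in> ?S" for a using M'.H_sq_integrable[OF ZH'[OF that]] .
  define x' where "x' k \<omega> = (\<chi> i. Z' (Inl (Inl (k, i))) \<omega>)" for k \<omega>
  define y' where "y' k \<omega> = (\<chi> i. Z' (Inl (Inr (k, i))) \<omega>)" for k \<omega>
  define J where "J k \<omega> = (\<chi> i. Z' (Inr (k, i)) \<omega>)" for k \<omega>
  \<comment> \<open>Dictionary between vectors and the flat family; it is read in both directions,
    since the transfer lemmas speak of \<open>Z\<close> and \<open>Z'\<close>.\<close>
  have Zx: "Z (Inl (Inl (k, i))) = (\<lambda>\<omega>. x k \<omega> $ i)" and Zy: "Z (Inl (Inr (k, j))) = (\<lambda>\<omega>. y k \<omega> $ j)"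
    and ZJ: "Z (Inr (k, i)) = (\<lambda>\<omega>. Jc k \<omega> $ i)" for k i j
    by (simp_all add: Z_def vec_coords_def coords_def[abs_def])
  have Zx': "Z' (Inl (Inl (k, i))) = (\<lambda>\<omega>. x' k \<omega> $ i)" and Zy': "Z' (Inl (Inr (k, j))) = (\<lambda>\<omega>. y' k \<omega> $ j)"
    and ZJ': "Z' (Inr (k, i)) = (\<lambda>\<omega>. J k \<omega> $ i)" for k i j
    by (simp_all add: x'_def y'_def J_def)
  have cy: "coords y p = Z (Inl (Inr p))" and cy': "coords y' p = Z' (Inl (Inr p))" for p
    by (cases p; simp add: Zy Zy' coords_def[abs_def])+
  have cJ: "coords Jc p = Z (Inr p)" and cJ': "coords J p = Z' (Inr p)" for p
    by (cases p; simp add: ZJ ZJ' coords_def[abs_def])+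
  have cx': "coords x' p = Z' (Inl (Inl p))" for p
    by (cases p; simp add: Zx' coords_def[abs_def])
  have xZ: "x k \<omega> $ i = Z (Inl (Inl (k, i))) \<omega>" and yZ: "y k \<omega> $ j = Z (Inl (Inr (k, j))) \<omega>"
    and JZ: "Jc k \<omega> $ i = Z (Inr (k, i)) \<omega>" for k i j \<omega>
    by (simp_all add: Zx Zy ZJ)
  have xZ': "x' k \<omega> $ i = Z' (Inl (Inl (k, i))) \<omega>" and yZ': "y' k \<omega> $ j = Z' (Inl (Inr (k, j))) \<omega>"
    and JZ': "J k \<omega> $ i = Z' (Inr (k, i)) \<omega>" for k i j \<omega>
    by (simp_all add: Zx' Zy' ZJ')
  note transfer = corr_resid_transfer[OF sqZ sqZ' eq]
  have yS: "coords y p \<in> H" if "p \<in> {..k} \<times> UNIV" "k \<le> T" for k p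
    using that yH[of "fst p" "snd p"] by (auto simp: coords_def[abs_def])

  have Jc_causal: "cond_indep M (gen_sa M {k} Jc) (gen_sa M {k + n} y) (gen_sa M {..k} y)"
    if "k \<le> T" "1 \<le> n" "k + n \<le> T" for k n
    using Jc_adm that unfolding admissible_def by simp
  have noise': "corr M' (\<lambda>\<omega>. y' k \<omega> $ j - (\<Sum>i\<in>UNIV. C k $ j $ i * x' k \<omega> $ i)) (\<lambda>\<omega>. y' l \<omega> $ j') = 0"
    if "k \<le> T" "l < k" for k l j j'
  proof -
    have "corr M' (\<lambda>\<omega>. y' k \<omega> $ j - (\<Sum>i\<in>UNIV. C k $ j $ i * x' k \<omega> $ i)) (\<lambda>\<omega>. y' l \<omega> $ j')
        = corr M (\<lambda>\<omega>. y k \<omega> $ j - (\<Sum>i\<in>UNIV. C k $ j $ i * x k \<omega> $ i)) (\<lambda>\<omega>. y l \<omega> $ j')"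
      unfolding xZ yZ xZ' yZ' by (rule transfer) (use that in auto)
    then show ?thesis using noise[of k l j j'] that by simp
  qed
  have causal': "\<exists>d. (\<forall>p\<in>{..k} \<times> UNIV. corr M' (\<lambda>\<omega>. y' m \<omega> $ j - (\<Sum>p\<in>{..k} \<times> UNIV. d p * coords y' p \<omega>)) (coords y' p) = 0) \<and>
      (\<forall>i. corr M' (\<lambda>\<omega>. y' m \<omega> $ j - (\<Sum>p\<in>{..k} \<times> UNIV. d p * coords y' p \<omega>)) (\<lambda>\<omega>. J k \<omega> $ i) = 0)"
    if m: "m \<le> T" and km: "k < m" for m k j
  proof (intro exI conjI ballI allI)
    \<comment> \<open>The coefficients come from the original space, where conditional independence
      makes the residual orthogonal to the given input. Equal covariances let them serve unchanged
      on the new space.\<close>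
    let ?d = "M.proj_coeff ({..k} \<times> UNIV) (coords y) (\<lambda>\<omega>. y m \<omega> $ j)"
    have k: "k \<le> T" using m km by simp
    show "corr M' (\<lambda>\<omega>. y' m \<omega> $ j - (\<Sum>p\<in>{..k} \<times> UNIV. ?d p * coords y' p \<omega>)) (coords y' p) = 0" (is "?l p = 0")
      if p: "p \<in> {..k} \<times> UNIV" for p
    proof -
      have "?l p = corr M (\<lambda>\<omega>. y m \<omega> $ j - (\<Sum>p\<in>{..k} \<times> UNIV. ?d p * coords y p \<omega>)) (coords y p)"
        unfolding yZ' cy' unfolding Zy[symmetric] unfolding cy
        by (subst transfer) (use p m k in \<open>auto simp: Zy\<close>)
      also have "\<dots> = 0" by (rule M.proj_coeff) (use p k yH[OF m] in \<open>auto intro: yS\<close>)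
      finally show ?thesis .
    qed
    show "corr M' (\<lambda>\<omega>. y' m \<omega> $ j - (\<Sum>p\<in>{..k} \<times> UNIV. ?d p * coords y' p \<omega>)) (\<lambda>\<omega>. J k \<omega> $ i) = 0" (is "?l i = 0") for i
    proof -
      have "?l i = corr M (\<lambda>\<omega>. y m \<omega> $ j - (\<Sum>p\<in>{..k} \<times> UNIV. ?d p * coords y p \<omega>)) (\<lambda>\<omega>. Jc k \<omega> $ i)"
        unfolding yZ' cy' JZ' unfolding Zy[symmetric] unfolding cy JZ
        by (subst transfer) (use m k in \<open>auto simp: Zy\<close>)
      also have "\<dots> = 0"
      proof (rule M.cond_indep_resid_uncorrelated[of "{k}" Jc "{m}" y "{..k}" y])
        show "cond_indep M (gen_sa M {k} Jc) (gen_sa M {m} y) (gen_sa M {..k} y)"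
          using Jc_causal[of k "m - k"] k m km by simp
      qed (use k m yH sqJ in auto)
      finally show ?thesis .
    qed
  qed
  \<comment> \<open>The same transport for the other condition, independence of input and states
    given all outputs.\<close>
  have xproj': "\<exists>d. (\<forall>p\<in>{..T} \<times> UNIV. corr M' (\<lambda>\<omega>. x' l \<omega> $ j - (\<Sum>p\<in>{..T} \<times> UNIV. d p * coords y' p \<omega>)) (coords y' p) = 0) \<and>
      (\<forall>p\<in>{..T} \<times> UNIV. corr M' (\<lambda>\<omega>. x' l \<omega> $ j - (\<Sum>p\<in>{..T} \<times> UNIV. d p * coords y' p \<omega>)) (coords J p) = 0)"
    if l: "l \<le> T" for l j
  proof (intro exI conjI ballI)
    let ?d = "M.proj_coeff ({..T} \<times> UNIV) (coords y) (\<lambda>\<omega>. x l \<omega> $ j)"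
    show "corr M' (\<lambda>\<omega>. x' l \<omega> $ j - (\<Sum>p\<in>{..T} \<times> UNIV. ?d p * coords y' p \<omega>)) (coords y' p) = 0" (is "?l p = 0")
      if p: "p \<in> {..T} \<times> UNIV" for p
    proof -
      have "?l p = corr M (\<lambda>\<omega>. x l \<omega> $ j - (\<Sum>p\<in>{..T} \<times> UNIV. ?d p * coords y p \<omega>)) (coords y p)"
        unfolding xZ' cy' unfolding Zx[symmetric] unfolding cy
        by (subst transfer) (use p l in \<open>auto simp: Zx\<close>)
      also have "\<dots> = 0" by (rule M.proj_coeff) (use p xH[OF l] in \<open>auto intro: yS\<close>)
      finally show ?thesis .
    qed
    show "corr M' (\<lambda>\<omega>. x' l \<omega> $ j - (\<Sum>p\<in>{..T} \<times> UNIV. ?d p * coords y' p \<omega>)) (coords J p) = 0" (is "?l p = 0")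
      if p: "p \<in> {..T} \<times> UNIV" for p
    proof -
      have "?l p = corr M (\<lambda>\<omega>. x l \<omega> $ j - (\<Sum>p\<in>{..T} \<times> UNIV. ?d p * coords y p \<omega>)) (coords Jc p)"
        unfolding xZ' cy' cJ' unfolding Zx[symmetric] unfolding cy cJ
        by (subst transfer) (use p l in \<open>auto simp: Zx\<close>)
      also have "\<dots> = 0"
        unfolding coords_def[of Jc p, abs_def]
      proof (rule M.cond_indep_resid_uncorrelated[of "{..T}" Jc "{..T}" x "{..T}" y])
        show "cond_indep M (gen_sa M {..T} Jc) (gen_sa M {..T} x) (gen_sa M {..T} y)"
          using Jc_adm unfolding admissible_def by blast
      qed (use p l xH yH sqJ in auto)
      finally show ?thesis .
    qed
  qed
  \<comment> \<open>Whiteness is read off the block-diagonal covariance prescribed for the given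
    input.\<close>
  have white': "corr M' (\<lambda>\<omega>. J k \<omega> $ i) (\<lambda>\<omega>. J l \<omega> $ i') = 0" if "k \<le> T" "l \<le> T" "k \<noteq> l" for k l i i'
  proof -
    have "corr M' (Z' (Inr (k, i))) (Z' (Inr (l, i'))) = corr M (Z (Inr (k, i))) (Z (Inr (l, i')))"
      by (rule eq) (use that in auto)
    then show ?thesis
      using M.centered_gauss_family_uncorrelated[OF gJ, of "(k, i)" "(l, i')"] that
      by (simp add: cJ ZJ' KJ_def)
  qed
  interpret I: innovation_setup M' H' T C x' J y'
  proof
    show "(\<lambda>\<omega>. x' k \<omega> $ i) \<in> H'" if "k \<le> T" for k i
      using ZH'[of "Inl (Inl (k, i))"] that by (auto simp: Zx')
    show "(\<lambda>\<omega>. y' k \<omega> $ j) \<in> H'" if "k \<le> T" for k j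
      using ZH'[of "Inl (Inr (k, j))"] that by (auto simp: Zy')
    show "(\<lambda>\<omega>. J k \<omega> $ i) \<in> H'" if "k \<le> T" for k i
      using ZH'[of "Inr (k, i)"] that by (auto simp: ZJ')
  qed (fact noise' causal' white')+
  have cxH': "coords x' p \<in> H'" if "p \<in> {..T} \<times> UNIV" for p
    using ZH'[of "Inl (Inl p)"] that by (auto simp: cx')
  have law: "joint_law M' T x' y' = joint_law M T x y"
  proof (rule joint_law_eq[OF HM' HM _ vH])
    have v: "vec_coords x' y' a = Z' (Inl a)" "vec_coords x y a = Z (Inl a)" for a
      by (cases a; auto simp: vec_coords_def Zx' Zy' Zx Zy split_beta)+
    show "vec_coords x' y' a \<in> H'" if "a \<in> ?S2" for a unfolding v by (rule ZH'[OF InlI[OF that]])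
    show "corr M' (vec_coords x' y' a) (vec_coords x' y' b) = corr M (vec_coords x y a) (vec_coords x y b)"
      if "a \<in> ?S2" "b \<in> ?S2" for a b
      unfolding v by (rule eq[OF InlI[OF that(1)] InlI[OF that(2)]])
  qed
  \<comment> \<open>On both spaces the cost is the same expression in covariances, so no property of
    the estimator beyond linearity in the input is involved.\<close>
  have cost: "wmse M' \<alpha> x' (est A J) T = Cost"
  proof -
    have "sq_integrable M' (\<lambda>\<omega>. x' k \<omega> $ i)" "sq_integrable M' (\<lambda>\<omega>. J k \<omega> $ i)"
      "sq_integrable M (\<lambda>\<omega>. x k \<omega> $ i)" if "k \<le> T" for k i
      using that M'.H_sq_integrable M.H_sq_integrable I.xH I.JH xH by auto
    note sq = this
    have "wmse M' \<alpha> x' (est A J) T = wmse M \<alpha> x (est A Jc) T"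
      by ((subst wmse_eq_sum_corr[OF sq(1,2)]; assumption?), (subst wmse_eq_sum_corr[OF sq(3) sqJ]; assumption?),
          unfold xZ' JZ' xZ JZ,
          intro sum.cong refl arg_cong2[where f="(*)"] corr_resid_resid_transfer[OF sqZ sqZ' eq], auto)
    then show ?thesis using Jc_cost by simp
  qed
  \<comment> \<open>The covariances are compared as quadratic forms, because only in this form does
    \<open>gJ\<close> relate \<open>KJ\<close> to the given input.\<close>
  have gJ': "gauss_family M' ({..T} \<times> UNIV) (coords J) (\<lambda>_. 0) KJ"
  proof (rule M'.gauss_familyI)
    fix c
    have "(\<Sum>i\<in>{..T} \<times> UNIV. \<Sum>j\<in>{..T} \<times> UNIV. c i * c j * corr M' (coords J i) (coords J j))
        = (\<Sum>i\<in>{..T} \<times> UNIV. \<Sum>j\<in>{..T} \<times> UNIV. c i * c j * corr M (coords Jc i) (coords Jc j))"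
      unfolding cJ cJ' by (intro sum.cong refl arg_cong2[where f="(*)"] eq) auto
    also have "\<dots> = (\<Sum>i\<in>{..T} \<times> UNIV. \<Sum>j\<in>{..T} \<times> UNIV. c i * c j * KJ i j)"
      by (subst M.centered_gauss_family_variance[OF gJ, symmetric], rule corr_lincomb_self[symmetric])
        (rule M.centered_gauss_family_sq_integrable[OF gJ])
    finally show "(\<Sum>i\<in>{..T} \<times> UNIV. \<Sum>j\<in>{..T} \<times> UNIV. c i * c j * corr M' (coords J i) (coords J j))
        = (\<Sum>i\<in>{..T} \<times> UNIV. \<Sum>j\<in>{..T} \<times> UNIV. c i * c j * KJ i j)" .
  qed (auto intro: I.coords_JH)
  \<comment> \<open>On the new space all variables lie in one Gaussian space, so the transported
    orthogonality gives conditional independence back.\<close>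
  have smooth: "cond_indep M' (gen_sa M' {..T} J) (gen_sa M' {..T} x') (gen_sa M' {..T} y')"
    unfolding cond_indep_coords
  proof (rule M'.cond_indep_of_orthogonal)
    show "\<exists>d. (\<forall>p\<in>{..T} \<times> UNIV. corr M' (\<lambda>\<omega>. coords x' l \<omega> - (\<Sum>p\<in>{..T} \<times> UNIV. d p * coords y' p \<omega>)) (coords y' p) = 0) \<and>
      (\<forall>p\<in>{..T} \<times> UNIV. corr M' (\<lambda>\<omega>. coords x' l \<omega> - (\<Sum>p\<in>{..T} \<times> UNIV. d p * coords y' p \<omega>)) (coords J p) = 0)"
      if "l \<in> {..T} \<times> UNIV" for l
      using xproj'[of "fst l" "snd l"] that unfolding coords_def[of x' l] by auto
  qed (auto intro!: I.coords_JH I.coords_yH cxH')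
  have filt: "cond_indep M' (gen_sa M' {k} J) (gen_sa M' {k + n} y') (gen_sa M' {..k} y')"
    if kn: "k \<le> T" "n \<ge> 1" "k + n \<le> T" for k n
    unfolding cond_indep_coords
  proof (rule M'.cond_indep_of_orthogonal)
    show "\<exists>d. (\<forall>p\<in>{..k} \<times> UNIV. corr M' (\<lambda>\<omega>. coords y' l \<omega> - (\<Sum>p\<in>{..k} \<times> UNIV. d p * coords y' p \<omega>)) (coords y' p) = 0) \<and>
      (\<forall>p\<in>{k} \<times> UNIV. corr M' (\<lambda>\<omega>. coords y' l \<omega> - (\<Sum>p\<in>{..k} \<times> UNIV. d p * coords y' p \<omega>)) (coords J p) = 0)"
      if l: "l \<in> {k + n} \<times> UNIV" for l
    proof -
      obtain j where j: "l = (k + n, j)" using l by auto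
      have c: "coords y' l \<omega> = y' (k + n) \<omega> $ j" for \<omega> by (simp add: j coords_def)
      have cJ: "coords J (k, i) = (\<lambda>\<omega>. J k \<omega> $ i)" for i by (simp add: coords_def[abs_def])
      show ?thesis using causal'[of "k + n" k j] kn unfolding c by (auto simp: cJ)
    qed
  qed (use kn in \<open>auto intro!: I.coords_JH I.coords_yH\<close>)
  have adm: "admissible M' T P0 Q x' y' J"
    unfolding admissible_def coords_split KJ_def[symmetric]
    using I.J_measurable smooth gJ' filt by simp
  let ?JY = "case_sum (\<lambda>(k, i) \<omega>. J k \<omega> $ i) (\<lambda>(k, i) \<omega>. y' k \<omega> $ i)"
  have "?JY a \<in> H'" if "a \<in> ({..T} \<times> UNIV) <+> ({..T} \<times> UNIV)" for a
    using that by (auto intro: I.JH I.yH)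
  then have "gauss_family M' (({..T} \<times> UNIV) <+> ({..T} \<times> UNIV)) ?JY (\<lambda>_. 0) (\<lambda>a b. corr M' (?JY a) (?JY b))"
    by (intro M'.gauss_familyI) auto
  then have jg: "jointly_gaussian M' (({..T} \<times> UNIV) <+> ({..T} \<times> UNIV)) ?JY"
    unfolding jointly_gaussian_def by (intro exI)
  show ?thesis
    by (intro exI[of _ M'] exI[of _ x'] exI[of _ y'] exI[of _ J] exI[of _ I.resid]
        exI[of _ "\<lambda>k. \<chi> i j. corr M' (\<lambda>\<omega>. I.resid k \<omega> $ i) (\<lambda>\<omega>. I.resid k \<omega> $ j)"]
        exI[of _ "\<lambda>k. \<chi> i a. I.gain k i (Inl a)"] exI[of _ "\<lambda>k j. \<chi> i a. I.gain k i (Inr (j, a))"]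
        conjI allI impI M'.prob_space_axioms I.x_measurable I.y_measurable law jg adm cost
        I.J_representation I.resid_gauss_vec I.resid_white I.resid_indep)
qed

end
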